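(* Let $\Lambda$ be a finite, strongly connected $k$-graph with adjacency matrices $A_1,\dots,A_k$ such that $A=A_1\cdots A_k$ is irreducible. Let $\delta\in(0,1)$ and suppose that $w_\delta(\lambda)=\operatorname{diam}[\lambda]$ for all $\lambda\in F\mathcal{B}_\Lambda$ (diameter with respect to $d_{w_\delta}$). Then the eigenspaces $E_{-1}$, $E_0$, $E_\gamma$ ($\gamma\in F\mathcal{B}_\Lambda$) of the associated Laplace–Beltrami operators $\Delta_s$ refine the wavelet decomposition $L^2(\Lambda^\infty,M)=\mathscr{V}_0\oplus\bigoplus_{n\in\mathbb{N}}\mathcal{W}_n$: $$\mathscr{V}_0=E_{-1}\oplus E_0\quad\text{and}\quad\mathcal{W}_n=\operatorname{span}\{E_\gamma: |\gamma|=nk+t,\ 0\le t\le k-1\}\ \text{ for all } n\in\mathbb{N}.$$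
   Context: $\mathbb{N}=\{0,1,2,\dots\}$. A $k$-graph is a countable small category $\Lambda$ with a functor $d:\Lambda\to\mathbb{N}^k$ ($\mathbb{N}^k$ viewed as a one-object category) satisfying the factorization property: if $d(\lambda)=m+n$, there are unique $\mu,\nu\in\Lambda$ with $d(\mu)=m$, $d(\nu)=n$ and $\lambda=\mu\nu$. $r,s$ denote range and source of morphisms; $\Lambda^n=d^{-1}(n)$; $\Lambda^0$ is the set of vertices. $\Lambda$ is finite if every $\Lambda^n$ is finite, and strongly connected if for all $v,w\in\Lambda^0$ there is a morphism with range $v$ and source $w$. $A_i(v,w)=\#\{\lambda\in\Lambda^{e_i}: r(\lambda)=v,s(\lambda)=w\}$, $\rho_i$ is the spectral radius of $A_i$; $x^\Lambda\in(0,\infty)^{\Lambda^0}$ is the unique positive vector with $\sum_v x^\Lambda_v=1$ and $A_ix^\Lambda=\rho_ix^\Lambda$ for all $i$. $\Omega_k$ is the $k$-graph with objects $\mathbb{N}^k$, morphisms $\{(m,n):m\le n\}$, $r(m,n)=m$, $s(m,n)=n$, $d(m,n)=n-m$; $\Lambda^\infty$ is the set of degree-preserving functors $x:\Omega_k\to\Lambda$, topologized by the cylinder sets $[\lambda]=\{x:x(0,d(\lambda))=\lambda\}$, $\lambda\in\Lambda$. $M$ is the Borel probability measure on $\Lambda^\infty$ with $M([\lambda])=\rho_1^{-d(\lambda)_1}\cdots\rho_k^{-d(\lambda)_k}x^\Lambda_{s(\lambda)}$. The stationary $k$-Bratteli diagram $\mathcal{B}_\Lambda$ has vertex set $\bigsqcup_{n\ge0}\mathcal{V}_n$,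 each $\mathcal{V}_n$ a copy of $\Lambda^0$, and edges $\mathcal{E}_n$ ($n\ge1$) with source in $\mathcal{V}_n$ and range in $\mathcal{V}_{n-1}$; for $n\equiv i\pmod k$, $1\le i\le k$, the edges in $\mathcal{E}_n$ with range $p$ and source $q$ are the $A_i(p,q)$ elements of $\Lambda^{e_i}$ with range $p$ and source $q$. $F\mathcal{B}_\Lambda$ is the set of finite paths with range in $\mathcal{V}_0$ (length-$0$ paths being vertices of $\mathcal{V}_0$), $|\gamma|$ is length, $X_{\mathcal{B}_\Lambda}$ is the space of infinite paths starting from $\mathcal{V}_0$. Composing edges identifies $\gamma\in F\mathcal{B}_\Lambda$, $|\gamma|=qk+t$, $0\le t\le k-1$, with a morphism of $\Lambda$ of degree $(q+1,\dots,q+1,q,\dots,q)$ ($t$ entries $q+1$) and identifies $X_{\mathcal{B}_\Lambda}$ with $\Lambda^\infty$ homeomorphically, preserving the cylinder sets $[\gamma]$. For $|\eta|=qk+t$, $0\le t\le k-1$, $w_\delta(\eta)=\left(\rho_1^{q+1}\cdots\rho_t^{q+1}\rho_{t+1}^q\cdots\rho_k^q\right)^{-1/\delta}x^\Lambda_{s(\eta)}$; the metric is $d_{w_\delta}(x,x)=0$, $d_{w_\delta}(x,y)=1$ if $r(x)\ne r(y)$, and otherwise $d_{w_\delta}(x,y)=w_\delta(x\wedge y)$ with $x\wedge y$ the longest common initial segment in $F\mathcal{B}_\Lambda$. $\operatorname{diam}[\lambda]=\sup\{d_{w_\delta}(x,y):x,y\in[\lambda]\}$. The Dixmier trace measure $\mu=\mu_\delta$,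 $\mu_\delta([\gamma])=\lim_{s\searrow\delta}\big(\sum w_\delta(\lambda)^s\big)/\big(\sum_{\lambda\in F\mathcal{B}_\Lambda}w_\delta(\lambda)^s\big)$ (numerator over $\lambda\in F\mathcal{B}_\Lambda$ with initial segment $\gamma$), equals $M$ under the hypotheses of the claim. For $s\in\mathbb{R}$, $\Delta_s$ is the Pearson–Bellissard Laplace–Beltrami operator on $L^2(X_{\mathcal{B}_\Lambda},\mu)$ defined by $\langle f,\Delta_s g\rangle=\frac12\int_\Upsilon\mathrm{Tr}(|D|^{-s}[D,\pi_\tau(f)]^*[D,\pi_\tau(g)])\,d\nu(\tau)$. Here $\Upsilon$ is the set of choice functions, i.e. maps $\tau=(\tau_+,\tau_-)$ with $\tau(\gamma)\in[\gamma]\times[\gamma]$ and $d_{w_\delta}(\tau_+(\gamma),\tau_-(\gamma))=\operatorname{diam}[\gamma]$ for all $\gamma\in F\mathcal{B}_\Lambda$; $\nu$ is the measure on $\Upsilon$ induced from $\mu$; and on $\ell^2(F\mathcal{B}_\Lambda)\otimes\mathbb{C}^2$, $\pi_\tau(f)=\bigoplus_\gamma\mathrm{diag}(f(\tau_+(\gamma)),f(\tau_-(\gamma)))$ and $D=\bigoplus_\gamma\frac{1}{\operatorname{diam}[\gamma]}\begin{pmatrix}0&1\\1&0\end{pmatrix}$. By a theorem of Julien and Savinien, the eigenspaces of $\Delta_s$ are the following, independently of $s$: $E_{-1}=\operatorname{span}\{\chi_{\Lambda^\infty}\}$, $E_0=\operatorname{span}\{\frac{1}{\mu([v])}\chi_{[v]}-\frac{1}{\mu([v'])}\chi_{[v']}:v\ne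 v'\in\mathcal{V}_0\}$, and for $\gamma\in F\mathcal{B}_\Lambda$ $$E_\gamma=\operatorname{span}\Big\{\tfrac{1}{\mu([\gamma e])}\chi_{[\gamma e]}-\tfrac{1}{\mu([\gamma e'])}\chi_{[\gamma e']}:(e,e')\in\mathrm{ext}_1(\gamma)\Big\},$$ where $\mathrm{ext}_1(\gamma)$ is the set of pairs of edges $e\ne e'$ of $\mathcal{B}_\Lambda$ with $r(e)=r(e')=s(\gamma)$. The wavelet spaces are $\mathscr{V}_n=\operatorname{span}\{\chi_{[\lambda]}:\lambda\in\Lambda,\ d(\lambda)=(n,\dots,n)\}$ and $\mathcal{W}_n=\mathscr{V}_{n+1}\cap\mathscr{V}_n^\perp$ in $L^2(\Lambda^\infty,M)$. *)

theory Defs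
  imports "HOL-Probability.Probability" "HOL-Library.Function_Algebras" "HOL-Library.Sublist"
begin

section \<open>Higher-rank graphs\<close>

text \<open>Categories are one-sorted: an object is identified with its identity morphism, so that
  \<open>rng\<close> and \<open>src\<close> take values in the morphisms. Composition \<open>cmp \<mu> \<nu>\<close> is meaningful
  only if \<open>src \<mu> = rng \<nu>\<close>.\<close>

record 'a cat =
  mor :: "'a set"
  rng :: "'a \<Rightarrow> 'a"
  src :: "'a \<Rightarrow> 'a"
  cmp :: "'a \<Rightarrow> 'a \<Rightarrow> 'a"

locale small_category =
  fixes C :: "('a, 'b) cat_scheme"
  assumes rng_mor: "f \<in> mor C \<Longrightarrow> rng C f \<in> mor C"
    and src_mor: "f \<in> mor C \<Longrightarrow> src C f \<in> mor C"
    and rng_rng: "f \<in> mor C \<Longrightarrow> rng C (rng C f) = rng C f"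
    and src_rng: "f \<in> mor C \<Longrightarrow> src C (rng C f) = rng C f"
    and rng_src: "f \<in> mor C \<Longrightarrow> rng C (src C f) = src C f"
    and src_src: "f \<in> mor C \<Longrightarrow> src C (src C f) = src C f"
    and cmp_mor: "\<lbrakk>f \<in> mor C; g \<in> mor C; src C f = rng C g\<rbrakk> \<Longrightarrow> cmp C f g \<in> mor C"
    and rng_cmp: "\<lbrakk>f \<in> mor C; g \<in> mor C; src C f = rng C g\<rbrakk> \<Longrightarrow> rng C (cmp C f g) = rng C f"
    and src_cmp: "\<lbrakk>f \<in> mor C; g \<in> mor C; src C f = rng C g\<rbrakk> \<Longrightarrow> src C (cmp C f g) = src C g"
    and cmp_assoc: "\<lbrakk>f \<in> mor C; g \<in> mor C; h \<in> mor C; src C f = rng C g; src C g = rng C h\<rbrakk>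
      \<Longrightarrow> cmp C (cmp C f g) h = cmp C f (cmp C g h)"
    and cmp_rng: "f \<in> mor C \<Longrightarrow> cmp C (rng C f) f = f"
    and cmp_src: "f \<in> mor C \<Longrightarrow> cmp C f (src C f) = f"

definition functors :: "('a, 'c) cat_scheme \<Rightarrow> ('b, 'd) cat_scheme \<Rightarrow> ('a \<Rightarrow> 'b) set" where
  "functors C D = {F \<in> mor C \<rightarrow>\<^sub>E mor D.
     (\<forall>f \<in> mor C. F (rng C f) = rng D (F f) \<and> F (src C f) = src D (F f)) \<and>
     (\<forall>f \<in> mor C. \<forall>g \<in> mor C. src C f = rng C g \<longrightarrow> F (cmp C f g) = cmp D (F f) (F g))}"

text \<open>Elements of $\mathbb{N}^k$ are functions vanishing from \<open>k\<close> on; the coordinates are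
  numbered \<open>0, \<dots>, k - 1\<close> instead of \<open>1, \<dots>, k\<close>.\<close>

definition Nk :: "nat \<Rightarrow> (nat \<Rightarrow> nat) set" where
  "Nk k = {n. \<forall>i \<ge> k. n i = 0}"

definition unit_deg :: "nat \<Rightarrow> nat \<Rightarrow> nat" where
  "unit_deg i = (\<lambda>j. if j = i then 1 else 0)"

definition diag_deg :: "nat \<Rightarrow> nat \<Rightarrow> nat \<Rightarrow> nat" where
  "diag_deg k n = (\<lambda>i. if i < k then n else 0)"

record 'a kgraph = "'a cat" + deg :: "'a \<Rightarrow> nat \<Rightarrow> nat"

locale k_graph = small_category G for k :: nat and G :: "'a kgraph" +
  assumes countable_mor: "countable (mor G)"
    and deg_Nk: "f \<in> mor G \<Longrightarrow> deg G f \<in> Nk k"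
    and deg_id: "f \<in> mor G \<Longrightarrow> deg G (src G f) = 0 \<and> deg G (rng G f) = 0"
    and deg_cmp: "\<lbrakk>f \<in> mor G; g \<in> mor G; src G f = rng G g\<rbrakk>
      \<Longrightarrow> deg G (cmp G f g) = deg G f + deg G g"
    and factorization: "\<lbrakk>l \<in> mor G; m \<in> Nk k; n \<in> Nk k; deg G l = m + n\<rbrakk>
      \<Longrightarrow> \<exists>!(f, g). f \<in> mor G \<and> g \<in> mor G \<and> src G f = rng G g \<and>
            deg G f = m \<and> deg G g = n \<and> l = cmp G f g"

definition of_deg :: "'a kgraph \<Rightarrow> (nat \<Rightarrow> nat) \<Rightarrow> 'a set" where
  "of_deg G n = {l \<in> mor G. deg G l = n}"

text \<open>By the factorization property the morphisms of degree \<open>0\<close> are exactly the identities.\<close>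

abbreviation verts :: "'a kgraph \<Rightarrow> 'a set" where
  "verts G \<equiv> of_deg G 0"

definition finite_kgraph :: "nat \<Rightarrow> 'a kgraph \<Rightarrow> bool" where
  "finite_kgraph k G \<longleftrightarrow> (\<forall>n \<in> Nk k. finite (of_deg G n))"

definition strongly_connected :: "'a kgraph \<Rightarrow> bool" where
  "strongly_connected G \<longleftrightarrow>
     (\<forall>v \<in> verts G. \<forall>w \<in> verts G. \<exists>l \<in> mor G. rng G l = v \<and> src G l = w)"


section \<open>Adjacency matrices\<close>

text \<open>Matrices indexed by a finite set \<open>V\<close> are functions of two arguments, of which only the
  values on \<open>V\<close> matter.\<close>

definition adj :: "'a kgraph \<Rightarrow> nat \<Rightarrow> 'a \<Rightarrow> 'a \<Rightarrow> nat" where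
  "adj G i v w = card {l \<in> of_deg G (unit_deg i). rng G l = v \<and> src G l = w}"

definition matmul :: "'v set \<Rightarrow> ('v \<Rightarrow> 'v \<Rightarrow> nat) \<Rightarrow> ('v \<Rightarrow> 'v \<Rightarrow> nat) \<Rightarrow> 'v \<Rightarrow> 'v \<Rightarrow> nat" where
  "matmul V A B v w = (\<Sum>u\<in>V. A v u * B u w)"

definition matid :: "'v \<Rightarrow> 'v \<Rightarrow> nat" where
  "matid v w = (if v = w then 1 else 0)"

definition matpow :: "'v set \<Rightarrow> ('v \<Rightarrow> 'v \<Rightarrow> nat) \<Rightarrow> nat \<Rightarrow> 'v \<Rightarrow> 'v \<Rightarrow> nat" where
  "matpow V A n = (matmul V A ^^ n) matid"

definition irreducible_mat :: "'v set \<Rightarrow> ('v \<Rightarrow> 'v \<Rightarrow> nat) \<Rightarrow> bool" where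
  "irreducible_mat V A \<longleftrightarrow> (\<forall>v\<in>V. \<forall>w\<in>V. \<exists>n\<ge>1. matpow V A n v w > 0)"

definition spectral_radius :: "'v set \<Rightarrow> ('v \<Rightarrow> 'v \<Rightarrow> nat) \<Rightarrow> real" where
  "spectral_radius V A = Max {cmod c | c. \<exists>z. (\<exists>v\<in>V. z v \<noteq> 0) \<and>
     (\<forall>v\<in>V. (\<Sum>w\<in>V. of_nat (A v w) * z w) = c * z v)}"

definition adj_prod :: "nat \<Rightarrow> 'a kgraph \<Rightarrow> 'a \<Rightarrow> 'a \<Rightarrow> nat" where
  "adj_prod k G = foldr (\<lambda>i. matmul (verts G) (adj G i)) [0..<k] matid"

definition rho :: "'a kgraph \<Rightarrow> nat \<Rightarrow> real" where
  "rho G i = spectral_radius (verts G) (adj G i)"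

text \<open>The vector, and below the measure on infinite paths and the Dixmier trace measure, are
  introduced through the properties that determine them.\<close>

definition perron_vector :: "nat \<Rightarrow> 'a kgraph \<Rightarrow> ('a \<Rightarrow> real) \<Rightarrow> bool" where
  "perron_vector k G x \<longleftrightarrow> (\<forall>v \<in> verts G. x v > 0) \<and> (\<Sum>v\<in>verts G. x v) = 1 \<and>
     (\<forall>i<k. \<forall>v \<in> verts G. (\<Sum>w\<in>verts G. real (adj G i v w) * x w) = rho G i * x v)"


section \<open>The infinite path space of a higher-rank graph\<close>

definition Omega :: "nat \<Rightarrow> ((nat \<Rightarrow> nat) \<times> (nat \<Rightarrow> nat)) kgraph" where
  "Omega k = \<lparr>mor = {(m, n). m \<in> Nk k \<and> n \<in> Nk k \<and> m \<le> n},
     rng = (\<lambda>(m, n). (m, m)), src = (\<lambda>(m, n). (n, n)),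
     cmp = (\<lambda>(m, n) (n', p). (m, p)), deg = (\<lambda>(m, n). n - m)\<rparr>"

definition inf_paths :: "nat \<Rightarrow> 'a kgraph \<Rightarrow> ((nat \<Rightarrow> nat) \<times> (nat \<Rightarrow> nat) \<Rightarrow> 'a) set" where
  "inf_paths k G = {x \<in> functors (Omega k) G. \<forall>p \<in> mor (Omega k). deg G (x p) = deg (Omega k) p}"

definition cyl :: "nat \<Rightarrow> 'a kgraph \<Rightarrow> 'a \<Rightarrow> ((nat \<Rightarrow> nat) \<times> (nat \<Rightarrow> nat) \<Rightarrow> 'a) set" where
  "cyl k G l = {x \<in> inf_paths k G. x (0, deg G l) = l}"

definition borel_sets_of :: "'x topology \<Rightarrow> 'x set set" where
  "borel_sets_of T = sigma_sets (topspace T) {U. openin T U}"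

definition perron_measure ::
    "nat \<Rightarrow> 'a kgraph \<Rightarrow> ('a \<Rightarrow> real) \<Rightarrow> ((nat \<Rightarrow> nat) \<times> (nat \<Rightarrow> nat) \<Rightarrow> 'a) measure \<Rightarrow> bool" where
  "perron_measure k G x M \<longleftrightarrow> prob_space M \<and> space M = inf_paths k G \<and>
     sets M = borel_sets_of (topology_generated_by (cyl k G ` mor G)) \<and>
     (\<forall>l \<in> mor G. measure M (cyl k G l) = (\<Prod>i<k. 1 / rho G i ^ deg G l i) * x (src G l))"


section \<open>The stationary Bratteli diagram\<close>

text \<open>Edges with range at level \<open>j\<close> and source at level \<open>j + 1\<close>. Level sets are not tagged:
  the level of an edge is its position in the path.\<close>

definition edges :: "nat \<Rightarrow> 'a kgraph \<Rightarrow> nat \<Rightarrow> 'a set" where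
  "edges k G j = of_deg G (unit_deg (j mod k))"

text \<open>A finite path is its initial vertex together with the list of its edges.\<close>

definition fpaths :: "nat \<Rightarrow> 'a kgraph \<Rightarrow> ('a \<times> 'a list) set" where
  "fpaths k G = {(v, es). v \<in> verts G \<and> (\<forall>j < length es. es ! j \<in> edges k G j \<and>
     rng G (es ! j) = (if j = 0 then v else src G (es ! (j - 1))))}"

abbreviation plen :: "'a \<times> 'a list \<Rightarrow> nat" where
  "plen \<gamma> \<equiv> length (snd \<gamma>)"

definition psrc :: "'a kgraph \<Rightarrow> 'a \<times> 'a list \<Rightarrow> 'a" where
  "psrc G \<gamma> = (if snd \<gamma> = [] then fst \<gamma> else src G (last (snd \<gamma>)))"

definition psnoc :: "'a \<times> 'a list \<Rightarrow> 'a \<Rightarrow> 'a \<times> 'a list" where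
  "psnoc \<gamma> e = (fst \<gamma>, snd \<gamma> @ [e])"

definition initial_segment :: "'a \<times> 'a list \<Rightarrow> 'a \<times> 'a list \<Rightarrow> bool" where
  "initial_segment \<gamma> \<eta> \<longleftrightarrow> fst \<gamma> = fst \<eta> \<and> prefix (snd \<gamma>) (snd \<eta>)"

definition ext1 :: "nat \<Rightarrow> 'a kgraph \<Rightarrow> 'a \<times> 'a list \<Rightarrow> ('a \<times> 'a) set" where
  "ext1 k G \<gamma> = {(e, e'). e \<in> edges k G (plen \<gamma>) \<and> e' \<in> edges k G (plen \<gamma>) \<and> e \<noteq> e' \<and>
     rng G e = psrc G \<gamma> \<and> rng G e' = psrc G \<gamma>}"

definition bspace :: "nat \<Rightarrow> 'a kgraph \<Rightarrow> (nat \<Rightarrow> 'a) set" where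
  "bspace k G = {y. \<forall>j. y j \<in> edges k G j \<and> rng G (y (Suc j)) = src G (y j)}"

definition bcyl :: "nat \<Rightarrow> 'a kgraph \<Rightarrow> 'a \<times> 'a list \<Rightarrow> (nat \<Rightarrow> 'a) set" where
  "bcyl k G \<gamma> = {y \<in> bspace k G. rng G (y 0) = fst \<gamma> \<and> (\<forall>j < plen \<gamma>. y j = snd \<gamma> ! j)}"

text \<open>The degree of the finite paths of length \<open>j = q k + t\<close>, namely \<open>t\<close> entries \<open>q + 1\<close>
  followed by \<open>k - t\<close> entries \<open>q\<close>.\<close>

definition level_deg :: "nat \<Rightarrow> nat \<Rightarrow> nat \<Rightarrow> nat" where
  "level_deg k j = (\<lambda>i. if i < k then j div k + (if i < j mod k then 1 else 0) else 0)"

text \<open>The identification of the infinite path space of \<open>G\<close> with that of the Bratteli diagram;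
  it is inverse to composing edges.\<close>

definition to_bratteli :: "nat \<Rightarrow> ((nat \<Rightarrow> nat) \<times> (nat \<Rightarrow> nat) \<Rightarrow> 'a) \<Rightarrow> nat \<Rightarrow> 'a" where
  "to_bratteli k x j = x (level_deg k j, level_deg k (Suc j))"


section \<open>The weight, its metric and the Dixmier trace measure\<close>

definition weight :: "nat \<Rightarrow> 'a kgraph \<Rightarrow> ('a \<Rightarrow> real) \<Rightarrow> real \<Rightarrow> 'a \<times> 'a list \<Rightarrow> real" where
  "weight k G x \<delta> \<eta> =
     (\<Prod>i<k. rho G i ^ level_deg k (plen \<eta>) i) powr (- 1 / \<delta>) * x (psrc G \<eta>)"

definition common_segment :: "'a kgraph \<Rightarrow> (nat \<Rightarrow> 'a) \<Rightarrow> (nat \<Rightarrow> 'a) \<Rightarrow> 'a \<times> 'a list" where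
  "common_segment G y z = (rng G (y 0), map y [0..<(LEAST j. y j \<noteq> z j)])"

definition wdist ::
    "nat \<Rightarrow> 'a kgraph \<Rightarrow> ('a \<Rightarrow> real) \<Rightarrow> real \<Rightarrow> (nat \<Rightarrow> 'a) \<Rightarrow> (nat \<Rightarrow> 'a) \<Rightarrow> real" where
  "wdist k G x \<delta> y z =
     (if y = z then 0
      else if rng G (y 0) \<noteq> rng G (z 0) then 1
      else weight k G x \<delta> (common_segment G y z))"

definition wdiam :: "nat \<Rightarrow> 'a kgraph \<Rightarrow> ('a \<Rightarrow> real) \<Rightarrow> real \<Rightarrow> 'a \<times> 'a list \<Rightarrow> real" where
  "wdiam k G x \<delta> \<gamma> = Sup {wdist k G x \<delta> y z | y z. y \<in> bcyl k G \<gamma> \<and> z \<in> bcyl k G \<gamma>}"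

definition dixmier_measure ::
    "nat \<Rightarrow> 'a kgraph \<Rightarrow> ('a \<Rightarrow> real) \<Rightarrow> real \<Rightarrow> (nat \<Rightarrow> 'a) measure \<Rightarrow> bool" where
  "dixmier_measure k G x \<delta> \<mu> \<longleftrightarrow> prob_space \<mu> \<and> space \<mu> = bspace k G \<and>
     sets \<mu> = borel_sets_of (topology_generated_by (bcyl k G ` fpaths k G)) \<and>
     (\<forall>\<gamma> \<in> fpaths k G.
        ((\<lambda>s. (\<Sum>\<^sub>\<infinity>\<eta>\<in>{\<eta> \<in> fpaths k G. initial_segment \<gamma> \<eta>}. weight k G x \<delta> \<eta> powr s) /
              (\<Sum>\<^sub>\<infinity>\<eta>\<in>fpaths k G. weight k G x \<delta> \<eta> powr s))
          \<longlongrightarrow> measure \<mu> (bcyl k G \<gamma>)) (at_right \<delta>))"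


section \<open>Square-integrable functions\<close>

text \<open>A subspace of the Hilbert space of square-integrable functions is represented by the set of
  all functions whose almost-everywhere class belongs to it.\<close>

definition L2 :: "'x measure \<Rightarrow> ('x \<Rightarrow> complex) set" where
  "L2 M = {f \<in> borel_measurable M. integrable M (\<lambda>x. (cmod (f x))\<^sup>2)}"

definition L2_inner :: "'x measure \<Rightarrow> ('x \<Rightarrow> complex) \<Rightarrow> ('x \<Rightarrow> complex) \<Rightarrow> complex" where
  "L2_inner M f g = (LINT x|M. cnj (f x) * g x)"

definition cspan :: "('x \<Rightarrow> complex) set \<Rightarrow> ('x \<Rightarrow> complex) set" where
  "cspan = module.span (\<lambda>c f x. c * f x)"

definition L2_span :: "'x measure \<Rightarrow> ('x \<Rightarrow> complex) set \<Rightarrow> ('x \<Rightarrow> complex) set" where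
  "L2_span M S = {f \<in> L2 M. \<exists>g \<in> cspan S. AE x in M. f x = g x}"

definition L2_orthogonal :: "'x measure \<Rightarrow> ('x \<Rightarrow> complex) set \<Rightarrow> ('x \<Rightarrow> complex) set \<Rightarrow> bool" where
  "L2_orthogonal M U W \<longleftrightarrow> (\<forall>f\<in>U. \<forall>g\<in>W. L2_inner M f g = 0)"

definition L2_perp :: "'x measure \<Rightarrow> ('x \<Rightarrow> complex) set \<Rightarrow> ('x \<Rightarrow> complex) set" where
  "L2_perp M U = {f \<in> L2 M. \<forall>g\<in>U. L2_inner M f g = 0}"

text \<open>Direct sums of subspaces are orthogonal direct sums; an infinite one is the closure of the
  algebraic sum.\<close>

definition is_orth_sum ::
    "'x measure \<Rightarrow> ('x \<Rightarrow> complex) set \<Rightarrow> ('x \<Rightarrow> complex) set \<Rightarrow> ('x \<Rightarrow> complex) set \<Rightarrow> bool" where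
  "is_orth_sum M H U W \<longleftrightarrow> L2_orthogonal M U W \<and> H = {f + g | f g. f \<in> U \<and> g \<in> W}"

definition is_L2_decomposition :: "'x measure \<Rightarrow> (nat \<Rightarrow> ('x \<Rightarrow> complex) set) \<Rightarrow> bool" where
  "is_L2_decomposition M U \<longleftrightarrow> (\<forall>n. U n \<subseteq> L2 M) \<and>
     (\<forall>m n. m \<noteq> n \<longrightarrow> L2_orthogonal M (U m) (U n)) \<and>
     (\<forall>f \<in> L2 M. \<exists>g. (\<forall>n. g n \<in> U n) \<and>
        (\<lambda>N. LINT x|M. (cmod (f x - (\<Sum>n<N. g n x)))\<^sup>2) \<longlonglongrightarrow> 0)"


section \<open>The Laplace--Beltrami operators\<close>

definition diam_pairs ::
    "nat \<Rightarrow> 'a kgraph \<Rightarrow> ('a \<Rightarrow> real) \<Rightarrow> real \<Rightarrow> 'a \<times> 'a list \<Rightarrow> ((nat \<Rightarrow> 'a) \<times> (nat \<Rightarrow> 'a)) set" where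
  "diam_pairs k G x \<delta> \<gamma> =
     {(y, z) \<in> bcyl k G \<gamma> \<times> bcyl k G \<gamma>. wdist k G x \<delta> y z = wdiam k G x \<delta> \<gamma>}"

definition choice_functions ::
    "nat \<Rightarrow> 'a kgraph \<Rightarrow> ('a \<Rightarrow> real) \<Rightarrow> real
      \<Rightarrow> ('a \<times> 'a list \<Rightarrow> (nat \<Rightarrow> 'a) \<times> (nat \<Rightarrow> 'a)) set" where
  "choice_functions k G x \<delta> = (\<Pi>\<^sub>E \<gamma>\<in>fpaths k G. diam_pairs k G x \<delta> \<gamma>)"

text \<open>The measure on choice functions induced by \<open>\<mu>\<close>: the values at distinct finite paths are
  independent, and the value at \<open>\<gamma>\<close> is distributed according to the normalised restriction of
  \<open>\<mu> \<times> \<mu>\<close> to the pairs realising the diameter of \<open>[\<gamma>]\<close>.\<close>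

definition choice_measure ::
    "nat \<Rightarrow> 'a kgraph \<Rightarrow> ('a \<Rightarrow> real) \<Rightarrow> real \<Rightarrow> (nat \<Rightarrow> 'a) measure
      \<Rightarrow> ('a \<times> 'a list \<Rightarrow> (nat \<Rightarrow> 'a) \<times> (nat \<Rightarrow> 'a)) measure" where
  "choice_measure k G x \<delta> \<mu> = PiM (fpaths k G) (\<lambda>\<gamma>.
     uniform_measure (restrict_space (\<mu> \<Otimes>\<^sub>M \<mu>) (diam_pairs k G x \<delta> \<gamma>)) (diam_pairs k G x \<delta> \<gamma>))"

lemma space_choice_measure:
  assumes "space \<mu> = bspace k G"
  shows "space (choice_measure k G x \<delta> \<mu>) = choice_functions k G x \<delta>"
proof -
  have "diam_pairs k G x \<delta> \<gamma> \<inter> (bspace k G \<times> bspace k G) = diam_pairs k G x \<delta> \<gamma>" for \<gamma>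
    by (auto simp: diam_pairs_def bcyl_def)
  then show ?thesis
    using assms unfolding choice_measure_def choice_functions_def
    by (simp add: space_PiM space_restrict_space space_pair_measure)
qed

text \<open>All operators in the spectral triple are block diagonal; they are represented by the families
  of their two-by-two blocks. Since the square of the block of $D$ is \<open>(diam [\<gamma>])\<^sup>-\<^sup>2\<close>
  times the identity, the block of $|D|^{-s}$ is \<open>(diam [\<gamma>])\<^sup>s\<close> times the identity.\<close>

definition dirac_block ::
    "nat \<Rightarrow> 'a kgraph \<Rightarrow> ('a \<Rightarrow> real) \<Rightarrow> real \<Rightarrow> 'a \<times> 'a list \<Rightarrow> complex^2^2" where
  "dirac_block k G x \<delta> \<gamma> =
     mat (complex_of_real (1 / wdiam k G x \<delta> \<gamma>)) ** vector [vector [0, 1], vector [1, 0]]"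

definition abs_dirac_block ::
    "nat \<Rightarrow> 'a kgraph \<Rightarrow> ('a \<Rightarrow> real) \<Rightarrow> real \<Rightarrow> real \<Rightarrow> 'a \<times> 'a list \<Rightarrow> complex^2^2" where
  "abs_dirac_block k G x \<delta> s \<gamma> = mat (complex_of_real (wdiam k G x \<delta> \<gamma> powr s))"

definition rep_block ::
    "('a \<times> 'a list \<Rightarrow> (nat \<Rightarrow> 'a) \<times> (nat \<Rightarrow> 'a)) \<Rightarrow> ((nat \<Rightarrow> 'a) \<Rightarrow> complex)
      \<Rightarrow> 'a \<times> 'a list \<Rightarrow> complex^2^2" where
  "rep_block \<tau> f \<gamma> = vector [vector [f (fst (\<tau> \<gamma>)), 0], vector [0, f (snd (\<tau> \<gamma>))]]"

definition commutator_block ::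
    "nat \<Rightarrow> 'a kgraph \<Rightarrow> ('a \<Rightarrow> real) \<Rightarrow> real
      \<Rightarrow> ('a \<times> 'a list \<Rightarrow> (nat \<Rightarrow> 'a) \<times> (nat \<Rightarrow> 'a)) \<Rightarrow> ((nat \<Rightarrow> 'a) \<Rightarrow> complex)
      \<Rightarrow> 'a \<times> 'a list \<Rightarrow> complex^2^2" where
  "commutator_block k G x \<delta> \<tau> f \<gamma> =
     dirac_block k G x \<delta> \<gamma> ** rep_block \<tau> f \<gamma> - rep_block \<tau> f \<gamma> ** dirac_block k G x \<delta> \<gamma>"

definition adjoint_mat :: "complex^2^2 \<Rightarrow> complex^2^2" where
  "adjoint_mat A = (\<chi> i j. cnj (A $ j $ i))"

definition LB_form ::
    "nat \<Rightarrow> 'a kgraph \<Rightarrow> ('a \<Rightarrow> real) \<Rightarrow> real \<Rightarrow> (nat \<Rightarrow> 'a) measure \<Rightarrow> real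
      \<Rightarrow> ((nat \<Rightarrow> 'a) \<Rightarrow> complex) \<Rightarrow> ((nat \<Rightarrow> 'a) \<Rightarrow> complex) \<Rightarrow> complex" where
  "LB_form k G x \<delta> \<mu> s f g =
     1 / 2 * (LINT \<tau>|choice_measure k G x \<delta> \<mu>. (\<Sum>\<^sub>\<infinity>\<gamma>\<in>fpaths k G.
       trace (abs_dirac_block k G x \<delta> s \<gamma> **
              adjoint_mat (commutator_block k G x \<delta> \<tau> f \<gamma>) **
              commutator_block k G x \<delta> \<tau> g \<gamma>)))"

text \<open>The form evaluates functions at points. Its domain consists of the linear combinations of
  indicator functions of cylinder sets, for which the trace above is a finite sum.\<close>

definition LB_domain :: "nat \<Rightarrow> 'a kgraph \<Rightarrow> ((nat \<Rightarrow> 'a) \<Rightarrow> complex) set" where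
  "LB_domain k G = cspan ((\<lambda>\<gamma>. indicator (bcyl k G \<gamma>)) ` fpaths k G)"

text \<open>The relation \<open>\<Delta>\<^sub>s g = h\<close>.\<close>

definition laplace_beltrami ::
    "nat \<Rightarrow> 'a kgraph \<Rightarrow> ('a \<Rightarrow> real) \<Rightarrow> real \<Rightarrow> (nat \<Rightarrow> 'a) measure \<Rightarrow> real
      \<Rightarrow> ((nat \<Rightarrow> 'a) \<Rightarrow> complex) \<Rightarrow> ((nat \<Rightarrow> 'a) \<Rightarrow> complex) \<Rightarrow> bool" where
  "laplace_beltrami k G x \<delta> \<mu> s g h \<longleftrightarrow> g \<in> L2 \<mu> \<and> h \<in> L2 \<mu> \<and>
     (\<exists>g' \<in> LB_domain k G. (AE y in \<mu>. g y = g' y) \<and>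
        (\<forall>f \<in> LB_domain k G. L2_inner \<mu> f h = LB_form k G x \<delta> \<mu> s f g'))"

definition LB_eigenspace ::
    "nat \<Rightarrow> 'a kgraph \<Rightarrow> ('a \<Rightarrow> real) \<Rightarrow> real \<Rightarrow> (nat \<Rightarrow> 'a) measure \<Rightarrow> real \<Rightarrow> complex
      \<Rightarrow> ((nat \<Rightarrow> 'a) \<Rightarrow> complex) set" where
  "LB_eigenspace k G x \<delta> \<mu> s c = {g. laplace_beltrami k G x \<delta> \<mu> s g (\<lambda>y. c * g y)}"

definition normalized_indicator :: "'x measure \<Rightarrow> 'x set \<Rightarrow> 'x \<Rightarrow> complex" where
  "normalized_indicator \<mu> S y = complex_of_real (1 / measure \<mu> S) * indicator S y"

definition E_minus1 :: "nat \<Rightarrow> 'a kgraph \<Rightarrow> (nat \<Rightarrow> 'a) measure \<Rightarrow> ((nat \<Rightarrow> 'a) \<Rightarrow> complex) set" where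
  "E_minus1 k G \<mu> = L2_span \<mu> {indicator (bspace k G)}"

definition E_zero :: "nat \<Rightarrow> 'a kgraph \<Rightarrow> (nat \<Rightarrow> 'a) measure \<Rightarrow> ((nat \<Rightarrow> 'a) \<Rightarrow> complex) set" where
  "E_zero k G \<mu> = L2_span \<mu>
     {normalized_indicator \<mu> (bcyl k G (v, [])) - normalized_indicator \<mu> (bcyl k G (v', []))
       | v v'. v \<in> verts G \<and> v' \<in> verts G \<and> v \<noteq> v'}"

definition E_path ::
    "nat \<Rightarrow> 'a kgraph \<Rightarrow> (nat \<Rightarrow> 'a) measure \<Rightarrow> 'a \<times> 'a list \<Rightarrow> ((nat \<Rightarrow> 'a) \<Rightarrow> complex) set" where
  "E_path k G \<mu> \<gamma> = L2_span \<mu>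
     {normalized_indicator \<mu> (bcyl k G (psnoc \<gamma> e)) - normalized_indicator \<mu> (bcyl k G (psnoc \<gamma> e'))
       | e e'. (e, e') \<in> ext1 k G \<gamma>}"


section \<open>The wavelet decomposition\<close>

definition wavelet_V ::
    "nat \<Rightarrow> 'a kgraph \<Rightarrow> ((nat \<Rightarrow> nat) \<times> (nat \<Rightarrow> nat) \<Rightarrow> 'a) measure \<Rightarrow> nat
      \<Rightarrow> (((nat \<Rightarrow> nat) \<times> (nat \<Rightarrow> nat) \<Rightarrow> 'a) \<Rightarrow> complex) set" where
  "wavelet_V k G M n = L2_span M ((\<lambda>l. indicator (cyl k G l)) ` of_deg G (diag_deg k n))"

definition wavelet_W ::
    "nat \<Rightarrow> 'a kgraph \<Rightarrow> ((nat \<Rightarrow> nat) \<times> (nat \<Rightarrow> nat) \<Rightarrow> 'a) measure \<Rightarrow> nat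
      \<Rightarrow> (((nat \<Rightarrow> nat) \<times> (nat \<Rightarrow> nat) \<Rightarrow> 'a) \<Rightarrow> complex) set" where
  "wavelet_W k G M n = wavelet_V k G M (Suc n) \<inter> L2_perp M (wavelet_V k G M n)"

text \<open>Transport of a space of functions on the path space of the Bratteli diagram to the infinite
  path space of the graph, along the identification of the two.\<close>

definition transport ::
    "nat \<Rightarrow> ((nat \<Rightarrow> nat) \<times> (nat \<Rightarrow> nat) \<Rightarrow> 'a) measure \<Rightarrow> ((nat \<Rightarrow> 'a) \<Rightarrow> complex) set
      \<Rightarrow> (((nat \<Rightarrow> nat) \<times> (nat \<Rightarrow> nat) \<Rightarrow> 'a) \<Rightarrow> complex) set" where
  "transport k M U = {f \<in> L2 M. \<exists>g \<in> U. AE x in M. f x = g (to_bratteli k x)}"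

end

theory Submission
  imports Defs
begin

text \<open>Composing edges identifies the cylinder sets of both path spaces, so that each level of the
  Bratteli diagram gives a finite partition of \<open>\<Lambda>\<^sup>\<infinity>\<close>, refined by the next one. Passing from a cylinder
  set \<open>[\<gamma>]\<close> to its parts \<open>[\<gamma>e]\<close> adds to the span of the indicator functions exactly the space
  \<open>E\<^sub>\<gamma>\<close>, whose elements have mean zero on \<open>[\<gamma>]\<close>; summing over \<open>k\<close> consecutive levels gives the
  wavelet spaces.

  The Dixmier trace measure agrees with \<open>M\<close>: self-similarity of the zeta function in steps of \<open>k\<close>
  levels makes \<open>(\<mu>[v])\<^sub>v\<close> an eigenvector of \<open>A\<^sub>1 \<cdots> A\<^sub>k\<close>, which is the Perron vector by irreducibility.

  The contribution of a path to the Laplace--Beltrami form is an integral over the pairs in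
  \<open>[\<gamma>] \<times> [\<gamma>]\<close> outside \<open>\<Union>\<^sub>e [\<gamma>e] \<times> [\<gamma>e]\<close>, and for \<open>B = [\<gamma>]\<close> or \<open>B = [\<gamma>e]\<close> the integral of
  \<open>cnj (f y - f z) (g y - g z)\<close> over \<open>B \<times> B\<close> is a multiple of \<open>\<langle>f, g\<rangle>\<close> whenever \<open>g\<close> is constant on \<open>B\<close>, or
  is supported in \<open>B\<close> with mean zero. One of these holds for every \<open>B\<close> if \<open>g\<close> lies in one of the given
  spaces.\<close>

section \<open>Spans of square-integrable functions\<close>

text \<open>The edges at level \<open>n\<close> depend on \<open>n mod k\<close>, so the diagram
  repeats itself only after \<open>k\<close> levels. The zeta function therefore determines
  \<open>\<mu>\<close> at first on levels that are multiples of \<open>k\<close>, through a factor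
  \<open>growth (q * k) powr (- s / \<delta>)\<close> that tends to
  \<open>1 / growth (q * k)\<close>; the levels in between follow from additivity, downwards.

  The form sees a finite path through the pairs realising its diameter. Equality of weight and
  diameter rules out one-point cylinder sets, so every path branches eventually. Since
  \<open>\<delta> < 1\<close> and all \<open>rho G i \<ge> 1\<close>, the weight drops strictly at a
  branching, which singles out the pairs that separate there.

  The trace is an infinite sum over paths, but a function of one of the given spaces is constant on
  all cylinder sets outside a finite set of paths, so the sum becomes finite. The eigenvalue is not
  evaluated; it matters only that the resulting factor is the same for all \<open>f\<close> and
  \<open>g\<close>.\<close>

interpretation cfun: vector_space "\<lambda>c (f :: 'x \<Rightarrow> complex) x. c * f x"
  by unfold_locales (auto simp: fun_eq_iff algebra_simps)

lemma sum_fun_eval: "(\<Sum>i\<in>I. f i) y = (\<Sum>i\<in>I. f i y)"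
  by (induction I rule: infinite_finite_induct) auto

lemma norm_add_sq_le: "(cmod (a + b))\<^sup>2 \<le> 2 * (cmod a)\<^sup>2 + 2 * (cmod b)\<^sup>2"
proof -
  have "(cmod (a + b))\<^sup>2 \<le> (cmod a + cmod b)\<^sup>2"
    by (intro power_mono norm_triangle_ineq) auto
  also have "\<dots> \<le> 2 * (cmod a)\<^sup>2 + 2 * (cmod b)\<^sup>2"
    using zero_le_power2[of "cmod a - cmod b"] by (simp add: power2_eq_square algebra_simps)
  finally show ?thesis .
qed

lemma borel_measurable_cnj [measurable]:
  "f \<in> borel_measurable M \<Longrightarrow> (\<lambda>y. cnj (f y)) \<in> borel_measurable M"
  by (rule borel_measurable_continuous_on[of cnj]) (auto intro!: continuous_intros)

lemma L2_integrable: "f \<in> L2 M \<Longrightarrow> integrable M (\<lambda>y. (cmod (f y))\<^sup>2)"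
  by (simp add: L2_def)

lemma L2_add: assumes "f \<in> L2 M" "g \<in> L2 M" shows "(\<lambda>y. f y + g y) \<in> L2 M"
proof -
  have [measurable]: "f \<in> borel_measurable M" "g \<in> borel_measurable M"
    using assms by (auto simp: L2_def)
  have "integrable M (\<lambda>y. (cmod (f y + g y))\<^sup>2)"
  proof (rule Bochner_Integration.integrable_bound)
    show "integrable M (\<lambda>y. 2 * (cmod (f y))\<^sup>2 + 2 * (cmod (g y))\<^sup>2)"
      using assms by (auto simp: L2_def)
  qed (use norm_add_sq_le in auto)
  then show ?thesis by (simp add: L2_def)
qed

lemma L2_scale: assumes "f \<in> L2 M" shows "(\<lambda>y. c * f y) \<in> L2 M"
  using assms by (auto simp: L2_def norm_mult power_mult_distrib)

lemma L2_zero: "(\<lambda>y. 0) \<in> L2 M"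
  by (simp add: L2_def)

lemma L2_diff: assumes "f \<in> L2 M" "g \<in> L2 M" shows "(\<lambda>y. f y - g y) \<in> L2 M"
  using L2_add[OF assms(1) L2_scale[OF assms(2), of "-1"]] by simp

lemma L2_subspace: "cfun.subspace (L2 M)"
  using L2_add[of _ M] L2_scale[of _ M] L2_zero[of M]
  by (auto simp: cfun.subspace_def plus_fun_def zero_fun_def)

lemma cspan_subset: "S \<subseteq> U \<Longrightarrow> cfun.subspace U \<Longrightarrow> cspan S \<subseteq> U"
  unfolding cspan_def by (rule cfun.span_minimal)

lemma cspan_L2: "S \<subseteq> L2 M \<Longrightarrow> cspan S \<subseteq> L2 M"
  by (rule cspan_subset[OF _ L2_subspace])

lemma cspan_base: "f \<in> S \<Longrightarrow> f \<in> cspan S"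
  unfolding cspan_def by (rule cfun.span_base)

lemma cspan_add: "f \<in> cspan S \<Longrightarrow> g \<in> cspan S \<Longrightarrow> (\<lambda>y. f y + g y) \<in> cspan S"
  using cfun.span_add[of f S g] by (simp add: cspan_def plus_fun_def)

lemma cspan_diff: "f \<in> cspan S \<Longrightarrow> g \<in> cspan S \<Longrightarrow> (\<lambda>y. f y - g y) \<in> cspan S"
  using cfun.span_diff[of f S g] by (simp add: cspan_def fun_diff_def)

lemma cspan_scale: "f \<in> cspan S \<Longrightarrow> (\<lambda>y. c * f y) \<in> cspan S"
  using cfun.span_scale[of f S c] by (simp add: cspan_def)

lemma cspan_zero: "(\<lambda>y. 0) \<in> cspan S"
  using cfun.span_zero[of S] by (simp add: cspan_def zero_fun_def)

lemma cspan_sum: "(\<And>i. i \<in> I \<Longrightarrow> f i \<in> cspan S) \<Longrightarrow> (\<lambda>y. \<Sum>i\<in>I. f i y) \<in> cspan S"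
  using cfun.span_sum[of I f S] by (simp add: cspan_def sum_fun_eval[symmetric] cong: sum.cong)

lemma cspan_mono: "S \<subseteq> S' \<Longrightarrow> cspan S \<subseteq> cspan S'"
  unfolding cspan_def by (rule cfun.span_mono)

lemma cspan_subspace: "cfun.subspace (cspan S)"
  unfolding cspan_def by (rule cfun.subspace_span)

lemma cspan_trans: "S \<subseteq> cspan S' \<Longrightarrow> cspan S \<subseteq> cspan S'"
  by (rule cspan_subset[OF _ cspan_subspace])

lemma cspan_Un: "h \<in> cspan (S \<union> S') \<Longrightarrow> \<exists>f\<in>cspan S. \<exists>g\<in>cspan S'. h = (\<lambda>y. f y + g y)"
  unfolding cspan_def cfun.span_Un by (force simp: plus_fun_def)

lemma cspan_induct [consumes 1, case_names base zero add scale]: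
  assumes "f \<in> cspan S"
    and "\<And>g. g \<in> S \<Longrightarrow> P g"
    and "P (\<lambda>y. 0)"
    and "\<And>g h. P g \<Longrightarrow> P h \<Longrightarrow> P (\<lambda>y. g y + h y)"
    and "\<And>c g. P g \<Longrightarrow> P (\<lambda>y. c * g y)"
  shows "P f"
proof -
  have "cspan S \<subseteq> Collect P"
    by (rule cspan_subset) (use assms(2-) in \<open>auto simp: cfun.subspace_def plus_fun_def zero_fun_def\<close>)
  then show ?thesis using assms(1) by auto
qed

text \<open>The inequality \<open>2 |a b| \<le> |a|^2 + |b|^2\<close> provides an integrable
  dominating function.\<close>

lemma L2_mult_integrable:
  assumes "f \<in> L2 M" "g \<in> L2 M" shows "integrable M (\<lambda>y. cnj (f y) * g y)"
proof (rule Bochner_Integration.integrable_bound)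
  have [measurable]: "f \<in> borel_measurable M" "g \<in> borel_measurable M"
    using assms by (auto simp: L2_def)
  show "integrable M (\<lambda>y. (cmod (f y))\<^sup>2 + (cmod (g y))\<^sup>2)"
    using assms by (auto simp: L2_def)
  show "(\<lambda>y. cnj (f y) * g y) \<in> borel_measurable M" by measurable
  have "cmod (cnj a * b) \<le> (cmod a)\<^sup>2 + (cmod b)\<^sup>2" for a b
  proof -
    have "2 * (cmod a * cmod b) \<le> (cmod a)\<^sup>2 + (cmod b)\<^sup>2"
      using zero_le_power2[of "cmod a - cmod b"] by (simp add: power2_eq_square algebra_simps)
    moreover have "0 \<le> cmod a * cmod b" by simp
    ultimately show ?thesis unfolding norm_mult complex_mod_cnj by linarith
  qed
  then show "AE y in M. cmod (cnj (f y) * g y) \<le> norm ((cmod (f y))\<^sup>2 + (cmod (g y))\<^sup>2)"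
    by simp
qed

lemma L2_inner_add_right: "f \<in> L2 M \<Longrightarrow> g \<in> L2 M \<Longrightarrow> h \<in> L2 M \<Longrightarrow>
    L2_inner M f (\<lambda>y. g y + h y) = L2_inner M f g + L2_inner M f h"
  unfolding L2_inner_def
  by (simp add: distrib_left Bochner_Integration.integral_add L2_mult_integrable)

lemma L2_inner_diff_right: "f \<in> L2 M \<Longrightarrow> g \<in> L2 M \<Longrightarrow> h \<in> L2 M \<Longrightarrow>
    L2_inner M f (\<lambda>y. g y - h y) = L2_inner M f g - L2_inner M f h"
  unfolding L2_inner_def
  by (simp add: right_diff_distrib Bochner_Integration.integral_diff L2_mult_integrable)

lemma L2_inner_scale_right: "L2_inner M f (\<lambda>y. c * g y) = c * L2_inner M f g"
proof -
  have "L2_inner M f (\<lambda>y. c * g y) = (LINT y|M. c * (cnj (f y) * g y))"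
    unfolding L2_inner_def by (simp add: mult.left_commute)
  then show ?thesis by (simp add: L2_inner_def)
qed

lemma L2_inner_commute: "L2_inner M g f = cnj (L2_inner M f g)"
  unfolding L2_inner_def
  by (subst Bochner_Integration.integral_cnj[symmetric]) (simp add: mult.commute)

lemma L2_inner_add_left: "f \<in> L2 M \<Longrightarrow> g \<in> L2 M \<Longrightarrow> h \<in> L2 M \<Longrightarrow>
    L2_inner M (\<lambda>y. g y + h y) f = L2_inner M g f + L2_inner M h f"
  by (subst (1 2 3) L2_inner_commute) (simp add: L2_inner_add_right)

lemma L2_inner_diff_left: "f \<in> L2 M \<Longrightarrow> g \<in> L2 M \<Longrightarrow> h \<in> L2 M \<Longrightarrow>
    L2_inner M (\<lambda>y. g y - h y) f = L2_inner M g f - L2_inner M h f"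
  by (subst (1 2 3) L2_inner_commute) (simp add: L2_inner_diff_right)

lemma L2_inner_cong_AE:
  assumes "f \<in> L2 M" "f' \<in> L2 M" "g \<in> L2 M" "g' \<in> L2 M" "AE y in M. f y = f' y" "AE y in M. g y = g' y"
  shows "L2_inner M f g = L2_inner M f' g'"
  unfolding L2_inner_def
proof (rule integral_cong_AE)
  have [measurable]: "f \<in> borel_measurable M" "g \<in> borel_measurable M"
    "f' \<in> borel_measurable M" "g' \<in> borel_measurable M"
    using assms by (auto simp: L2_def)
  show "(\<lambda>y. cnj (f y) * g y) \<in> borel_measurable M" "(\<lambda>y. cnj (f' y) * g' y) \<in> borel_measurable M"
    by measurable
qed (use assms in auto)

lemma L2_inner_zero_right: "L2_inner M f (\<lambda>y. 0) = 0"
  by (simp add: L2_inner_def)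

lemma L2_inner_self: "L2_inner M f f = complex_of_real (LINT y|M. (cmod (f y))\<^sup>2)"
  unfolding L2_inner_def
  by (subst integral_complex_of_real[symmetric])
    (simp add: complex_norm_square mult.commute del: of_real_power integral_complex_of_real)

lemma L2_inner_self_eq_0:
  assumes "f \<in> L2 M" "L2_inner M f f = 0" shows "AE y in M. f y = 0"
proof -
  have "(LINT y|M. (cmod (f y))\<^sup>2) = 0"
    using assms(2) by (simp add: L2_inner_self)
  then have "AE y in M. (cmod (f y))\<^sup>2 = 0"
    using integral_nonneg_eq_0_iff_AE[OF L2_integrable[OF assms(1)]] by simp
  then show ?thesis by simp
qed

lemma L2_inner_cspan_right:
  assumes "f \<in> L2 M" "S \<subseteq> L2 M" "\<And>g. g \<in> S \<Longrightarrow> L2_inner M f g = 0" "g \<in> cspan S"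
  shows "L2_inner M f g = 0"
proof -
  from assms(4) have "g \<in> L2 M \<and> L2_inner M f g = 0"
    by (induction rule: cspan_induct)
      (use assms in \<open>auto simp: L2_zero L2_add L2_scale L2_inner_zero_right L2_inner_add_right L2_inner_scale_right\<close>)
  then show ?thesis by simp
qed

section \<open>Spans up to null sets\<close>

lemma L2_spanI: "f \<in> L2 M \<Longrightarrow> g \<in> cspan S \<Longrightarrow> AE y in M. f y = g y \<Longrightarrow> f \<in> L2_span M S"
  by (auto simp: L2_span_def)

lemma L2_spanE:
  assumes "f \<in> L2_span M S" obtains g where "f \<in> L2 M" "g \<in> cspan S" "AE y in M. f y = g y"
  using assms by (auto simp: L2_span_def)

lemma L2_span_L2: "L2_span M S \<subseteq> L2 M"
  by (auto simp: L2_span_def)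

lemma cspan_L2_span: "S \<subseteq> L2 M \<Longrightarrow> cspan S \<subseteq> L2_span M S"
  using cspan_L2[of S M] by (auto intro!: L2_spanI)

lemma L2_span_mono: "cspan S \<subseteq> cspan S' \<Longrightarrow> L2_span M S \<subseteq> L2_span M S'"
  by (auto simp: L2_span_def)

lemma L2_span_add: "f \<in> L2_span M S \<Longrightarrow> g \<in> L2_span M S \<Longrightarrow> (\<lambda>y. f y + g y) \<in> L2_span M S"
  unfolding L2_span_def by (auto intro!: L2_add bexI[OF _ cspan_add])

lemma L2_span_scale: "f \<in> L2_span M S \<Longrightarrow> (\<lambda>y. c * f y) \<in> L2_span M S"
  unfolding L2_span_def by (auto intro!: L2_scale bexI[OF _ cspan_scale])

lemma L2_span_diff: "f \<in> L2_span M S \<Longrightarrow> g \<in> L2_span M S \<Longrightarrow> (\<lambda>y. f y - g y) \<in> L2_span M S"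
  using L2_span_add[of f M S "\<lambda>y. -1 * g y"] L2_span_scale[of g M S "-1"] by simp

text \<open>A generator on the left agrees with a combination of generators on the right only almost
  everywhere. Since \<open>L2_span\<close> is itself closed under sums and multiples, the induction
  stays inside it. The lemma lets a span of spaces \<open>E_path\<close> be replaced by the span of
  their generators.\<close>

lemma L2_span_UN:
  assumes "\<And>i. i \<in> I \<Longrightarrow> S i \<subseteq> L2 M"
  shows "L2_span M (\<Union>i\<in>I. L2_span M (S i)) = L2_span M (\<Union>i\<in>I. S i)"
proof
  show "L2_span M (\<Union>i\<in>I. S i) \<subseteq> L2_span M (\<Union>i\<in>I. L2_span M (S i))"
  proof (intro L2_span_mono cspan_mono UN_mono subset_refl)
    fix i assume "i \<in> I"
    then show "S i \<subseteq> L2_span M (S i)"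
      using cspan_L2_span[OF assms, of i] cspan_base[of _ "S i"] by auto
  qed
  show "L2_span M (\<Union>i\<in>I. L2_span M (S i)) \<subseteq> L2_span M (\<Union>i\<in>I. S i)"
  proof
    fix f assume "f \<in> L2_span M (\<Union>i\<in>I. L2_span M (S i))"
    then obtain g where g: "f \<in> L2 M" "g \<in> cspan (\<Union>i\<in>I. L2_span M (S i))" "AE y in M. f y = g y"
      by (rule L2_spanE)
    from g(2) have "g \<in> L2_span M (\<Union>i\<in>I. S i)"
    proof (induction rule: cspan_induct)
      case (base g)
      then obtain i where i: "i \<in> I" "g \<in> L2_span M (S i)" by auto
      then show ?case
        using L2_span_mono[OF cspan_mono[of "S i" "\<Union>i\<in>I. S i"], of M] by auto
    next
      case zero show ?case by (rule L2_spanI[OF L2_zero cspan_zero]) simp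
    qed (auto intro: L2_span_add L2_span_scale)
    then obtain h where h: "h \<in> cspan (\<Union>i\<in>I. S i)" "AE y in M. g y = h y" by (rule L2_spanE)
    with g show "f \<in> L2_span M (\<Union>i\<in>I. S i)"
      by (intro L2_spanI[of f M h]) auto
  qed
qed

lemma L2_orthogonal_L2_span:
  assumes "S \<subseteq> L2 M" "S' \<subseteq> L2 M" "\<And>f g. f \<in> S \<Longrightarrow> g \<in> S' \<Longrightarrow> L2_inner M f g = 0"
  shows "L2_orthogonal M (L2_span M S) (L2_span M S')"
  unfolding L2_orthogonal_def
proof (intro ballI)
  fix f g assume "f \<in> L2_span M S" "g \<in> L2_span M S'"
  then obtain f' g' where fg: "f \<in> L2 M" "f' \<in> cspan S" "AE y in M. f y = f' y"
    "g \<in> L2 M" "g' \<in> cspan S'" "AE y in M. g y = g' y" by (auto elim!: L2_spanE)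
  have L: "f' \<in> L2 M" "g' \<in> L2 M" using fg cspan_L2[OF assms(1)] cspan_L2[OF assms(2)] by auto
  have *: "L2_inner M h f' = 0" if "h \<in> S'" for h
    by (rule L2_inner_cspan_right[OF _ assms(1) _ fg(2)])
      (use assms that in \<open>auto simp: L2_inner_commute[of M h]\<close>)
  have "L2_inner M f' g' = 0"
    by (rule L2_inner_cspan_right[OF L(1) assms(2) _ fg(5)])
      (use * in \<open>auto simp: L2_inner_commute[of M _ f']\<close>)
  then show "L2_inner M f g = 0"
    using L2_inner_cong_AE[of f M f' g g'] fg L by simp
qed

lemma is_orth_sum_L2_span:
  assumes "S \<subseteq> L2 M" "S' \<subseteq> L2 M" "\<And>f g. f \<in> S \<Longrightarrow> g \<in> S' \<Longrightarrow> L2_inner M f g = 0"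
  shows "is_orth_sum M (L2_span M (S \<union> S')) (L2_span M S) (L2_span M S')"
  unfolding is_orth_sum_def
proof (intro conjI L2_orthogonal_L2_span assms set_eqI iffI)
  fix h assume "h \<in> L2_span M (S \<union> S')"
  then obtain h' where h: "h \<in> L2 M" "h' \<in> cspan (S \<union> S')" "AE y in M. h y = h' y" by (rule L2_spanE)
  from cspan_Un[OF h(2)] obtain f g where fg: "f \<in> cspan S" "g \<in> cspan S'" "h' = (\<lambda>y. f y + g y)"
    by auto
  have f: "f \<in> L2_span M S" using cspan_L2_span[OF assms(1)] fg(1) by auto
  \<comment> \<open>The second summand is \<open>h - f\<close> and not \<open>g\<close>: the sum has
    to be \<open>h\<close> at every point, whereas \<open>f + g\<close> equals \<open>h\<close> only
    almost everywhere.\<close>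
  have "(\<lambda>y. h y - f y) \<in> L2_span M S'"
    using f fg h by (intro L2_spanI[where g = g] L2_diff) (auto simp: L2_span_def)
  moreover have "h = f + (\<lambda>y. h y - f y)" by (simp add: plus_fun_def)
  ultimately show "h \<in> {f + g | f g. f \<in> L2_span M S \<and> g \<in> L2_span M S'}" using f by blast
next
  fix h assume "h \<in> {f + g | f g. f \<in> L2_span M S \<and> g \<in> L2_span M S'}"
  then obtain f g where "h = (\<lambda>y. f y + g y)" "f \<in> L2_span M S" "g \<in> L2_span M S'"
    by (auto simp: plus_fun_def)
  moreover have "L2_span M S \<subseteq> L2_span M (S \<union> S')" "L2_span M S' \<subseteq> L2_span M (S \<union> S')"
    by (auto intro!: L2_span_mono cspan_mono)
  ultimately show "h \<in> L2_span M (S \<union> S')" by (auto intro!: L2_span_add)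
qed

text \<open>The same coefficients serve on both sides, because the generators correspond pointwise
  on \<open>space M\<close>. Null sets of \<open>\<mu>\<close> are pulled back to \<open>M\<close>
  by \<open>AE\<close>.\<close>

lemma transport_L2_span:
  assumes T: "to_bratteli k \<in> measurable M \<mu>"
    and AE: "\<And>P. (AE y in \<mu>. P y) \<Longrightarrow> AE w in M. P (to_bratteli k w)"
    and ab: "\<And>i w. i \<in> I \<Longrightarrow> w \<in> space M \<Longrightarrow> b i w = a i (to_bratteli k w)"
    and L2: "\<And>i. i \<in> I \<Longrightarrow> a i \<in> L2 \<mu>"
  shows "transport k M (L2_span \<mu> (a ` I)) = L2_span M (b ` I)"
proof (intro set_eqI iffI)
  have fwd: "\<exists>h'\<in>cspan (b ` I). \<forall>w\<in>space M. h' w = h (to_bratteli k w)" if "h \<in> cspan (a ` I)" for h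
    using that
  proof (induction rule: cspan_induct)
    case (base g) then show ?case using ab by (auto intro!: bexI[of _ "b i" for i] cspan_base)
  next
    case zero show ?case using cspan_zero by (auto intro!: bexI[of _ "\<lambda>w. 0"])
  next
    case (add g h)
    then obtain g' h' where "g' \<in> cspan (b ` I)" "\<forall>w\<in>space M. g' w = g (to_bratteli k w)"
      "h' \<in> cspan (b ` I)" "\<forall>w\<in>space M. h' w = h (to_bratteli k w)" by auto
    then show ?case by (auto intro!: bexI[of _ "\<lambda>w. g' w + h' w"] cspan_add)
  next
    case (scale c g)
    then obtain g' where "g' \<in> cspan (b ` I)" "\<forall>w\<in>space M. g' w = g (to_bratteli k w)" by auto
    then show ?case by (auto intro!: bexI[of _ "\<lambda>w. c * g' w"] cspan_scale)
  qed
  have bwd: "\<exists>h\<in>cspan (a ` I). \<forall>w\<in>space M. h' w = h (to_bratteli k w)" if "h' \<in> cspan (b ` I)" for h'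
    using that
  proof (induction rule: cspan_induct)
    case (base g) then show ?case using ab by (auto intro!: bexI[of _ "a i" for i] cspan_base)
  next
    case zero show ?case using cspan_zero by (auto intro!: bexI[of _ "\<lambda>w. 0"])
  next
    case (add g' h')
    then obtain g h where "g \<in> cspan (a ` I)" "\<forall>w\<in>space M. g' w = g (to_bratteli k w)"
      "h \<in> cspan (a ` I)" "\<forall>w\<in>space M. h' w = h (to_bratteli k w)" by auto
    then show ?case by (auto intro!: bexI[of _ "\<lambda>w. g w + h w"] cspan_add)
  next
    case (scale c g')
    then obtain g where "g \<in> cspan (a ` I)" "\<forall>w\<in>space M. g' w = g (to_bratteli k w)" by auto
    then show ?case by (auto intro!: bexI[of _ "\<lambda>w. c * g w"] cspan_scale)
  qed
  fix f
  {
    assume "f \<in> transport k M (L2_span \<mu> (a ` I))"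
    then obtain g h where fg: "f \<in> L2 M" "AE w in M. f w = g (to_bratteli k w)"
      "h \<in> cspan (a ` I)" "AE y in \<mu>. g y = h y"
      by (auto simp: transport_def elim!: L2_spanE)
    from fwd[OF fg(3)] obtain h' where h': "h' \<in> cspan (b ` I)" "\<forall>w\<in>space M. h' w = h (to_bratteli k w)"
      by auto
    from h'(2) have "AE w in M. h' w = h (to_bratteli k w)" by auto
    with fg(2) AE[OF fg(4)] have "AE w in M. f w = h' w" by eventually_elim simp
    then show "f \<in> L2_span M (b ` I)" using fg(1) h'(1) by (intro L2_spanI)
  }
  {
    assume "f \<in> L2_span M (b ` I)"
    then obtain h' where f: "f \<in> L2 M" "h' \<in> cspan (b ` I)" "AE w in M. f w = h' w" by (rule L2_spanE)
    from bwd[OF f(2)] obtain h where h: "h \<in> cspan (a ` I)" "\<forall>w\<in>space M. h' w = h (to_bratteli k w)"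
      by auto
    have "h \<in> L2_span \<mu> (a ` I)"
      using h(1) cspan_L2_span[of "a ` I" \<mu>] L2 by auto
    moreover from h(2) have "AE w in M. h' w = h (to_bratteli k w)" by auto
    with f(3) have "AE w in M. f w = h (to_bratteli k w)" by eventually_elim simp
    ultimately show "f \<in> transport k M (L2_span \<mu> (a ` I))"
      using f(1) by (auto simp: transport_def)
  }
qed

section \<open>Nested finite partitions of a probability space\<close>

context finite_measure begin

lemma bounded_in_L2:
  assumes [measurable]: "f \<in> borel_measurable M" and B: "\<And>y. cmod (f y) \<le> C" shows "f \<in> L2 M"
proof -
  have "integrable M (\<lambda>y. (cmod (f y))\<^sup>2)"
    by (rule integrable_const_bound[where B = "C\<^sup>2"]) (use B in \<open>auto intro!: power_mono\<close>)
  then show ?thesis by (simp add: L2_def)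
qed

lemma indicator_in_L2: "A \<in> sets M \<Longrightarrow> indicator A \<in> L2 M"
  by (rule bounded_in_L2[where C = 1]) (auto simp: indicator_def)

lemma normalized_indicator_in_L2: "A \<in> sets M \<Longrightarrow> normalized_indicator M A \<in> L2 M"
  unfolding normalized_indicator_def[abs_def] by (intro L2_scale indicator_in_L2)

lemma L2_in_integrable: "f \<in> L2 M \<Longrightarrow> integrable M f"
  using L2_mult_integrable[OF indicator_in_L2[of "space M"], of f]
  by (auto cong: Bochner_Integration.integrable_cong)

end

text \<open>With \<open>B\<close> running over the cylinder sets of the vertices these functions
  generate \<open>E_zero\<close>; with the one-edge extensions of a path \<open>\<gamma>\<close>
  they generate \<open>E_path\<close> at \<open>\<gamma>\<close>.\<close>

definition diffs :: "'x measure \<Rightarrow> ('p \<Rightarrow> 'x set) \<Rightarrow> 'p set \<Rightarrow> ('x \<Rightarrow> complex) set" where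
  "diffs M B I = {normalized_indicator M (B i) - normalized_indicator M (B j) | i j. i \<in> I \<and> j \<in> I \<and> i \<noteq> j}"

lemma normalized_indicator_in_cspan: "normalized_indicator M A \<in> cspan {indicator A}"
  unfolding normalized_indicator_def[abs_def] by (intro cspan_scale cspan_base) simp

lemma diffs_in_cspan: "diffs M B I \<subseteq> cspan ((\<lambda>i. indicator (B i)) ` I)"
proof
  fix f assume "f \<in> diffs M B I"
  then obtain i j where ij: "f = (\<lambda>y. normalized_indicator M (B i) y - normalized_indicator M (B j) y)"
    "i \<in> I" "j \<in> I" by (auto simp: diffs_def fun_diff_def)
  have "normalized_indicator M (B i) \<in> cspan ((\<lambda>i. indicator (B i)) ` I)" if "i \<in> I" for i
    using cspan_mono[of "{indicator (B i)}" "(\<lambda>i. indicator (B i)) ` I"] that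
      normalized_indicator_in_cspan[of M "B i"] by auto
  with ij show "f \<in> cspan ((\<lambda>i. indicator (B i)) ` I)" by (auto intro!: cspan_diff)
qed

lemma indicator_UN_sum:
  assumes "finite I" "disjoint_family_on B I"
  shows "indicator (\<Union>i\<in>I. B i) y = (\<Sum>i\<in>I. indicator (B i) y :: complex)"
  using indicator_UN_disjoint[OF assms, where 'c = complex] by simp

text \<open>Let \<open>A\<close> be the union and \<open>N_j\<close> the normalised indicators.
  Averaging \<open>N_i - N_j\<close> over \<open>j\<close> with weights
  \<open>measure M (B j) / measure M A\<close> gives \<open>N_i - N_A\<close>; multiplying by
  \<open>measure M (B i)\<close> recovers the indicator of \<open>B i\<close>. This is the origin of
  the coefficients \<open>?c j\<close>.\<close>

lemma (in finite_measure) indicator_in_cspan_diffs: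
  assumes I: "finite I" "disjoint_family_on B I" "\<And>i. i \<in> I \<Longrightarrow> B i \<in> sets M"
    "\<And>i. i \<in> I \<Longrightarrow> measure M (B i) > 0" and i: "i \<in> I"
  shows "indicator (B i) \<in> cspan (insert (indicator (\<Union>i\<in>I. B i)) (diffs M B I))" (is "_ \<in> cspan ?S")
proof -
  let ?A = "\<Union>i\<in>I. B i" and ?m = "\<lambda>i. complex_of_real (measure M (B i))"
  let ?N = "\<lambda>i. normalized_indicator M (B i)"
  have mA: "measure M ?A = (\<Sum>i\<in>I. measure M (B i))"
    using finite_measure_finite_Union[of I B] I by auto
  have "measure M (B i) \<le> measure M ?A"
    unfolding mA using I i by (intro member_le_sum) auto
  then have A0: "measure M ?A > 0" using I(4)[OF i] by linarith
  let ?c = "\<lambda>j. ?m i * ?m j / complex_of_real (measure M ?A)"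
  have mN: "?m j * ?N j y = indicator (B j) y" if "j \<in> I" for j y
    using I(4)[OF that] by (simp add: normalized_indicator_def)
  have "indicator (B i) y = ?m i / complex_of_real (measure M ?A) * indicator ?A y
      + (\<Sum>j\<in>I. ?c j * (?N i y - ?N j y))" (is "_ = ?rhs y") for y
  proof -
    have "(\<Sum>j\<in>I. ?c j * (?N i y - ?N j y))
      = ?m i / complex_of_real (measure M ?A) * (\<Sum>j\<in>I. ?m j * ?N i y - ?m j * ?N j y)"
      by (simp add: sum_distrib_left algebra_simps)
    also have "(\<Sum>j\<in>I. ?m j * ?N i y - ?m j * ?N j y) = (\<Sum>j\<in>I. ?m j) * ?N i y - (\<Sum>j\<in>I. indicator (B j) y)"
      by (simp add: sum_subtractf sum_distrib_right mN)
    also have "(\<Sum>j\<in>I. ?m j) = complex_of_real (measure M ?A)" by (simp add: mA)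
    also have "(\<Sum>j\<in>I. indicator (B j) y) = (indicator ?A y :: complex)"
      using indicator_UN_sum[OF I(1,2)] by simp
    finally have "?rhs y = ?m i * ?N i y" using A0 by (simp add: field_simps)
    then show ?thesis using mN[OF i] by simp
  qed
  then have "indicator (B i) = ?rhs" by (simp add: fun_eq_iff)
  moreover have "?rhs \<in> cspan ?S"
  proof (intro cspan_add cspan_scale cspan_sum)
    show "indicator ?A \<in> cspan ?S" by (rule cspan_base) simp
    fix j assume "j \<in> I"
    show "(\<lambda>y. ?N i y - ?N j y) \<in> cspan ?S"
    proof (cases "i = j")
      case True then show ?thesis using cspan_zero by simp
    next
      case False
      then have "?N i - ?N j \<in> diffs M B I" using i \<open>j \<in> I\<close> by (auto simp: diffs_def)
      then show ?thesis by (intro cspan_base) (simp add: fun_diff_def)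
    qed
  qed
  ultimately show ?thesis by simp
qed

lemma (in finite_measure) integral_normalized_indicator:
  assumes "A \<in> sets M" "measure M A > 0"
  shows "(LINT y|M. normalized_indicator M A y) = 1"
proof -
  have "(LINT y|M. (indicator A y :: complex)) = (LINT y|M. complex_of_real (indicator A y))"
    by (intro Bochner_Integration.integral_cong) (auto simp: indicator_def)
  also have "\<dots> = complex_of_real (measure M A)"
    using assms by (subst integral_complex_of_real) auto
  finally show ?thesis using assms by (simp add: normalized_indicator_def)
qed

text \<open>Each normalised indicator integrates to 1, so a difference of two has mean zero.\<close>

lemma (in finite_measure) integral_diffs:
  assumes "\<And>i. i \<in> I \<Longrightarrow> B i \<in> sets M" "\<And>i. i \<in> I \<Longrightarrow> measure M (B i) > 0" "f \<in> diffs M B I"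
  shows "f \<in> L2 M" "(LINT y|M. f y) = 0" "y \<notin> (\<Union>i\<in>I. B i) \<Longrightarrow> f y = 0"
proof -
  from assms(3) obtain i j where ij: "f = (\<lambda>y. normalized_indicator M (B i) y - normalized_indicator M (B j) y)"
    "i \<in> I" "j \<in> I" by (auto simp: diffs_def fun_diff_def)
  note L = normalized_indicator_in_L2[OF assms(1)]
  show "f \<in> L2 M" using ij L by (auto intro!: L2_diff)
  show "(LINT y|M. f y) = 0"
    using ij L assms by (simp add: L2_in_integrable integral_normalized_indicator)
  show "f y = 0" if "y \<notin> (\<Union>i\<in>I. B i)"
    using that ij by (auto simp: normalized_indicator_def indicator_def)
qed

text \<open>Partitions indexed by a forest: \<open>L n\<close> is a generation, \<open>ch p\<close>
  the children of \<open>p\<close>, and \<open>B p\<close> the cell of \<open>p\<close>.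
  Disjointness is asked among roots and among siblings; for a whole generation it follows. Positive
  measure makes the normalised indicators meaningful.\<close>

locale nested_partitions = prob_space M for M :: "'x measure" +
  fixes L :: "nat \<Rightarrow> 'p set" and ch :: "'p \<Rightarrow> 'p set" and B :: "'p \<Rightarrow> 'x set"
  assumes finite_L: "finite (L n)"
    and L_Suc: "L (Suc n) = (\<Union>p\<in>L n. ch p)"
    and B_sets: "p \<in> L n \<Longrightarrow> B p \<in> sets M"
    and B_pos: "p \<in> L n \<Longrightarrow> measure M (B p) > 0"
    and B_root: "(\<Union>p\<in>L 0. B p) = space M"
    and disjoint_root: "disjoint_family_on B (L 0)"
    and B_ch: "p \<in> L n \<Longrightarrow> B p = (\<Union>q\<in>ch p. B q)"
    and disjoint_ch: "p \<in> L n \<Longrightarrow> disjoint_family_on B (ch p)"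
begin

abbreviation inds :: "nat \<Rightarrow> ('x \<Rightarrow> complex) set" where
  "inds n \<equiv> (\<lambda>p. indicator (B p)) ` L n"

text \<open>Generators of what is gained in passing from level \<open>m\<close> to level
  \<open>n\<close>: the splitting of a cell of level \<open>j\<close> leads to level
  \<open>j + 1\<close>, so \<open>j\<close> stops at \<open>n - 1\<close>.\<close>

definition details :: "nat \<Rightarrow> nat \<Rightarrow> ('x \<Rightarrow> complex) set" where
  "details m n = (\<Union>j\<in>{m..<n}. \<Union>p\<in>L j. diffs M B (ch p))"

lemma ch_L: "p \<in> L n \<Longrightarrow> q \<in> ch p \<Longrightarrow> q \<in> L (Suc n)"
  by (auto simp: L_Suc)

lemma ch_finite: "p \<in> L n \<Longrightarrow> finite (ch p)"
  by (rule finite_subset[OF _ finite_L[of "Suc n"]]) (auto simp: L_Suc)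

lemma B_mono: "p \<in> L n \<Longrightarrow> q \<in> ch p \<Longrightarrow> B q \<subseteq> B p"
  using B_ch by auto

lemma disjoint_L: "disjoint_family_on B (L n)"
proof (induction n)
  case 0 show ?case by (rule disjoint_root)
next
  case (Suc n)
  show ?case unfolding disjoint_family_on_def
  proof (intro ballI impI)
    fix q q' assume q: "q \<in> L (Suc n)" "q' \<in> L (Suc n)" "q \<noteq> q'"
    then obtain p p' where p: "p \<in> L n" "q \<in> ch p" "p' \<in> L n" "q' \<in> ch p'"
      by (auto simp: L_Suc)
    show "B q \<inter> B q' = {}"
    proof (cases "p = p'")
      case True
      then show ?thesis using disjoint_ch[OF p(1)] p q(3) by (auto simp: disjoint_family_on_def)
    next
      case False
      then have "B p \<inter> B p' = {}" using Suc p by (auto simp: disjoint_family_on_def)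
      then show ?thesis using B_mono[OF p(1,2)] B_mono[OF p(3,4)] by auto
    qed
  qed
qed

text \<open>Passing to a child shrinks the cell, so a cell inside or outside \<open>B q\<close> has
  its descendants on the same side. This dichotomy is behind the orthogonality of the wavelets and
  the intersection stability of the cells.\<close>

lemma nested: "m \<le> n \<Longrightarrow> p \<in> L n \<Longrightarrow> q \<in> L m \<Longrightarrow> B p \<subseteq> B q \<or> B p \<inter> B q = {}"
proof (induction n arbitrary: p rule: dec_induct)
  case base
  then show ?case using disjoint_L[of m] by (cases "p = q") (auto simp: disjoint_family_on_def)
next
  case (step n)
  then obtain p' where "p' \<in> L n" "p \<in> ch p'" by (auto simp: L_Suc)
  then show ?case using step.IH[of p'] step.prems B_mono[of p' n p] by blast
qed

lemma inds_L2: "inds n \<subseteq> L2 M"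
  using B_sets by (auto intro!: indicator_in_L2)

lemma indicator_ch: "p \<in> L n \<Longrightarrow> (indicator (B p) :: 'x \<Rightarrow> complex) = (\<lambda>y. \<Sum>q\<in>ch p. indicator (B q) y)"
  using indicator_UN_sum[OF ch_finite disjoint_ch, of p n n] B_ch[of p n] by auto

lemma inds_Suc: "inds n \<subseteq> cspan (inds (Suc n))"
proof safe
  fix p assume p: "p \<in> L n"
  have "(\<lambda>y. \<Sum>q\<in>ch p. indicator (B q) y) \<in> cspan (inds (Suc n))"
    using ch_L[OF p] by (intro cspan_sum cspan_base) auto
  then show "indicator (B p) \<in> cspan (inds (Suc n))" by (simp only: indicator_ch[OF p])
qed

lemma inds_mono: "m \<le> n \<Longrightarrow> cspan (inds m) \<subseteq> cspan (inds n)"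
  by (induction n rule: dec_induct) (use cspan_trans[OF inds_Suc] in auto)

lemma details_cspan: "details m n \<subseteq> cspan (inds n)"
proof
  fix f assume "f \<in> details m n"
  then obtain j p where jp: "j < n" "p \<in> L j" "f \<in> diffs M B (ch p)" by (auto simp: details_def)
  have "f \<in> cspan ((\<lambda>p. indicator (B p)) ` ch p)" using diffs_in_cspan jp(3) by auto
  also have "\<dots> \<subseteq> cspan (inds (Suc j))" using jp ch_L by (intro cspan_mono) auto
  also have "\<dots> \<subseteq> cspan (inds n)" using jp by (intro inds_mono) auto
  finally show "f \<in> cspan (inds n)" .
qed

lemma details_L2: "details m n \<subseteq> L2 M"
  using details_cspan cspan_L2[OF inds_L2] by blast

lemma details_mono: "n \<le> n' \<Longrightarrow> details m n \<subseteq> details m n'"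
  unfolding details_def by (intro UN_mono) auto

text \<open>Each splitting trades the indicator of a child for the indicator of its parent and the
  differences between siblings.\<close>

lemma inds_split: "m \<le> n \<Longrightarrow> cspan (inds n) \<subseteq> cspan (inds m \<union> details m n)"
proof (induction n rule: dec_induct)
  case base show ?case by (intro cspan_mono) auto
next
  case (step n)
  have mono: "cspan (inds m \<union> details m n) \<subseteq> cspan (inds m \<union> details m (Suc n))"
    using details_mono[of n "Suc n" m] by (intro cspan_mono) auto
  show ?case
  proof (rule cspan_trans, safe)
    fix q assume "q \<in> L (Suc n)"
    then obtain p where p: "p \<in> L n" "q \<in> ch p" by (auto simp: L_Suc)
    let ?U = "\<Union>q\<in>ch p. B q"
    have "indicator (B q) \<in> cspan (insert (indicator ?U) (diffs M B (ch p)))"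
      by (rule indicator_in_cspan_diffs[OF ch_finite[OF p(1)] disjoint_ch[OF p(1)] _ _ p(2)])
        (use ch_L[OF p(1)] in \<open>auto intro: B_sets B_pos\<close>)
    also have "\<dots> \<subseteq> cspan (inds m \<union> details m (Suc n))"
    proof (rule cspan_trans, rule insert_subsetI)
      have "indicator (B p) \<in> cspan (inds n)" using p by (auto intro!: cspan_base)
      then show "indicator ?U \<in> cspan (inds m \<union> details m (Suc n))"
        using step mono B_ch[OF p(1)] by auto
      have "diffs M B (ch p) \<subseteq> details m (Suc n)"
        using p step(1) by (fastforce simp: details_def)
      then show "diffs M B (ch p) \<subseteq> cspan (inds m \<union> details m (Suc n))"
        by (auto intro!: cspan_base)
    qed
    finally show "indicator (B q) \<in> cspan (inds m \<union> details m (Suc n))" .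
  qed
qed

text \<open>\<open>f\<close> has mean zero and is supported in a cell of level at least
  \<open>m\<close>; by \<open>nested\<close>, \<open>g\<close> is constant on that cell.\<close>

lemma details_orthogonal:
  assumes "f \<in> details m n" "g \<in> inds m" shows "L2_inner M f g = 0"
proof -
  from assms(1) obtain j p where jp: "m \<le> j" "p \<in> L j" "f \<in> diffs M B (ch p)"
    by (auto simp: details_def)
  from assms(2) obtain q where q: "q \<in> L m" "g = indicator (B q)" by auto
  note D = integral_diffs[OF _ _ jp(3)]
  have f0: "(LINT y|M. f y) = 0" using D(2) ch_L[OF jp(2)] B_sets B_pos by blast
  have fz: "f y = 0" if "y \<notin> B p" for y
    using D(3) ch_L[OF jp(2)] B_sets B_pos that B_ch[OF jp(2)] by metis
  have "L2_inner M g f = 0"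
  proof (cases "B p \<subseteq> B q")
    case True
    then have eq: "cnj (g y) * f y = f y" for y
      using fz q by (cases "y \<in> B p") (auto simp: indicator_def)
    show ?thesis unfolding L2_inner_def eq by (rule f0)
  next
    case False
    then have "B p \<inter> B q = {}" using nested[OF jp(1,2) q(1)] by auto
    then have eq: "cnj (g y) * f y = 0" for y
      using fz q by (cases "y \<in> B p") (auto simp: indicator_def)
    show ?thesis unfolding L2_inner_def eq by simp
  qed
  then show ?thesis by (simp add: L2_inner_commute[of M f])
qed

text \<open>For the inclusion from left to right, a representative splits as \<open>v + w\<close>
  with \<open>v\<close> in the coarse span. Since \<open>w\<close> is orthogonal to
  \<open>v\<close>, orthogonality to the coarse span leaves \<open>L2_inner M v v = 0\<close>, so
  \<open>v\<close> vanishes almost everywhere.\<close>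

lemma wavelet_eq_details:
  assumes "m \<le> n"
  shows "L2_span M (inds n) \<inter> L2_perp M (L2_span M (inds m)) = L2_span M (details m n)"
proof (intro equalityI subsetI)
  have orth: "L2_orthogonal M (L2_span M (details m n)) (L2_span M (inds m))"
    by (rule L2_orthogonal_L2_span[OF details_L2 inds_L2 details_orthogonal])
  fix f
  {
    assume "f \<in> L2_span M (details m n)"
    then show "f \<in> L2_span M (inds n) \<inter> L2_perp M (L2_span M (inds m))"
      using orth L2_span_mono[OF cspan_trans[OF details_cspan[of m n]], of M]
        L2_span_L2[of M "details m n"]
      by (auto simp: L2_orthogonal_def L2_perp_def)
  }
  assume "f \<in> L2_span M (inds n) \<inter> L2_perp M (L2_span M (inds m))"
  then obtain h where f: "f \<in> L2 M" "h \<in> cspan (inds n)" "AE y in M. f y = h y"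
    and perp: "\<And>g. g \<in> L2_span M (inds m) \<Longrightarrow> L2_inner M f g = 0"
    by (auto simp: L2_perp_def elim: L2_spanE)
  from inds_split[OF assms] f(2) have "h \<in> cspan (inds m \<union> details m n)" by auto
  from cspan_Un[OF this] obtain v w where vw: "v \<in> cspan (inds m)" "w \<in> cspan (details m n)"
    "h = (\<lambda>y. v y + w y)" by auto
  have L: "v \<in> L2 M" "w \<in> L2 M"
    using vw(1,2) cspan_L2[OF inds_L2] cspan_L2[OF details_L2] by blast+
  have v: "v \<in> L2_span M (inds m)" using cspan_L2_span[OF inds_L2] vw(1) by auto
  have w: "w \<in> L2_span M (details m n)" using cspan_L2_span[OF details_L2] vw(2) by auto
  have "L2_inner M h v = L2_inner M f v"
    using L2_inner_cong_AE[of f M h v v] f L vw(3) by (simp add: L2_add)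
  then have "L2_inner M h v = 0" using perp[OF v] by simp
  moreover have "L2_inner M h v = L2_inner M v v + L2_inner M w v"
    unfolding vw(3) by (rule L2_inner_add_left) (use L in auto)
  moreover have "L2_inner M w v = 0" using orth v w by (auto simp: L2_orthogonal_def)
  ultimately have "AE y in M. v y = 0" using L2_inner_self_eq_0[OF L(1)] by simp
  with f(3) have "AE y in M. f y = w y" unfolding vw(3) by eventually_elim simp
  then show "f \<in> L2_span M (details m n)" using f(1) vw(2) by (intro L2_spanI)
qed

section \<open>Conditional expectations onto the levels\<close>

definition proj :: "nat \<Rightarrow> ('x \<Rightarrow> complex) \<Rightarrow> 'x \<Rightarrow> complex" where
  "proj n f y = (\<Sum>p\<in>L n. L2_inner M (indicator (B p)) f / complex_of_real (measure M (B p)) * indicator (B p) y)"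

lemma proj_cspan: "proj n f \<in> cspan (inds n)"
  unfolding proj_def[abs_def] by (intro cspan_sum cspan_scale cspan_base) auto

lemma proj_L2: "proj n f \<in> L2 M"
  using proj_cspan cspan_L2[OF inds_L2] by blast

lemma L2_inner_indicator: 
  assumes "p \<in> L n" "q \<in> L n"
  shows "L2_inner M (indicator (B q)) (indicator (B p)) = (if p = q then complex_of_real (measure M (B q)) else 0)"
proof -
  have "L2_inner M (indicator (B q)) (indicator (B p)) =
      (LINT y|M. complex_of_real (indicator (if p = q then B q else {}) y))"
    unfolding L2_inner_def using disjoint_L[of n] assms
    by (intro Bochner_Integration.integral_cong) (auto simp: indicator_def disjoint_family_on_def)
  also have "\<dots> = complex_of_real (measure M (if p = q then B q else {}))"
    using B_sets[OF assms(2)] by (subst integral_complex_of_real) (auto simp: Int_absorb2 sets.sets_into_space)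
  finally show ?thesis by auto
qed

lemma L2_inner_indicator_proj:
  assumes q: "q \<in> L n" shows "L2_inner M (indicator (B q)) (proj n f) = L2_inner M (indicator (B q)) f"
proof -
  define a where "a p = L2_inner M (indicator (B p)) f / complex_of_real (measure M (B p))" for p
  have int: "integrable M (\<lambda>y. cnj (indicator (B q) y) * (a p * indicator (B p) y))" if "p \<in> L n" for p
    by (intro L2_mult_integrable L2_scale indicator_in_L2 B_sets[OF that] B_sets[OF q])
  have "L2_inner M (indicator (B q)) (proj n f)
      = (\<Sum>p\<in>L n. L2_inner M (indicator (B q)) (\<lambda>y. a p * indicator (B p) y))"
    unfolding proj_def[abs_def] a_def[symmetric] unfolding L2_inner_def sum_distrib_left using int by (subst Bochner_Integration.integral_sum) auto
  also have "\<dots> = (\<Sum>p\<in>L n. if p = q then L2_inner M (indicator (B q)) f else 0)"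
    unfolding L2_inner_scale_right using B_pos[OF q]
    by (intro sum.cong refl) (auto simp: a_def L2_inner_indicator q)
  finally show ?thesis using q finite_L by simp
qed

lemma proj_perp:
  assumes f: "f \<in> L2 M" shows "(\<lambda>y. f y - proj n f y) \<in> L2_perp M (L2_span M (inds n))"
proof -
  let ?u = "\<lambda>y. f y - proj n f y"
  have u: "?u \<in> L2 M" by (intro L2_diff f proj_L2)
  have "L2_inner M ?u g = 0" if "g \<in> L2_span M (inds n)" for g
  proof -
    from that obtain h where h: "g \<in> L2 M" "h \<in> cspan (inds n)" "AE y in M. g y = h y" by (rule L2_spanE)
    have "L2_inner M ?u h = 0"
    proof (rule L2_inner_cspan_right[OF u inds_L2 _ h(2)])
      fix g assume "g \<in> inds n"
      then obtain q where q: "q \<in> L n" "g = indicator (B q)" by auto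
      have "L2_inner M g ?u = 0"
        using L2_inner_diff_right[OF _ f proj_L2, of g n f] L2_inner_indicator_proj[OF q(1), of f] q
          indicator_in_L2[OF B_sets[OF q(1)]] by simp
      then show "L2_inner M ?u g = 0" using L2_inner_commute[of M ?u g] by simp
    qed
    then show ?thesis
      using L2_inner_cong_AE[OF u u h(1) _ _ h(3)] cspan_L2[OF inds_L2] h(2) by auto
  qed
  then show ?thesis using u by (auto simp: L2_perp_def)
qed

text \<open>Pythagoras: the error of \<open>h\<close> splits into a part orthogonal to the level and
  a part inside it. This turns a single good approximation into convergence of the projections, as
  its level is contained in all finer ones.\<close>

lemma proj_best:
  assumes f: "f \<in> L2 M" and h: "h \<in> cspan (inds n)"
  shows "(LINT y|M. (cmod (f y - proj n f y))\<^sup>2) \<le> (LINT y|M. (cmod (f y - h y))\<^sup>2)"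
proof -
  let ?u = "\<lambda>y. f y - proj n f y" and ?w = "\<lambda>y. proj n f y - h y"
  have w: "?w \<in> cspan (inds n)" by (intro cspan_diff proj_cspan h)
  have L: "?u \<in> L2 M" "?w \<in> L2 M"
    using cspan_L2[OF inds_L2] w by (intro L2_diff f proj_L2, blast)
  have "?w \<in> L2_span M (inds n)" using w cspan_L2_span[OF inds_L2] by auto
  then have uw: "L2_inner M ?u ?w = 0" using proj_perp[OF f, of n] by (auto simp: L2_perp_def)
  then have wu: "L2_inner M ?w ?u = 0" using L2_inner_commute[of M ?w ?u] by simp
  have "L2_inner M (\<lambda>y. ?u y + ?w y) (\<lambda>y. ?u y + ?w y) = L2_inner M ?u ?u + L2_inner M ?w ?w"
    using L uw wu by (simp only: L2_inner_add_left L2_inner_add_right L2_add) simp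
  then have "(LINT y|M. (cmod (f y - h y))\<^sup>2)
      = (LINT y|M. (cmod (?u y))\<^sup>2) + (LINT y|M. (cmod (?w y))\<^sup>2)"
    unfolding L2_inner_self of_real_add[symmetric] of_real_eq_iff by simp
  moreover have "(LINT y|M. (cmod (?w y))\<^sup>2) \<ge> 0" by simp
  ultimately show ?thesis by linarith
qed

section \<open>Density of the step functions, measured by squared distances\<close>

definition approximable :: "('x \<Rightarrow> complex) set" where
  "approximable = {f \<in> L2 M. \<forall>e>0. \<exists>n. \<exists>h\<in>cspan (inds n). (LINT y|M. (cmod (f y - h y))\<^sup>2) < e}"

lemma integral_norm_add_sq:
  assumes "f \<in> L2 M" "g \<in> L2 M"
  shows "(LINT y|M. (cmod (f y + g y))\<^sup>2) \<le> 2 * (LINT y|M. (cmod (f y))\<^sup>2) + 2 * (LINT y|M. (cmod (g y))\<^sup>2)"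
proof -
  have "(LINT y|M. (cmod (f y + g y))\<^sup>2) \<le> (LINT y|M. 2 * (cmod (f y))\<^sup>2 + 2 * (cmod (g y))\<^sup>2)"
    by (rule integral_mono)
      (use norm_add_sq_le L2_integrable[OF assms(1)] L2_integrable[OF assms(2)]
        L2_integrable[OF L2_add[OF assms]] in auto)
  then show ?thesis using L2_integrable[OF assms(1)] L2_integrable[OF assms(2)] by simp
qed

lemma approximable_closed:
  assumes f: "f \<in> L2 M" and lim: "\<And>e. e > 0 \<Longrightarrow> \<exists>g\<in>approximable. (LINT y|M. (cmod (f y - g y))\<^sup>2) < e"
  shows "f \<in> approximable"
  unfolding approximable_def
proof (intro CollectI conjI f allI impI)
  fix e :: real assume "e > 0"
  \<comment> \<open>The triangle inequality for squared distances carries a factor 2, and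
    \<open>2 * (e / 4) + 2 * (e / 4) = e\<close>.\<close>
  then have e4: "e / 4 > 0" by simp
  from lim[OF this] obtain g where g: "g \<in> approximable" "(LINT y|M. (cmod (f y - g y))\<^sup>2) < e / 4" by auto
  then obtain n h where h: "h \<in> cspan (inds n)" "(LINT y|M. (cmod (g y - h y))\<^sup>2) < e / 4"
    using e4 unfolding approximable_def by blast
  have L: "g \<in> L2 M" "h \<in> L2 M" using g h cspan_L2[OF inds_L2] by (auto simp: approximable_def)
  have "(LINT y|M. (cmod (f y - h y))\<^sup>2) \<le> 2 * (LINT y|M. (cmod (f y - g y))\<^sup>2) + 2 * (LINT y|M. (cmod (g y - h y))\<^sup>2)"
    using integral_norm_add_sq[OF L2_diff[OF f L(1)] L2_diff[OF L]] by simp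
  also have "\<dots> < e" using g h by simp
  finally show "\<exists>n. \<exists>h\<in>cspan (inds n). (LINT y|M. (cmod (f y - h y))\<^sup>2) < e" using h(1) by blast
qed

lemma cspan_approximable: "cspan (inds n) \<subseteq> approximable"
proof
  fix f assume f: "f \<in> cspan (inds n)"
  then show "f \<in> approximable" using cspan_L2[OF inds_L2]
    by (auto simp: approximable_def intro!: exI[of _ n] bexI[of _ f])
qed

lemma approximable_add:
  assumes "f \<in> approximable" "g \<in> approximable" shows "(\<lambda>y. f y + g y) \<in> approximable"
proof (rule approximable_closed)
  show "(\<lambda>y. f y + g y) \<in> L2 M" using assms by (auto simp: approximable_def intro!: L2_add)
  fix e :: real assume "e > 0"
  then have e4: "e / 4 > 0" by simp
  obtain n h where h: "h \<in> cspan (inds n)" "(LINT y|M. (cmod (f y - h y))\<^sup>2) < e / 4"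
    using assms(1) e4 unfolding approximable_def by blast
  obtain n' h' where h': "h' \<in> cspan (inds n')" "(LINT y|M. (cmod (g y - h' y))\<^sup>2) < e / 4"
    using assms(2) e4 unfolding approximable_def by blast
  have L: "f \<in> L2 M" "g \<in> L2 M" "h \<in> L2 M" "h' \<in> L2 M"
    using assms h h' cspan_L2[OF inds_L2] by (auto simp: approximable_def)
  \<comment> \<open>The two approximants may live on different levels and are added on the finer
    one.\<close>
  have "(\<lambda>y. h y + h' y) \<in> cspan (inds (max n n'))"
    using h h' inds_mono[of n "max n n'"] inds_mono[of n' "max n n'"] by (auto intro!: cspan_add)
  moreover have "(LINT y|M. (cmod ((f y - h y) + (g y - h' y)))\<^sup>2) < e"
    using integral_norm_add_sq[OF L2_diff[OF L(1,3)] L2_diff[OF L(2,4)]] h h' by simp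
  then have "(LINT y|M. (cmod (f y + g y - (h y + h' y)))\<^sup>2) < e" by (simp add: algebra_simps)
  ultimately show "\<exists>g'\<in>approximable. (LINT y|M. (cmod (f y + g y - g' y))\<^sup>2) < e"
    using cspan_approximable by (intro bexI[of _ "\<lambda>y. h y + h' y"]) blast+
qed

lemma approximable_scale:
  assumes "f \<in> approximable" shows "(\<lambda>y. c * f y) \<in> approximable"
proof (cases "c = 0")
  case True
  then show ?thesis using cspan_zero cspan_approximable[of 0] by auto
next
  case False
  show ?thesis
  proof (rule approximable_closed)
    show "(\<lambda>y. c * f y) \<in> L2 M" using assms by (auto simp: approximable_def intro!: L2_scale)
    fix e :: real assume "e > 0"
    then have "e / (cmod c)\<^sup>2 > 0" using False by simp
    then obtain n h where h: "h \<in> cspan (inds n)" "(LINT y|M. (cmod (f y - h y))\<^sup>2) < e / (cmod c)\<^sup>2"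
      using assms unfolding approximable_def by blast
    have "(LINT y|M. (cmod (c * f y - c * h y))\<^sup>2) = (LINT y|M. (cmod c)\<^sup>2 * (cmod (f y - h y))\<^sup>2)"
      by (simp add: norm_mult power_mult_distrib flip: right_diff_distrib)
    also have "\<dots> < e" using h(2) False by (simp add: field_simps)
    finally show "\<exists>g\<in>approximable. (LINT y|M. (cmod (c * f y - g y))\<^sup>2) < e"
      using cspan_approximable[of n] cspan_scale[OF h(1), of c]
      by (intro bexI[of _ "\<lambda>y. c * h y"]) auto
  qed
qed

lemma approximable_sum:
  "(\<And>i. i \<in> I \<Longrightarrow> f i \<in> approximable) \<Longrightarrow> (\<lambda>y. \<Sum>i\<in>I. f i y) \<in> approximable"
proof (induction I rule: infinite_finite_induct)
  case (insert i I)
  then show ?case by (auto intro!: approximable_add)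
qed (use cspan_zero cspan_approximable[of 0] in auto)

lemma approximable_cong:
  assumes "f \<in> approximable" "g \<in> L2 M" "\<And>y. y \<in> space M \<Longrightarrow> f y = g y" shows "g \<in> approximable"
proof (rule approximable_closed[OF assms(2)])
  fix e :: real assume "e > 0"
  moreover have "(LINT y|M. (cmod (g y - f y))\<^sup>2) = (LINT y|M. 0)"
    using assms(3) by (intro Bochner_Integration.integral_cong) auto
  ultimately show "\<exists>f\<in>approximable. (LINT y|M. (cmod (g y - f y))\<^sup>2) < e"
    using assms(1) by (intro bexI[of _ f]) auto
qed

context
  assumes gen: "sets M = sigma_sets (space M) (\<Union>n. B ` L n)"
begin

text \<open>Dynkin's argument. By \<open>nested\<close> the cells are stable under intersection once
  the empty set is adjoined for disjoint cells, and sets with approximable indicator are closed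
  under complements and countable disjoint unions.\<close>

lemma indicator_approximable: "A \<in> sets M \<Longrightarrow> indicator A \<in> approximable"
proof -
  let ?G = "insert {} (\<Union>n. B ` L n)"
  assume A: "A \<in> sets M"
  have "sets M \<subseteq> sigma_sets (space M) ?G"
    unfolding gen by (intro sigma_sets_mono') auto
  with A have A': "A \<in> sigma_sets (space M) ?G" by auto
  have sub: "sigma_sets (space M) ?G \<subseteq> sets M"
    using B_sets by (intro sets.sigma_sets_subset) auto
  have IS: "Int_stable ?G"
  proof (rule Int_stableI)
    have *: "B p \<inter> B q \<in> ?G" if "p \<in> L n" "q \<in> L m" "m \<le> n" for p q m n
    proof -
      from nested[OF that(3,1,2)] have "B p \<inter> B q = B p \<or> B p \<inter> B q = {}" by auto
      then show ?thesis using that by auto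
    qed
    fix a b assume ab: "a \<in> ?G" "b \<in> ?G"
    show "a \<inter> b \<in> ?G"
    proof (cases "a = {} \<or> b = {}")
      case False
      with ab obtain p q n m where pq: "a = B p" "b = B q" "p \<in> L n" "q \<in> L m" by auto
      show ?thesis
        using *[of p n q m] *[of q m p n] pq by (cases "m \<le> n") (simp_all add: Int_commute)
    qed auto
  qed
  have sp: "?G \<subseteq> Pow (space M)" using B_sets sets.sets_into_space by blast
  have one: "indicator (space M) \<in> approximable"
  proof -
    have "(indicator (space M) :: 'x \<Rightarrow> complex) = (\<lambda>y. \<Sum>p\<in>L 0. indicator (B p) y)"
      using indicator_UN_sum[OF finite_L disjoint_root] B_root by auto
    also have "\<dots> \<in> cspan (inds 0)" by (intro cspan_sum cspan_base) auto
    finally show ?thesis using cspan_approximable by blast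
  qed
  show ?thesis using IS sp A'
  proof (induction rule: sigma_sets_induct_disjoint)
    case (basic A)
    show ?case
    proof (cases "A = {}")
      case True then show ?thesis using cspan_zero cspan_approximable[of 0] by auto
    next
      case False
      with basic obtain n p where "A = B p" "p \<in> L n" by auto
      then have "indicator A \<in> cspan (inds n)" by (auto intro!: cspan_base)
      then show ?thesis using cspan_approximable by blast
    qed
  next
    case empty
    then show ?case using cspan_zero cspan_approximable[of 0] by auto
  next
    case (compl A)
    then have "A \<subseteq> space M" using sub sets.sets_into_space by blast
    then have "(indicator (space M - A) :: 'x \<Rightarrow> complex) = (\<lambda>y. indicator (space M) y + (-1) * indicator A y)"
      by (auto simp: indicator_def fun_eq_iff)
    then show ?case using approximable_add[OF one approximable_scale[OF compl(2), of "-1"]] by simp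
  next
    case (union A)
    have Am: "A i \<in> sets M" for i using union(2) sub by auto
    let ?U = "\<lambda>n. \<Union>i<n. A i"
    show ?case
    proof (rule approximable_closed[OF indicator_in_L2])
      show "(\<Union>i. A i) \<in> sets M" using Am by auto
      fix e :: real assume "e > 0"
      \<comment> \<open>The squared distance between the indicators of nested sets is the measure of
        their difference, so continuity from below gives the approximation by finite unions.\<close>
      have "(\<lambda>n. measure M (?U n)) \<longlonglongrightarrow> measure M (\<Union>n. ?U n)"
      proof (rule finite_Lim_measure_incseq)
        show "incseq ?U" unfolding incseq_def by (intro allI impI UN_mono) auto
      qed (use Am in auto)
      moreover have "(\<Union>n. ?U n) = (\<Union>i. A i)" by auto
      ultimately have "(\<lambda>n. measure M (?U n)) \<longlonglongrightarrow> measure M (\<Union>i. A i)" by simp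
      from LIMSEQ_D[OF this \<open>e > 0\<close>] obtain n
        where n: "\<bar>measure M (?U n) - measure M (\<Union>i. A i)\<bar> < e" by fastforce
      have "(\<lambda>y. (cmod (indicator (\<Union>i. A i) y - indicator (?U n) y))\<^sup>2) = indicator ((\<Union>i. A i) - ?U n)"
        by (auto simp: fun_eq_iff indicator_def)
      then have "(LINT y|M. (cmod (indicator (\<Union>i. A i) y - indicator (?U n) y))\<^sup>2)
          = measure M ((\<Union>i. A i) - ?U n)"
        using Am by (simp add: Int_absorb2 sets.sets_into_space)
      also have "\<dots> = measure M (\<Union>i. A i) - measure M (?U n)"
        using Am by (intro finite_measure_Diff) auto
      also have "\<dots> < e" using n by linarith
      finally have "(LINT y|M. (cmod (indicator (\<Union>i. A i) y - indicator (?U n) y))\<^sup>2) < e" .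
      moreover have "(indicator (?U n) :: 'x \<Rightarrow> complex) = (\<lambda>y. \<Sum>i<n. indicator (A i) y)"
        using indicator_UN_sum[of "{..<n}" A] union(1) by (auto simp: disjoint_family_on_def)
      then have "indicator (?U n) \<in> approximable" using union(3) by (auto intro!: approximable_sum)
      ultimately show "\<exists>g\<in>approximable. (LINT y|M. (cmod (indicator (\<Union>i. A i) y - g y))\<^sup>2) < e"
        by blast
    qed
  qed
qed

lemma L2_approximable:
  assumes f: "f \<in> L2 M" shows "f \<in> approximable"
proof (rule approximable_closed[OF f])
  have [measurable]: "f \<in> borel_measurable M" using f by (simp add: L2_def)
  obtain s where "\<forall>i. simple_function M (s i)" "\<forall>y\<in>space M. (\<lambda>i. s i y) \<longlonglongrightarrow> f y"
    "\<forall>i. \<forall>y\<in>space M. dist (s i y) 0 \<le> 2 * dist (f y) 0"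
    using borel_measurable_implies_sequence_metric[of f M 0] by auto
  then have s: "\<And>i. simple_function M (s i)" "\<And>y. y \<in> space M \<Longrightarrow> (\<lambda>i. s i y) \<longlonglongrightarrow> f y"
    "\<And>i y. y \<in> space M \<Longrightarrow> cmod (s i y) \<le> 2 * cmod (f y)"
    by auto
  have [measurable]: "s i \<in> borel_measurable M" for i using s(1) by (rule borel_measurable_simple_function)
  have sL2: "s i \<in> L2 M" for i
  proof -
    have "integrable M (\<lambda>y. (cmod (s i y))\<^sup>2)"
    proof (rule Bochner_Integration.integrable_bound)
      show "integrable M (\<lambda>y. 4 * (cmod (f y))\<^sup>2)" using L2_integrable[OF f] by simp
      have "(cmod (s i y))\<^sup>2 \<le> 4 * (cmod (f y))\<^sup>2" if "y \<in> space M" for y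
        using power_mono[OF s(3)[OF that, of i], of 2] by (simp add: power_mult_distrib)
      then show "AE y in M. norm ((cmod (s i y))\<^sup>2) \<le> norm (4 * (cmod (f y))\<^sup>2)" by auto
    qed measurable
    then show ?thesis by (simp add: L2_def)
  qed
  have sa: "s i \<in> approximable" for i
  proof (rule approximable_cong[OF _ sL2])
    let ?A = "\<lambda>c. s i -` {c} \<inter> space M"
    show "(\<lambda>y. \<Sum>c\<in>s i ` space M. c * indicator (?A c) y) \<in> approximable"
      by (intro approximable_sum approximable_scale indicator_approximable) measurable
    fix y assume y: "y \<in> space M"
    have "(\<Sum>c\<in>s i ` space M. c * indicator (?A c) y) = (\<Sum>c\<in>s i ` space M. if c = s i y then c else 0)"
      using y by (intro sum.cong) (auto simp: indicator_def)
    also have "\<dots> = s i y" using y simple_functionD(1)[OF s(1)] by simp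
    finally show "(\<Sum>c\<in>s i ` space M. c * indicator (?A c) y) = s i y" .
  qed
  \<comment> \<open>The dominating function comes from \<open>|f - s i| \<le> |f| + 2 |f|\<close>,
    squared.\<close>
  have "(\<lambda>i. LINT y|M. (cmod (f y - s i y))\<^sup>2) \<longlonglongrightarrow> (LINT y|M. 0)"
  proof (rule integral_dominated_convergence[where w = "\<lambda>y. 9 * (cmod (f y))\<^sup>2"])
    show "integrable M (\<lambda>y. 9 * (cmod (f y))\<^sup>2)" using L2_integrable[OF f] by simp
    have "(\<lambda>i. (cmod (f y - s i y))\<^sup>2) \<longlonglongrightarrow> (cmod (f y - f y))\<^sup>2" if "y \<in> space M" for y
      by (intro tendsto_intros s(2) that)
    then show "AE y in M. (\<lambda>i. (cmod (f y - s i y))\<^sup>2) \<longlonglongrightarrow> 0" by simp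
    fix i
    have "(cmod (f y - s i y))\<^sup>2 \<le> 9 * (cmod (f y))\<^sup>2" if "y \<in> space M" for y
    proof -
      have "cmod (f y - s i y) \<le> 3 * cmod (f y)"
        using norm_triangle_ineq4[of "f y" "s i y"] s(3)[OF that, of i] by linarith
      from power_mono[OF this, of 2] show ?thesis by (simp add: power_mult_distrib)
    qed
    then show "AE y in M. norm ((cmod (f y - s i y))\<^sup>2) \<le> 9 * (cmod (f y))\<^sup>2" by auto
  qed measurable
  then have lim: "(\<lambda>i. LINT y|M. (cmod (f y - s i y))\<^sup>2) \<longlonglongrightarrow> 0" by simp
  fix e :: real assume "e > 0"
  from LIMSEQ_D[OF lim this] obtain i where "\<bar>LINT y|M. (cmod (f y - s i y))\<^sup>2\<bar> < e" by fastforce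
  then show "\<exists>g\<in>approximable. (LINT y|M. (cmod (f y - g y))\<^sup>2) < e" using sa by fastforce
qed

lemma proj_tendsto:
  assumes f: "f \<in> L2 M" shows "(\<lambda>n. LINT y|M. (cmod (f y - proj n f y))\<^sup>2) \<longlonglongrightarrow> 0"
proof (rule LIMSEQ_I)
  fix e :: real assume "e > 0"
  then obtain n h where h: "h \<in> cspan (inds n)" "(LINT y|M. (cmod (f y - h y))\<^sup>2) < e"
    using L2_approximable[OF f] by (auto simp: approximable_def)
  have "norm ((LINT y|M. (cmod (f y - proj m f y))\<^sup>2) - 0) < e" if "m \<ge> n" for m
    using proj_best[OF f, of h m] inds_mono[OF that] h by auto
  then show "\<exists>n. \<forall>m\<ge>n. norm ((LINT y|M. (cmod (f y - proj m f y))\<^sup>2) - 0) < e" by blast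
qed

text \<open>The wavelets use only every \<open>k\<close>-th level, hence the subsequence
  \<open>l\<close>. The components of \<open>f\<close> are the increments of its conditional
  expectations; the error of each of these is orthogonal to all coarser levels.\<close>

lemma wavelet_decomposition:
  fixes l :: "nat \<Rightarrow> nat"
  assumes l: "strict_mono l"
  defines "V \<equiv> \<lambda>n. L2_span M (inds (l n))"
  shows "is_L2_decomposition M (case_nat (V 0) (\<lambda>n. V (Suc n) \<inter> L2_perp M (V n)))"
    (is "is_L2_decomposition M ?U")
proof -
  have lmono: "m \<le> n \<Longrightarrow> l m \<le> l n" for m n using l by (simp add: strict_mono_less_eq)
  have Vmono: "V m \<subseteq> V n" if "m \<le> n" for m n
    unfolding V_def by (intro L2_span_mono inds_mono lmono that)
  have UV: "?U n \<subseteq> V n" for n by (cases n) auto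
  have orth: "L2_inner M f g = 0" if "m < n" "f \<in> ?U n" "g \<in> ?U m" for m n f g
  proof -
    from that obtain n' where n': "n = Suc n'" "m \<le> n'" by (cases n) auto
    have "g \<in> V n'" using UV[of m] Vmono[OF n'(2)] that(3) by auto
    then show ?thesis using that(2) n'(1) by (auto simp: L2_perp_def)
  qed
  show ?thesis
    unfolding is_L2_decomposition_def
  proof (intro conjI allI impI ballI)
    fix n show "?U n \<subseteq> L2 M" using UV[of n] L2_span_L2 unfolding V_def by blast
  next
    fix m n :: nat assume "m \<noteq> n"
    then consider "m < n" | "n < m" by linarith
    then show "L2_orthogonal M (?U m) (?U n)"
    proof cases
      case 1
      show ?thesis unfolding L2_orthogonal_def
      proof (intro ballI)
        fix f g assume "f \<in> ?U m" "g \<in> ?U n"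
        then show "L2_inner M f g = 0" using orth[OF 1, of g f] L2_inner_commute[of M f g] by simp
      qed
    next
      case 2
      then show ?thesis unfolding L2_orthogonal_def using orth by blast
    qed
  next
    fix f assume f: "f \<in> L2 M"
    define P where "P n = proj (l n) f" for n
    define g where "g = case_nat (P 0) (\<lambda>n y. P (Suc n) y - P n y)"
    have PV: "P n \<in> V n" for n
      unfolding P_def V_def using proj_cspan cspan_L2_span[OF inds_L2] by blast
    have PL: "P n \<in> L2 M" for n unfolding P_def by (rule proj_L2)
    have "g n \<in> ?U n" for n
    proof (cases n)
      case 0 then show ?thesis using PV by (simp add: g_def)
    next
      case (Suc m)
      have "(\<lambda>y. P (Suc m) y - P m y) \<in> V (Suc m)"
        using PV[of m] PV[of "Suc m"] Vmono[of m "Suc m"] unfolding V_def by (intro L2_span_diff) auto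
      moreover have "L2_inner M (\<lambda>y. P (Suc m) y - P m y) h = 0" if h: "h \<in> V m" for h
      proof -
        have hL: "h \<in> L2 M" using h L2_span_L2 unfolding V_def by blast
        have "L2_inner M (\<lambda>y. f y - P m y) h = 0"
          using proj_perp[OF f, of "l m"] h unfolding P_def V_def by (auto simp: L2_perp_def)
        moreover have "L2_inner M (\<lambda>y. f y - P (Suc m) y) h = 0"
          using proj_perp[OF f, of "l (Suc m)"] h Vmono[of m "Suc m"]
          unfolding P_def V_def by (auto simp: L2_perp_def)
        ultimately show ?thesis
          using L2_inner_diff_left[OF hL L2_diff[OF f PL] L2_diff[OF f PL], of m "Suc m"] by simp
      qed
      ultimately show ?thesis
        using PL by (auto simp: Suc g_def L2_perp_def intro!: L2_diff)
    qed
    \<comment> \<open>The increments telescope: the first \<open>N + 1\<close> components add up to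
      \<open>P N\<close>. The shift by one is removed at the end by
      \<open>LIMSEQ_imp_Suc\<close>.\<close>
    moreover have "(\<Sum>n<Suc N. g n y) = P N y" for N y
      by (induction N) (auto simp: g_def)
    then have "(\<lambda>N. LINT y|M. (cmod (f y - (\<Sum>n<Suc N. g n y)))\<^sup>2) \<longlonglongrightarrow> 0"
      using LIMSEQ_subseq_LIMSEQ[OF proj_tendsto[OF f] l] by (simp add: P_def o_def)
    then have "(\<lambda>N. LINT y|M. (cmod (f y - (\<Sum>n<N. g n y)))\<^sup>2) \<longlonglongrightarrow> 0"
      by (rule LIMSEQ_imp_Suc)
    ultimately show "\<exists>g. (\<forall>n. g n \<in> ?U n) \<and>
        (\<lambda>N. LINT y|M. (cmod (f y - (\<Sum>n<N. g n y)))\<^sup>2) \<longlonglongrightarrow> 0" by blast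
  qed
qed

end

end

section \<open>Paths in the Bratteli diagram and morphisms\<close>

lemma ex1_implies_unique: "\<exists>!x. P x \<Longrightarrow> P x \<Longrightarrow> P y \<Longrightarrow> x = y"
  by blast

text \<open>Every open set is a union of members of the countable family \<open>S'\<close>, hence a
  countable union. \<open>S\<close> may be larger: for infinite paths it contains all cylinder sets,
  while \<open>S'\<close> keeps those of composed finite paths.\<close>

lemma borel_sets_of_basis:
  assumes "countable S'" "S' \<subseteq> S"
    and basis: "\<And>A B x. A \<in> S \<Longrightarrow> B \<in> S \<Longrightarrow> x \<in> A \<Longrightarrow> x \<in> B \<Longrightarrow> \<exists>C\<in>S'. x \<in> C \<and> C \<subseteq> A \<inter> B"
  shows "borel_sets_of (topology_generated_by S) = sigma_sets (\<Union>S) S'"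
proof -
  have nb: "\<forall>x\<in>U. \<exists>C\<in>S'. x \<in> C \<and> C \<subseteq> U" if "generate_topology_on S U" for U
    using that
  proof (induction rule: generate_topology_on.induct)
    case (Int a b)
    show ?case
    proof
      fix x assume "x \<in> a \<inter> b"
      then obtain C D where CD: "C \<in> S'" "x \<in> C" "C \<subseteq> a" "D \<in> S'" "x \<in> D" "D \<subseteq> b"
        using Int.IH by blast
      then obtain E where "E \<in> S'" "x \<in> E" "E \<subseteq> C \<inter> D" using basis[of C D x] assms(2) by blast
      then show "\<exists>C\<in>S'. x \<in> C \<and> C \<subseteq> a \<inter> b" using CD by blast
    qed
  next
    case (UN K)
    show ?case
    proof
      fix x assume "x \<in> \<Union>K"
      then obtain U where "U \<in> K" "x \<in> U" by blast
      moreover from this obtain C where "C \<in> S'" "x \<in> C" "C \<subseteq> U" using UN.IH by blast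
      ultimately show "\<exists>C\<in>S'. x \<in> C \<and> C \<subseteq> \<Union>K" by blast
    qed
  next
    case (Basis s)
    show ?case
    proof
      fix x assume "x \<in> s"
      from basis[OF Basis Basis this this] show "\<exists>C\<in>S'. x \<in> C \<and> C \<subseteq> s" by simp
    qed
  qed simp
  have "sigma_sets (\<Union>S) {U. openin (topology_generated_by S) U} = sigma_sets (\<Union>S) S'"
  proof (rule sigma_sets_eqI)
    fix U assume "U \<in> {U. openin (topology_generated_by S) U}"
    then have U: "generate_topology_on S U" by (simp add: openin_topology_generated_by_iff)
    have "U = \<Union>{C \<in> S'. C \<subseteq> U}" using nb[OF U] by blast
    moreover have "countable {C \<in> S'. C \<subseteq> U}" using assms(1) by (rule countable_subset[rotated]) auto
    moreover have "\<Union>{C \<in> S'. C \<subseteq> U} \<in> sigma_sets (\<Union>S) S'"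
      using calculation(2) by (rule sigma_sets_UNION) auto
    ultimately show "U \<in> sigma_sets (\<Union>S) S'" by simp
  next
    fix C assume "C \<in> S'"
    then show "C \<in> sigma_sets (\<Union>S) {U. openin (topology_generated_by S) U}"
      using assms(2) by (auto intro!: sigma_sets.Basic topology_generated_by_Basis)
  qed
  then show ?thesis by (simp add: borel_sets_of_def)
qed

section \<open>Degrees, finite paths and cylinder sets of the diagram\<close>

lemma Nk_zero: "0 \<in> Nk k"
  and Nk_unit_deg: "i < k \<Longrightarrow> unit_deg i \<in> Nk k"
  by (auto simp: Nk_def unit_deg_def)

lemma Nk_level_deg: "level_deg k n \<in> Nk k"
  by (auto simp: Nk_def level_deg_def)

lemma level_deg_0: "level_deg k 0 = 0"
  by (auto simp: level_deg_def)

lemma level_deg_Suc: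
  assumes "k \<ge> 1" shows "level_deg k (Suc n) = level_deg k n + unit_deg (n mod k)"
proof
  fix i
  have "n mod k < k" using assms by simp
  then show "level_deg k (Suc n) i = (level_deg k n + unit_deg (n mod k)) i"
    by (auto simp: level_deg_def unit_deg_def div_Suc mod_Suc)
qed

lemma level_deg_mono: assumes "k \<ge> 1" "m \<le> n" shows "level_deg k m \<le> level_deg k n"
  using assms(2)
  by (induction n rule: dec_induct) (auto simp: level_deg_Suc[OF assms(1)] le_fun_def intro: le_SucI le_trans trans_le_add1)

lemma level_deg_add_mult: "i < k \<Longrightarrow> level_deg k (q * k + m) i = q + level_deg k m i"
  by (auto simp: level_deg_def)

lemma level_deg_mult: "k \<ge> 1 \<Longrightarrow> level_deg k (q * k) = diag_deg k q"
  by (auto simp: level_deg_def diag_deg_def)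

text \<open>The fold starts at the initial vertex, which is its own identity morphism, so that a
  path without edges also has a value.\<close>

definition pcomp :: "'a kgraph \<Rightarrow> 'a \<times> 'a list \<Rightarrow> 'a" where
  "pcomp G \<gamma> = foldl (cmp G) (fst \<gamma>) (snd \<gamma>)"

lemma pcomp_psnoc: "pcomp G (psnoc \<gamma> e) = cmp G (pcomp G \<gamma>) e"
  by (simp add: pcomp_def psnoc_def)

lemma plen_psnoc [simp]: "plen (psnoc \<gamma> e) = Suc (plen \<gamma>)"
  by (simp add: psnoc_def)

lemma psrc_psnoc [simp]: "psrc G (psnoc \<gamma> e) = src G e"
  by (simp add: psnoc_def psrc_def)

lemma psrc_Nil [simp]: "psrc G (v, []) = v"
  by (simp add: psrc_def)

lemma fst_psnoc [simp]: "fst (psnoc \<gamma> e) = fst \<gamma>"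
  by (simp add: psnoc_def)

lemma psnoc_inject [simp]: "psnoc \<gamma> e = psnoc \<gamma>' e' \<longleftrightarrow> \<gamma> = \<gamma>' \<and> e = e'"
  by (auto simp: psnoc_def prod_eq_iff)

lemma fpaths_Nil [simp]: "(v, []) \<in> fpaths k G \<longleftrightarrow> v \<in> verts G"
  by (simp add: fpaths_def)

lemma fpaths_psnoc: "psnoc \<gamma> e \<in> fpaths k G \<longleftrightarrow>
    \<gamma> \<in> fpaths k G \<and> e \<in> edges k G (plen \<gamma>) \<and> rng G e = psrc G \<gamma>"
proof -
  obtain v es where \<gamma>: "\<gamma> = (v, es)" by (cases \<gamma>)
  have "(\<forall>j<Suc (length es). P j) \<longleftrightarrow> (\<forall>j<length es. P j) \<and> P (length es)" for P
    by (auto simp: less_Suc_eq)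
  moreover have "(es @ [e]) ! (length es - 1) = last es" if "es \<noteq> []"
    using that by (simp add: nth_append last_conv_nth)
  moreover have "(es @ [e]) ! (j - 1) = es ! (j - 1)" if "j < length es" for j
    using that by (simp add: nth_append less_imp_diff_less)
  ultimately show ?thesis
    by (auto simp: \<gamma> fpaths_def psnoc_def psrc_def nth_append)
qed

lemma fpaths_cases:
  assumes "\<gamma> \<in> fpaths k G"
  obtains v where "v \<in> verts G" "\<gamma> = (v, [])"
  | \<eta> e where "\<gamma> = psnoc \<eta> e" "\<eta> \<in> fpaths k G" "e \<in> edges k G (plen \<eta>)" "rng G e = psrc G \<eta>"
proof (cases "snd \<gamma>" rule: rev_cases)
  case Nil
  with assms show ?thesis using that(1)[of "fst \<gamma>"] by (cases \<gamma>) auto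
next
  case (snoc es e)
  then have "\<gamma> = psnoc (fst \<gamma>, es) e" by (simp add: psnoc_def prod_eq_iff)
  with assms show ?thesis using that(2)[of "(fst \<gamma>, es)" e] fpaths_psnoc[of "(fst \<gamma>, es)" e] by auto
qed

lemma fpaths_induct [consumes 1, case_names vertex snoc]:
  assumes "\<gamma> \<in> fpaths k G"
    and "\<And>v. v \<in> verts G \<Longrightarrow> P (v, [])"
    and "\<And>\<gamma> e. \<gamma> \<in> fpaths k G \<Longrightarrow> e \<in> edges k G (plen \<gamma>) \<Longrightarrow> rng G e = psrc G \<gamma> \<Longrightarrow> P \<gamma> \<Longrightarrow> P (psnoc \<gamma> e)"
  shows "P \<gamma>"
  using assms(1)
proof (induction "plen \<gamma>" arbitrary: \<gamma>)
  case 0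
  from \<open>\<gamma> \<in> fpaths k G\<close> show ?case by (cases rule: fpaths_cases) (use 0 assms(2) in auto)
next
  case (Suc n)
  from \<open>\<gamma> \<in> fpaths k G\<close> show ?case by (cases rule: fpaths_cases) (use Suc assms in auto)
qed

lemma bcyl_psnoc: "bcyl k G (psnoc \<gamma> e) = {y \<in> bcyl k G \<gamma>. y (plen \<gamma>) = e}"
  by (auto simp: bcyl_def psnoc_def nth_append less_Suc_eq)

lemma bcyl_Nil: "bcyl k G (v, []) = {y \<in> bspace k G. rng G (y 0) = v}"
  by (simp add: bcyl_def)

lemma bcyl_bspace: "bcyl k G \<gamma> \<subseteq> bspace k G"
  by (auto simp: bcyl_def)

text \<open>A common point spells out both finite paths, so the shorter one is an initial segment of
  the longer one.\<close>

lemma bcyl_nested: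
  assumes "plen \<gamma> \<le> plen \<eta>" "y \<in> bcyl k G \<gamma>" "y \<in> bcyl k G \<eta>"
  shows "bcyl k G \<eta> \<subseteq> bcyl k G \<gamma>"
  using assms by (auto simp: bcyl_def)

locale finite_k_graph = k_graph k G for k and G :: "'a kgraph" +
  assumes k_pos: "k \<ge> 1" and finite_G: "finite_kgraph k G"
begin

abbreviation "ld \<equiv> level_deg k"

definition ext :: "'a \<times> 'a list \<Rightarrow> 'a set" where
  "ext \<gamma> = {e \<in> edges k G (plen \<gamma>). rng G e = psrc G \<gamma>}"

definition paths :: "nat \<Rightarrow> ('a \<times> 'a list) set" where
  "paths n = {\<gamma> \<in> fpaths k G. plen \<gamma> = n}"

text \<open>Degrees are additive and cancel, so equal degrees of the first factors force equal
  degrees of the second ones; then the uniqueness half of the factorization property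
  applies.\<close>

lemma factor_unique:
  assumes "f \<in> mor G" "g \<in> mor G" "src G f = rng G g" "f' \<in> mor G" "g' \<in> mor G" "src G f' = rng G g'"
    and "deg G f = deg G f'" "cmp G f g = cmp G f' g'"
  shows "f = f' \<and> g = g'"
proof -
  have d: "deg G (cmp G f g) = deg G f + deg G g" "deg G (cmp G f g) = deg G f + deg G g'"
    using deg_cmp[OF assms(1-3)] deg_cmp[OF assms(4-6)] assms(7,8) by auto
  then have "deg G g' = deg G g" by auto
  then have "(f, g) = (f', g')"
    by (intro ex1_implies_unique[OF
          factorization[OF cmp_mor[OF assms(1-3)] deg_Nk[OF assms(1)] deg_Nk[OF assms(2)] d(1)]])
      (use assms in auto)
  then show ?thesis by simp
qed

text \<open>A morphism \<open>v\<close> of degree 0 factors both as \<open>v\<close> composed with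
  \<open>src G v\<close> and as \<open>rng G v\<close> composed with \<open>v\<close>, all of degree
  0. Uniqueness identifies the first factors.\<close>

lemma rng_vert: "v \<in> verts G \<Longrightarrow> rng G v = v"
  using factor_unique[of v "src G v" "rng G v" v]
  by (auto simp: of_deg_def src_mor rng_mor rng_src src_rng deg_id cmp_src cmp_rng)

lemma src_vert: "v \<in> verts G \<Longrightarrow> src G v = v"
  using src_rng[of v] rng_vert[of v] by (simp add: of_deg_def)

lemma rng_verts: "f \<in> mor G \<Longrightarrow> rng G f \<in> verts G" and src_verts: "f \<in> mor G \<Longrightarrow> src G f \<in> verts G"
  by (auto simp: of_deg_def rng_mor src_mor deg_id)

lemma edges_mor: "e \<in> edges k G n \<Longrightarrow> e \<in> mor G" and edges_deg: "e \<in> edges k G n \<Longrightarrow> deg G e = unit_deg (n mod k)"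
  by (auto simp: edges_def of_deg_def)

lemma finite_of_deg: "n \<in> Nk k \<Longrightarrow> finite (of_deg G n)"
  using finite_G by (simp add: finite_kgraph_def)

lemma finite_edges: "finite (edges k G n)"
  unfolding edges_def using k_pos by (intro finite_of_deg Nk_unit_deg) simp

lemma finite_verts: "finite (verts G)"
  by (intro finite_of_deg Nk_zero)

lemma finite_ext: "finite (ext \<gamma>)"
  unfolding ext_def using finite_edges by simp

lemma psnoc_fpaths: "\<gamma> \<in> fpaths k G \<Longrightarrow> psnoc \<gamma> e \<in> fpaths k G \<longleftrightarrow> e \<in> ext \<gamma>"
  by (simp add: fpaths_psnoc ext_def)

lemma paths_0: "paths 0 = (\<lambda>v. (v, [])) ` verts G"
  by (auto simp: paths_def)

lemma paths_Suc: "paths (Suc n) = (\<Union>\<gamma>\<in>paths n. psnoc \<gamma> ` ext \<gamma>)"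
proof (intro equalityI subsetI)
  fix \<gamma> assume "\<gamma> \<in> paths (Suc n)"
  then have "\<gamma> \<in> fpaths k G" "plen \<gamma> = Suc n" by (auto simp: paths_def)
  then show "\<gamma> \<in> (\<Union>\<gamma>\<in>paths n. psnoc \<gamma> ` ext \<gamma>)"
  proof (cases rule: fpaths_cases)
    case (2 \<eta> e)
    with \<open>plen \<gamma> = Suc n\<close> have "\<eta> \<in> paths n" "e \<in> ext \<eta>" by (auto simp: paths_def ext_def)
    with 2(1) show ?thesis by blast
  qed (use \<open>plen \<gamma> = Suc n\<close> in simp)
qed (auto simp: paths_def ext_def fpaths_psnoc)

lemma finite_paths: "finite (paths n)"
  by (induction n) (auto simp: paths_0 paths_Suc finite_verts finite_ext)

lemma fpaths_UN: "fpaths k G = (\<Union>n. paths n)"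
  by (auto simp: paths_def)

lemma countable_fpaths: "countable (fpaths k G)"
  unfolding fpaths_UN using finite_paths by (auto intro: countable_finite)

lemma psrc_verts: "\<gamma> \<in> fpaths k G \<Longrightarrow> psrc G \<gamma> \<in> verts G"
proof (induction rule: fpaths_induct)
  case (vertex v)
  then show ?case by (simp only: psrc_Nil)
next
  case (snoc \<gamma> e)
  then show ?case using src_verts[OF edges_mor[OF snoc(2)]] by (simp only: psrc_psnoc)
qed

lemma pcomp:
  assumes "\<gamma> \<in> fpaths k G"
  shows "pcomp G \<gamma> \<in> mor G" "rng G (pcomp G \<gamma>) = fst \<gamma>" "src G (pcomp G \<gamma>) = psrc G \<gamma>"
    "deg G (pcomp G \<gamma>) = ld (plen \<gamma>)"
proof -
  have "pcomp G \<gamma> \<in> mor G \<and> rng G (pcomp G \<gamma>) = fst \<gamma> \<and> src G (pcomp G \<gamma>) = psrc G \<gamma> \<and>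
      deg G (pcomp G \<gamma>) = ld (plen \<gamma>)"
    using assms
  proof (induction rule: fpaths_induct)
    case (vertex v)
    then have "v \<in> mor G" "deg G v = ld 0" by (auto simp: of_deg_def level_deg_0)
    then show ?case using rng_vert[OF vertex] src_vert[OF vertex] by (simp add: pcomp_def)
  next
    case (snoc \<gamma> e)
    then show ?case
      by (auto simp: pcomp_psnoc cmp_mor rng_cmp src_cmp deg_cmp edges_mor edges_deg level_deg_Suc[OF k_pos])
  qed
  then show "pcomp G \<gamma> \<in> mor G" "rng G (pcomp G \<gamma>) = fst \<gamma>" "src G (pcomp G \<gamma>) = psrc G \<gamma>"
    "deg G (pcomp G \<gamma>) = ld (plen \<gamma>)" by auto
qed

text \<open>Factorization at degree \<open>ld n\<close> splits off a last morphism whose degree is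
  the unit vector prescribed at level \<open>n\<close>, that is, an edge.\<close>

lemma pcomp_surj:
  assumes "l \<in> mor G" "deg G l = ld n" shows "\<exists>\<gamma>\<in>paths n. pcomp G \<gamma> = l"
  using assms
proof (induction n arbitrary: l)
  case 0
  have "deg G l = 0" using 0(2) by (rule trans[OF _ level_deg_0])
  with 0(1) have "l \<in> verts G" by (simp add: of_deg_def)
  then show ?case by (auto simp: paths_0 pcomp_def)
next
  case (Suc n)
  have "n mod k < k" using k_pos by simp
  have d: "deg G l = ld n + unit_deg (n mod k)"
    by (rule trans[OF Suc.prems(2) level_deg_Suc[OF k_pos]])
  obtain f g where fg: "f \<in> mor G" "g \<in> mor G" "src G f = rng G g" "deg G f = ld n"
    "deg G g = unit_deg (n mod k)" "l = cmp G f g"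
    using ex1_implies_ex[OF factorization[OF Suc.prems(1) Nk_level_deg Nk_unit_deg[OF \<open>n mod k < k\<close>] d]]
    by auto
  from Suc.IH[OF fg(1,4)] obtain \<gamma> where \<gamma>: "\<gamma> \<in> paths n" "pcomp G \<gamma> = f" by auto
  then have "psnoc \<gamma> g \<in> paths (Suc n)"
    using fg pcomp(3)[of \<gamma>] by (auto simp: paths_def fpaths_psnoc edges_def of_deg_def)
  then show ?case using \<gamma> fg by (auto intro!: bexI[of _ "psnoc \<gamma> g"] simp: pcomp_psnoc)
qed

section \<open>Infinite paths of the graph, read level by level\<close>

lemma Omega_mor: "(m, n) \<in> mor (Omega k) \<longleftrightarrow> m \<in> Nk k \<and> n \<in> Nk k \<and> m \<le> n"
  by (simp add: Omega_def)

lemma inf_path: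
  assumes x: "x \<in> inf_paths k G" and mn: "m \<in> Nk k" "n \<in> Nk k" "m \<le> n"
  shows "x (m, n) \<in> mor G" "deg G (x (m, n)) = n - m" "rng G (x (m, n)) = x (m, m)" "src G (x (m, n)) = x (n, n)"
proof -
  have M: "(m, n) \<in> mor (Omega k)" using mn by (simp add: Omega_mor)
  show "x (m, n) \<in> mor G"
    using x M by (auto simp: inf_paths_def functors_def)
  have "deg G (x (m, n)) = deg (Omega k) (m, n)" using x M unfolding inf_paths_def by blast
  then show "deg G (x (m, n)) = n - m" by (simp add: Omega_def)
  have "x (rng (Omega k) (m, n)) = rng G (x (m, n))" "x (src (Omega k) (m, n)) = src G (x (m, n))"
    using x M unfolding inf_paths_def functors_def by blast+
  then show "rng G (x (m, n)) = x (m, m)" "src G (x (m, n)) = x (n, n)" by (simp_all add: Omega_def)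
qed

lemma inf_path_cmp:
  assumes x: "x \<in> inf_paths k G" and mn: "m \<in> Nk k" "n \<in> Nk k" "m \<le> n" "p \<in> Nk k" "n \<le> p"
  shows "x (m, p) = cmp G (x (m, n)) (x (n, p))"
proof -
  have M: "(m, n) \<in> mor (Omega k)" "(n, p) \<in> mor (Omega k)" using mn by (auto simp: Omega_mor)
  have "src (Omega k) (m, n) = rng (Omega k) (n, p)" by (simp add: Omega_def)
  then have "x (cmp (Omega k) (m, n) (n, p)) = cmp G (x (m, n)) (x (n, p))"
    using x M unfolding inf_paths_def functors_def by blast
  then show ?thesis by (simp add: Omega_def)
qed

text \<open>Infinite paths that agree up to degree \<open>n\<close> agree up to every smaller
  degree, by unique factorization of their common initial morphism at
  \<open>deg G l\<close>.\<close>

lemma cyl_subset: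
  assumes l: "l \<in> mor G" and x: "x \<in> cyl k G l" and n: "n \<in> Nk k" "deg G l \<le> n"
  shows "cyl k G (x (0, n)) \<subseteq> cyl k G l"
proof
  have xi: "x \<in> inf_paths k G" "x (0, deg G l) = l" using x by (auto simp: cyl_def)
  fix y assume "y \<in> cyl k G (x (0, n))"
  then have y: "y \<in> inf_paths k G" "y (0, deg G (x (0, n))) = x (0, n)" by (auto simp: cyl_def)
  have "0 \<le> n" by (simp add: le_fun_def)
  then have "deg G (x (0, n)) = n" using inf_path(2)[OF xi(1) Nk_zero n(1)] by (simp add: fun_eq_iff)
  with y(2) have eq: "y (0, n) = x (0, n)" by simp
  let ?d = "deg G l"
  have d: "?d \<in> Nk k" "0 \<le> ?d" using deg_Nk[OF l] by (auto simp: le_fun_def)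
  note c = inf_path_cmp[OF _ Nk_zero d n]
  note p = inf_path[OF _ Nk_zero d] inf_path[OF _ d(1) n]
  have "y (0, ?d) = x (0, ?d) \<and> y (?d, n) = x (?d, n)"
    by (rule factor_unique) (simp_all only: p[OF xi(1)] p[OF y(1)] c[OF xi(1), symmetric] c[OF y(1), symmetric] eq)
  then show "y \<in> cyl k G l" using xi y by (auto simp: cyl_def)
qed

lemma inf_path_level:
  assumes x: "x \<in> inf_paths k G"
  shows "x (0, ld n) \<in> mor G" "deg G (x (0, ld n)) = ld n" "src G (x (0, ld n)) = rng G (to_bratteli k x n)"
    "x (0, ld (Suc n)) = cmp G (x (0, ld n)) (to_bratteli k x n)"
    "to_bratteli k x n \<in> edges k G n" "src G (to_bratteli k x n) = rng G (to_bratteli k x (Suc n))"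
    "rng G (to_bratteli k x 0) = x (0, 0)"
proof -
  have z: "0 \<le> ld n" for n by (simp add: le_fun_def)
  have s: "ld n \<le> ld (Suc n)" for n by (simp add: level_deg_mono[OF k_pos])
  note a = inf_path[OF x Nk_zero Nk_level_deg[of k n] z] and b = inf_path[OF x Nk_level_deg Nk_level_deg s]
  show "x (0, ld n) \<in> mor G" by (rule a(1))
  show "deg G (x (0, ld n)) = ld n" unfolding a(2) by (simp add: fun_eq_iff)
  show "src G (x (0, ld n)) = rng G (to_bratteli k x n)"
    unfolding a(4) to_bratteli_def b(3) by (rule refl)
  show "x (0, ld (Suc n)) = cmp G (x (0, ld n)) (to_bratteli k x n)"
    unfolding to_bratteli_def by (rule inf_path_cmp[OF x Nk_zero Nk_level_deg z Nk_level_deg s])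
  have "deg G (to_bratteli k x n) = unit_deg (n mod k)"
    unfolding to_bratteli_def b(2) unfolding level_deg_Suc[OF k_pos] by (simp add: fun_eq_iff)
  then show "to_bratteli k x n \<in> edges k G n"
    using b(1)[of n] by (simp add: edges_def of_deg_def to_bratteli_def)
  show "src G (to_bratteli k x n) = rng G (to_bratteli k x (Suc n))"
    unfolding to_bratteli_def b(3) b(4) by (rule refl)
  have "rng G (to_bratteli k x 0) = x (ld 0, ld 0)"
    unfolding to_bratteli_def b(3) by (rule refl)
  then show "rng G (to_bratteli k x 0) = x (0, 0)" unfolding level_deg_0 .
qed

lemma to_bratteli_bspace: "x \<in> inf_paths k G \<Longrightarrow> to_bratteli k x \<in> bspace k G"
  using inf_path_level by (auto simp: bspace_def)

text \<open>The comparison of the two path spaces rests on this equivalence. In the induction step,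
  unique factorization recovers from the initial morphism of degree \<open>ld (Suc n)\<close> both
  its part of degree \<open>ld n\<close> and its last edge.\<close>

lemma to_bratteli_bcyl:
  assumes x: "x \<in> inf_paths k G" and "\<gamma> \<in> fpaths k G"
  shows "to_bratteli k x \<in> bcyl k G \<gamma> \<longleftrightarrow> x \<in> cyl k G (pcomp G \<gamma>)"
  using assms(2)
proof (induction rule: fpaths_induct)
  case (vertex v)
  then show ?case
    using x to_bratteli_bspace[OF x] inf_path_level(7)[OF x]
    by (auto simp: bcyl_Nil cyl_def pcomp_def of_deg_def)
next
  case (snoc \<gamma> e)
  note p = pcomp[OF snoc(1)]
  have ps: "psnoc \<gamma> e \<in> fpaths k G" using snoc by (simp add: fpaths_psnoc)
  let ?n = "plen \<gamma>"
  note l = inf_path_level[OF x]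
  have c: "x \<in> cyl k G (pcomp G \<gamma>) \<longleftrightarrow> x (0, ld ?n) = pcomp G \<gamma>"
    using x p by (simp add: cyl_def)
  have "x \<in> cyl k G (pcomp G (psnoc \<gamma> e)) \<longleftrightarrow> x (0, ld (Suc ?n)) = cmp G (pcomp G \<gamma>) e"
    using x pcomp(4)[OF ps] by (simp add: cyl_def pcomp_psnoc)
  also have "\<dots> \<longleftrightarrow> x (0, ld ?n) = pcomp G \<gamma> \<and> to_bratteli k x ?n = e"
  proof
    assume "x (0, ld (Suc ?n)) = cmp G (pcomp G \<gamma>) e"
    then have "cmp G (x (0, ld ?n)) (to_bratteli k x ?n) = cmp G (pcomp G \<gamma>) e" using l by simp
    then show "x (0, ld ?n) = pcomp G \<gamma> \<and> to_bratteli k x ?n = e"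
      by (intro factor_unique) (simp_all add: l edges_mor[OF l(5)] edges_mor[OF snoc(2)] p snoc(3))
  qed (use l(4)[of ?n] in simp)
  finally show ?case using snoc.IH c by (auto simp: bcyl_psnoc)
qed

lemma bspace_rng: "y \<in> bspace k G \<Longrightarrow> rng G (y 0) \<in> verts G"
  by (auto simp: bspace_def intro!: rng_verts edges_mor)

lemma bspace_eq_UN: "bspace k G = (\<Union>\<gamma>\<in>paths 0. bcyl k G \<gamma>)"
  by (auto simp: paths_0 bcyl_Nil dest: bspace_rng)

lemma bcyl_psrc:
  assumes "\<gamma> \<in> fpaths k G" "y \<in> bcyl k G \<gamma>" shows "y (plen \<gamma>) \<in> ext \<gamma>"
proof -
  have y: "y j \<in> edges k G j" "rng G (y (Suc j)) = src G (y j)" for j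
    using assms(2) by (auto simp: bcyl_def bspace_def)
  from assms have "rng G (y (plen \<gamma>)) = psrc G \<gamma>"
    by (cases rule: fpaths_cases) (auto simp: bcyl_psnoc bcyl_Nil y)
  then show ?thesis using y by (simp add: ext_def)
qed

lemma bcyl_eq_UN: "\<gamma> \<in> fpaths k G \<Longrightarrow> bcyl k G \<gamma> = (\<Union>e\<in>ext \<gamma>. bcyl k G (psnoc \<gamma> e))"
  using bcyl_psrc[of \<gamma>] by (auto simp: bcyl_psnoc)

lemma disjoint_bcyl_psnoc: "e \<noteq> e' \<Longrightarrow> bcyl k G (psnoc \<gamma> e) \<inter> bcyl k G (psnoc \<gamma> e') = {}"
  by (auto simp: bcyl_psnoc)

lemma UN_bcyl: "\<Union>(bcyl k G ` fpaths k G) = bspace k G"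
  using bspace_eq_UN by (auto simp: bcyl_def fpaths_UN)

lemma borel_sets_bspace:
  "borel_sets_of (topology_generated_by (bcyl k G ` fpaths k G)) = sigma_sets (bspace k G) (bcyl k G ` fpaths k G)"
proof -
  have "borel_sets_of (topology_generated_by (bcyl k G ` fpaths k G))
      = sigma_sets (\<Union>(bcyl k G ` fpaths k G)) (bcyl k G ` fpaths k G)"
  proof (rule borel_sets_of_basis)
    fix A B y assume "A \<in> bcyl k G ` fpaths k G" "B \<in> bcyl k G ` fpaths k G" "y \<in> A" "y \<in> B"
    then obtain \<gamma> \<eta> where ge: "A = bcyl k G \<gamma>" "B = bcyl k G \<eta>" "\<gamma> \<in> fpaths k G" "\<eta> \<in> fpaths k G" by auto
    show "\<exists>C\<in>bcyl k G ` fpaths k G. y \<in> C \<and> C \<subseteq> A \<inter> B"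
    proof (cases "plen \<gamma> \<le> plen \<eta>")
      case True
      then show ?thesis using bcyl_nested[of \<gamma> \<eta> y k G] ge \<open>y \<in> A\<close> \<open>y \<in> B\<close> by auto
    next
      case False
      then show ?thesis using bcyl_nested[of \<eta> \<gamma> y k G] ge \<open>y \<in> A\<close> \<open>y \<in> B\<close> by auto
    qed
  qed (use countable_fpaths in auto)
  then show ?thesis by (simp only: UN_bcyl)
qed

text \<open>The topology uses cylinder sets of arbitrary degree, while finite paths reach only the
  degrees \<open>ld n\<close>. Among these are the diagonal degrees, which dominate any two given
  degrees, so every point of an intersection of cylinder sets has a path cylinder around it inside
  the intersection.\<close>

lemma borel_sets_inf_paths:
  "borel_sets_of (topology_generated_by (cyl k G ` mor G))
    = sigma_sets (inf_paths k G) ((\<lambda>\<gamma>. cyl k G (pcomp G \<gamma>)) ` fpaths k G)"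
proof -
  have lvl: "\<exists>\<gamma>\<in>fpaths k G. x (0, diag_deg k n) = pcomp G \<gamma>" if "x \<in> inf_paths k G" for x n
    using pcomp_surj[OF inf_path_level(1,2)[OF that], of "n * k"]
    by (force simp: level_deg_mult[OF k_pos] paths_def)
  have incyl: "x \<in> cyl k G (x (0, diag_deg k n))" if "x \<in> inf_paths k G" for x n
    using that inf_path_level(2)[OF that, of "n * k"] by (simp add: level_deg_mult[OF k_pos] cyl_def)
  have bound: "\<exists>n. d \<le> diag_deg k n \<and> d' \<le> diag_deg k n" if "d \<in> Nk k" "d' \<in> Nk k" for d d'
  proof -
    \<comment> \<open>The sum of all entries of \<open>d\<close> and \<open>d'\<close> is a crude
      bound for each single entry.\<close>
    have "d i \<le> diag_deg k (\<Sum>i<k. d i + d' i) i \<and> d' i \<le> diag_deg k (\<Sum>i<k. d i + d' i) i" for i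
    proof (cases "i < k")
      case True
      have "d i + d' i \<le> (\<Sum>i<k. d i + d' i)"
        by (rule member_le_sum[of i "{..<k}" "\<lambda>i. d i + d' i"]) (use True in auto)
      then show ?thesis using True by (auto simp: diag_deg_def)
    qed (use that in \<open>auto simp: Nk_def\<close>)
    then show ?thesis unfolding le_fun_def by blast
  qed
  have dNk: "diag_deg k n \<in> Nk k" for n by (auto simp: Nk_def diag_deg_def)
  have "borel_sets_of (topology_generated_by (cyl k G ` mor G))
      = sigma_sets (\<Union>(cyl k G ` mor G)) ((\<lambda>\<gamma>. cyl k G (pcomp G \<gamma>)) ` fpaths k G)"
  proof (rule borel_sets_of_basis)
    fix A B x assume "A \<in> cyl k G ` mor G" "B \<in> cyl k G ` mor G" "x \<in> A" "x \<in> B"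
    then obtain l l' where l: "A = cyl k G l" "B = cyl k G l'" "l \<in> mor G" "l' \<in> mor G" by auto
    from bound[OF deg_Nk[OF l(3)] deg_Nk[OF l(4)]] obtain n
      where n: "deg G l \<le> diag_deg k n" "deg G l' \<le> diag_deg k n" by auto
    have x: "x \<in> inf_paths k G" using \<open>x \<in> A\<close> l by (auto simp: cyl_def)
    from lvl[OF x, of n] obtain \<gamma> where \<gamma>: "\<gamma> \<in> fpaths k G" "x (0, diag_deg k n) = pcomp G \<gamma>" by blast
    have "cyl k G (pcomp G \<gamma>) \<subseteq> A \<inter> B"
      using cyl_subset[OF l(3) _ dNk n(1), of x] cyl_subset[OF l(4) _ dNk n(2), of x] \<open>x \<in> A\<close> \<open>x \<in> B\<close> l \<gamma>
      by auto
    moreover have "x \<in> cyl k G (pcomp G \<gamma>)" using incyl[OF x, of n] \<gamma> by simp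
    ultimately show "\<exists>C\<in>(\<lambda>\<gamma>. cyl k G (pcomp G \<gamma>)) ` fpaths k G. x \<in> C \<and> C \<subseteq> A \<inter> B" using \<gamma>(1) by auto
  qed (use countable_fpaths pcomp(1) in auto)
  moreover have "\<Union>(cyl k G ` mor G) = inf_paths k G"
  proof (intro equalityI subsetI)
    fix x assume x: "x \<in> inf_paths k G"
    from lvl[OF x, of 0] obtain \<gamma> where "\<gamma> \<in> fpaths k G" "x (0, diag_deg k 0) = pcomp G \<gamma>" by blast
    with incyl[OF x, of 0] pcomp(1)[of \<gamma>] show "x \<in> \<Union>(cyl k G ` mor G)" by auto
  qed (auto simp: cyl_def)
  ultimately show ?thesis by simp
qed

text \<open>After \<open>n\<close> rounds through the \<open>k\<close> kinds of edges each kind has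
  been used \<open>n\<close> times. For this reason the \<open>n\<close>-th wavelet space belongs to
  level \<open>n * k\<close>.\<close>

lemma pcomp_paths_diag: "pcomp G ` paths (n * k) = of_deg G (diag_deg k n)"
proof (intro equalityI subsetI)
  fix l assume "l \<in> pcomp G ` paths (n * k)"
  then show "l \<in> of_deg G (diag_deg k n)"
    by (auto simp: of_deg_def paths_def pcomp level_deg_mult[OF k_pos])
next
  fix l assume "l \<in> of_deg G (diag_deg k n)"
  then have "l \<in> mor G" "deg G l = ld (n * k)" by (auto simp: of_deg_def level_deg_mult[OF k_pos])
  from pcomp_surj[OF this] show "l \<in> pcomp G ` paths (n * k)" by auto
qed

end

section \<open>The Dixmier trace measure\<close>

text \<open>Serves to exclude a zero adjacency matrix, which would be incompatible with an
  irreducible product.\<close>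

lemma matmul_zero_foldr:
  assumes "i \<in> set is" "\<And>v w. v \<in> V \<Longrightarrow> w \<in> V \<Longrightarrow> A i v w = 0" "v \<in> V" "w \<in> V"
  shows "foldr (\<lambda>i. matmul V (A i)) is matid v w = 0"
  using assms(1,3)
proof (induction "is" arbitrary: v)
  case (Cons j "is")
  show ?case
  proof (cases "j = i")
    case True
    then show ?thesis using assms(2) Cons.prems by (simp add: matmul_def)
  next
    case False
    then show ?thesis using Cons by (simp add: matmul_def)
  qed
qed simp

text \<open>Replaces the product matrix by successive application of its factors, the form in which
  sums over paths arise edge by edge.\<close>

lemma foldr_matmul_eval:
  assumes V: "finite V"
  shows "v \<in> V \<Longrightarrow> (\<Sum>w\<in>V. real (foldr (\<lambda>i. matmul V (A i)) is matid v w) * f w)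
    = foldr (\<lambda>i h v. \<Sum>w\<in>V. real (A i v w) * h w) is f v"
proof (induction "is" arbitrary: v)
  case Nil
  have "(\<Sum>w\<in>V. real (matid v w) * f w) = (\<Sum>w\<in>V. if w = v then f v else 0)"
    by (intro sum.cong) (auto simp: matid_def)
  then show ?case using Nil V by simp
next
  case (Cons i "is")
  let ?P = "foldr (\<lambda>i. matmul V (A i)) is matid"
  have "(\<Sum>w\<in>V. real (matmul V (A i) ?P v w) * f w) = (\<Sum>w\<in>V. \<Sum>u\<in>V. real (A i v u) * (real (?P u w) * f w))"
    by (intro sum.cong refl) (simp add: matmul_def sum_distrib_left mult.commute mult.left_commute)
  also have "\<dots> = (\<Sum>u\<in>V. real (A i v u) * (\<Sum>w\<in>V. real (?P u w) * f w))"
    by (subst sum.swap) (simp add: sum_distrib_left)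
  also have "\<dots> = (\<Sum>u\<in>V. real (A i v u) * foldr (\<lambda>i h v. \<Sum>w\<in>V. real (A i v w) * h w) is f u)"
    using Cons.IH by simp
  finally show ?case by simp
qed

lemma matpow_eigenvector:
  assumes V: "finite V" and eig: "\<And>v. v \<in> V \<Longrightarrow> (\<Sum>w\<in>V. real (A v w) * h w) = r * h v" and "v \<in> V"
  shows "(\<Sum>w\<in>V. real (matpow V A n v w) * h w) = r ^ n * h v"
  using assms(3)
proof (induction n arbitrary: v)
  case 0
  have "(\<Sum>w\<in>V. real (matid v w) * h w) = (\<Sum>w\<in>V. if w = v then h v else 0)"
    by (intro sum.cong) (auto simp: matid_def)
  then show ?case using 0 V by (simp add: matpow_def)
next
  case (Suc n)
  have "(\<Sum>w\<in>V. real (matpow V A (Suc n) v w) * h w)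
      = (\<Sum>w\<in>V. \<Sum>u\<in>V. real (A v u) * (real (matpow V A n u w) * h w))"
    by (intro sum.cong refl) (simp add: matpow_def matmul_def sum_distrib_left mult.commute mult.left_commute)
  also have "\<dots> = (\<Sum>u\<in>V. real (A v u) * (\<Sum>w\<in>V. real (matpow V A n u w) * h w))"
    by (subst sum.swap) (simp add: sum_distrib_left)
  also have "\<dots> = (\<Sum>u\<in>V. r ^ n * (real (A v u) * h u))"
    using Suc.IH by (intro sum.cong) auto
  also have "\<dots> = r ^ Suc n * h v"
    using eig[OF Suc.prems] by (simp flip: sum_distrib_left)
  finally show ?case .
qed

text \<open>If \<open>c\<close> is the least ratio of the entries of \<open>u\<close> and \<open>x\<close>, then \<open>u - c x\<close> is a nonnegative
  eigenvector with a zero entry, which vanishes by irreducibility.\<close>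

lemma irreducible_eigenvector_unique:
  fixes u x :: "'v \<Rightarrow> real"
  assumes V: "finite V" "V \<noteq> {}" and irr: "irreducible_mat V A"
    and x: "\<And>v. v \<in> V \<Longrightarrow> (\<Sum>w\<in>V. real (A v w) * x w) = r * x v" "\<And>v. v \<in> V \<Longrightarrow> x v > 0" "(\<Sum>v\<in>V. x v) = 1"
    and u: "\<And>v. v \<in> V \<Longrightarrow> (\<Sum>w\<in>V. real (A v w) * u w) = r * u v" "(\<Sum>v\<in>V. u v) = 1"
    and v: "v \<in> V"
  shows "u v = x v"
proof -
  define c where "c = Min ((\<lambda>v. u v / x v) ` V)"
  have "c \<in> (\<lambda>v. u v / x v) ` V" unfolding c_def using V by (intro Min_in) auto
  then obtain v0 where v0: "v0 \<in> V" "c = u v0 / x v0" by auto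
  define h where "h = (\<lambda>v. u v - c * x v)"
  have h0: "h v \<ge> 0" if "v \<in> V" for v
  proof -
    have "c \<le> u v / x v" unfolding c_def using that V by (intro Min_le) auto
    then show ?thesis using x(2)[OF that] by (simp add: h_def field_simps)
  qed
  have hv0: "h v0 = 0" using v0 x(2)[OF v0(1)] by (simp add: h_def)
  have eig: "(\<Sum>w\<in>V. real (A v w) * h w) = r * h v" if "v \<in> V" for v
  proof -
    have "(\<Sum>w\<in>V. real (A v w) * h w) = (\<Sum>w\<in>V. real (A v w) * u w) - c * (\<Sum>w\<in>V. real (A v w) * x w)"
      by (simp add: h_def right_diff_distrib sum_subtractf sum_distrib_left mult.left_commute)
    then show ?thesis using x(1)[OF that] u(1)[OF that] by (simp add: h_def algebra_simps)
  qed
  have hz: "h w = 0" if w: "w \<in> V" for w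
  proof -
    from irr v0(1) w obtain n where n: "matpow V A n v0 w > 0" by (auto simp: irreducible_mat_def)
    have "(\<Sum>w\<in>V. real (matpow V A n v0 w) * h w) = 0"
      using matpow_eigenvector[OF V(1) eig v0(1)] hv0 by simp
    then have "real (matpow V A n v0 w) * h w = 0"
      using sum_nonneg_eq_0_iff[OF V(1), of "\<lambda>w. real (matpow V A n v0 w) * h w"] h0 w by simp
    then show ?thesis using n by simp
  qed
  have uc: "u w = c * x w" if "w \<in> V" for w using hz[OF that] by (simp add: h_def)
  have "c * (\<Sum>v\<in>V. x v) = (\<Sum>v\<in>V. u v)" unfolding sum_distrib_left using uc by simp
  then have "c = 1" using x(3) u(2) by simp
  then show ?thesis using uc[OF v] by simp
qed

section \<open>Eigenvalues and sums over paths\<close>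

locale perron_k_graph = finite_k_graph k G for k and G :: "'a kgraph" +
  fixes x :: "'a \<Rightarrow> real"
  assumes irreducible: "irreducible_mat (verts G) (adj_prod k G)" and perron: "perron_vector k G x"
begin

text \<open>The scale of level \<open>n\<close>: with \<open>v\<close> the source of a path of that
  length, its cylinder set will have measure \<open>x v / growth n\<close> and its weight is
  \<open>growth n powr (- 1 / \<delta>) * x v\<close>.\<close>

definition growth :: "nat \<Rightarrow> real" where
  "growth n = (\<Prod>i<k. rho G i ^ ld n i)"

lemma x_pos: "v \<in> verts G \<Longrightarrow> x v > 0" and x_sum: "(\<Sum>v\<in>verts G. x v) = 1"
  and x_eigen: "i < k \<Longrightarrow> v \<in> verts G \<Longrightarrow> (\<Sum>w\<in>verts G. real (adj G i v w) * x w) = rho G i * x v"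
  using perron by (auto simp: perron_vector_def)

lemma verts_nonempty: "verts G \<noteq> {}"
  using x_sum by auto

text \<open>If one adjacency matrix vanished, so would every positive power of the product. A
  nonzero entry makes one side of the eigenvalue equation positive in its row.\<close>

lemma rho_pos:
  assumes i: "i < k" shows "rho G i > 0"
proof -
  obtain v0 where v0: "v0 \<in> verts G" using verts_nonempty by auto
  have "\<exists>v\<in>verts G. \<exists>w\<in>verts G. adj G i v w \<noteq> 0"
  proof (rule ccontr)
    assume "\<not> ?thesis"
    then have "adj_prod k G v w = 0" if "v \<in> verts G" "w \<in> verts G" for v w
      unfolding adj_prod_def by (intro matmul_zero_foldr[of i]) (use i that in auto)
    then have "matpow (verts G) (adj_prod k G) (Suc n) v0 v0 = 0" for n
      using v0 by (simp add: matpow_def matmul_def)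
    then have "matpow (verts G) (adj_prod k G) n v0 v0 = 0" if "n \<ge> 1" for n
      using that by (cases n) auto
    then show False using irreducible v0 by (force simp: irreducible_mat_def)
  qed
  then obtain v w where vw: "v \<in> verts G" "w \<in> verts G" "adj G i v w > 0" by auto
  have "0 < real (adj G i v w) * x w" using vw x_pos by simp
  also have "\<dots> \<le> (\<Sum>w\<in>verts G. real (adj G i v w) * x w)"
    using finite_verts vw by (intro member_le_sum) (auto intro!: mult_nonneg_nonneg less_imp_le[OF x_pos])
  also have "\<dots> = rho G i * x v" using x_eigen[OF i vw(1)] .
  finally show ?thesis using x_pos[OF vw(1)] by (simp add: zero_less_mult_iff)
qed

text \<open>At a vertex where \<open>x\<close> is minimal, a nonzero entry of the row is a positive
  integer and contributes at least the minimal value. The bound makes the weights decrease along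
  paths.\<close>

lemma rho_ge_1:
  assumes i: "i < k" shows "rho G i \<ge> 1"
proof -
  have "Min (x ` verts G) \<in> x ` verts G" using finite_verts verts_nonempty by (intro Min_in) auto
  then obtain v where v: "v \<in> verts G" "x v = Min (x ` verts G)" by auto
  have min: "x v \<le> x w" if "w \<in> verts G" for w
    unfolding v(2) using finite_verts that by (intro Min_le) auto
  have "(\<Sum>w\<in>verts G. real (adj G i v w) * x w) > 0"
    using x_eigen[OF i v(1)] rho_pos[OF i] x_pos[OF v(1)] by simp
  then have "(\<Sum>w\<in>verts G. real (adj G i v w) * x w) \<noteq> 0" by simp
  then obtain w where w: "w \<in> verts G" "real (adj G i v w) * x w \<noteq> 0"
    by (rule sum.not_neutral_contains_not_neutral)
  then have "real (adj G i v w) \<ge> 1" by simp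
  then have "x v \<le> real (adj G i v w) * x w"
    using min[OF w(1)] x_pos[OF w(1)] mult_right_mono[of 1 "real (adj G i v w)" "x w"] by linarith
  also have "\<dots> \<le> (\<Sum>w\<in>verts G. real (adj G i v w) * x w)"
    using finite_verts w by (intro member_le_sum) (auto intro!: mult_nonneg_nonneg less_imp_le[OF x_pos])
  also have "\<dots> = rho G i * x v" using x_eigen[OF i v(1)] .
  finally show ?thesis using x_pos[OF v(1)] by simp
qed

lemma growth_pos: "growth n > 0"
  unfolding growth_def using rho_pos by (intro prod_pos) auto

lemma growth_0: "growth 0 = 1"
  by (simp add: growth_def level_deg_def)

lemma growth_Suc: "growth (Suc n) = growth n * rho G (n mod k)"
proof -
  have n: "n mod k < k" using k_pos by simp
  have "growth (Suc n) = (\<Prod>i<k. rho G i ^ ld n i * (if i = n mod k then rho G (n mod k) else 1))"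
    unfolding growth_def level_deg_Suc[OF k_pos]
    by (intro prod.cong) (auto simp: unit_deg_def)
  then show ?thesis using n by (simp add: prod.distrib growth_def)
qed

lemma growth_add_mult: "growth (q * k + m) = growth (q * k) * growth m"
  unfolding growth_def prod.distrib[symmetric]
  using level_deg_add_mult[of _ k q m] level_deg_add_mult[of _ k q 0]
  by (intro prod.cong) (auto simp: power_add level_deg_def)

definition adj_op :: "nat \<Rightarrow> ('a \<Rightarrow> real) \<Rightarrow> 'a \<Rightarrow> real" where
  "adj_op i f v = (\<Sum>w\<in>verts G. real (adj G i v w) * f w)"

lemma sum_ext:
  assumes "\<gamma> \<in> fpaths k G"
  shows "(\<Sum>e\<in>ext \<gamma>. f (src G e)) = adj_op (plen \<gamma> mod k) f (psrc G \<gamma>)"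
proof -
  have "{e \<in> ext \<gamma>. src G e = w} =
      {l \<in> of_deg G (unit_deg (plen \<gamma> mod k)). rng G l = psrc G \<gamma> \<and> src G l = w}" for w
    by (auto simp: ext_def edges_def)
  then have card: "card {e \<in> ext \<gamma>. src G e = w} = adj G (plen \<gamma> mod k) (psrc G \<gamma>) w" for w
    by (simp add: adj_def)
  have "(\<Sum>e\<in>ext \<gamma>. f (src G e)) = (\<Sum>w\<in>verts G. \<Sum>e\<in>{e \<in> ext \<gamma>. src G e = w}. f (src G e))"
    by (rule sum.group[symmetric, OF finite_ext finite_verts])
      (auto simp: ext_def intro!: src_verts edges_mor)
  also have "\<dots> = (\<Sum>w\<in>verts G. real (card {e \<in> ext \<gamma>. src G e = w}) * f w)" by simp
  finally show ?thesis by (simp add: adj_op_def card)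
qed

lemma sum_ext_x:
  assumes "\<gamma> \<in> fpaths k G"
  shows "(\<Sum>e\<in>ext \<gamma>. x (src G e)) = rho G (plen \<gamma> mod k) * x (psrc G \<gamma>)"
  unfolding sum_ext[OF assms] adj_op_def using k_pos by (intro x_eigen psrc_verts assms) simp

lemma sum_paths_Suc: "(\<Sum>\<gamma>\<in>paths (Suc n). h \<gamma>) = (\<Sum>\<gamma>\<in>paths n. \<Sum>e\<in>ext \<gamma>. h (psnoc \<gamma> e))"
proof -
  have "(\<Sum>\<gamma>\<in>paths (Suc n). h \<gamma>) = (\<Sum>\<gamma>\<in>paths n. \<Sum>\<eta>\<in>psnoc \<gamma> ` ext \<gamma>. h \<eta>)"
    unfolding paths_Suc by (intro sum.UNION_disjoint) (auto simp: finite_paths finite_ext)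
  also have "\<dots> = (\<Sum>\<gamma>\<in>paths n. \<Sum>e\<in>ext \<gamma>. h (psnoc \<gamma> e))"
    by (intro sum.cong refl) (simp add: sum.reindex inj_on_def)
  finally show ?thesis .
qed

text \<open>Peeling off the last edge applies the last matrix first. The bound
  \<open>n \<le> k\<close> keeps the path within one period, where level \<open>j\<close> carries
  the \<open>j\<close>-th matrix itself.\<close>

lemma sum_paths_psrc:
  assumes "n \<le> k" "v \<in> verts G"
  shows "(\<Sum>\<gamma>\<in>paths n. if fst \<gamma> = v then f (psrc G \<gamma>) else 0) = foldr adj_op [0..<n] f v"
  using assms(1)
proof (induction n arbitrary: f)
  case 0
  have "(\<Sum>\<gamma>\<in>paths 0. if fst \<gamma> = v then f (psrc G \<gamma>) else 0) = (\<Sum>w\<in>verts G. if w = v then f w else 0)"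
    unfolding paths_0 by (subst sum.reindex) (auto simp: inj_on_def intro!: sum.cong)
  then show ?case using assms(2) finite_verts by simp
next
  case (Suc n)
  have "(\<Sum>\<gamma>\<in>paths (Suc n). if fst \<gamma> = v then f (psrc G \<gamma>) else 0)
      = (\<Sum>\<gamma>\<in>paths n. \<Sum>e\<in>ext \<gamma>. if fst \<gamma> = v then f (src G e) else 0)"
    unfolding sum_paths_Suc psrc_psnoc fst_psnoc by (rule refl)
  also have "\<dots> = (\<Sum>\<gamma>\<in>paths n. if fst \<gamma> = v then adj_op n f (psrc G \<gamma>) else 0)"
    using Suc.prems by (intro sum.cong refl) (auto simp: sum_ext paths_def)
  also have "\<dots> = foldr adj_op [0..<n] (adj_op n f) v"
    using Suc by simp
  finally show ?case by simp
qed

lemma adj_prod_eval: "v \<in> verts G \<Longrightarrow>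
    (\<Sum>w\<in>verts G. real (adj_prod k G v w) * f w) = foldr adj_op [0..<k] f v"
  unfolding adj_prod_def using foldr_matmul_eval[OF finite_verts, of v "adj G" "[0..<k]" f]
  by (simp add: adj_op_def[abs_def])

lemma sum_paths_x:
  assumes "v \<in> verts G"
  shows "(\<Sum>\<gamma>\<in>paths n. if fst \<gamma> = v then x (psrc G \<gamma>) else 0) = growth n * x v"
proof (induction n)
  case 0
  have "(\<Sum>\<gamma>\<in>paths 0. if fst \<gamma> = v then x (psrc G \<gamma>) else 0) = (\<Sum>w\<in>verts G. if w = v then x w else 0)"
    unfolding paths_0 by (subst sum.reindex) (auto simp: inj_on_def intro!: sum.cong)
  then show ?case using assms finite_verts by (simp add: growth_0)
next
  case (Suc n)
  have "(\<Sum>\<gamma>\<in>paths (Suc n). if fst \<gamma> = v then x (psrc G \<gamma>) else 0)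
      = (\<Sum>\<gamma>\<in>paths n. \<Sum>e\<in>ext \<gamma>. if fst \<gamma> = v then x (src G e) else 0)"
    unfolding sum_paths_Suc psrc_psnoc fst_psnoc by (rule refl)
  also have "\<dots> = (\<Sum>\<gamma>\<in>paths n. rho G (n mod k) * (if fst \<gamma> = v then x (psrc G \<gamma>) else 0))"
    by (intro sum.cong refl) (auto simp: sum_ext_x paths_def)
  finally show ?case using Suc by (simp add: growth_Suc flip: sum_distrib_left)
qed

lemma eigenvector_unique:
  assumes "\<And>v. v \<in> verts G \<Longrightarrow> (\<Sum>\<gamma>\<in>paths k. if fst \<gamma> = v then u (psrc G \<gamma>) else 0) = growth k * u v"
    and "(\<Sum>v\<in>verts G. u v) = 1" "v \<in> verts G"
  shows "u v = x v"
proof (rule irreducible_eigenvector_unique[OF finite_verts verts_nonempty irreducible _ x_pos x_sum _ assms(2,3)])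
  fix v assume v: "v \<in> verts G"
  show "(\<Sum>w\<in>verts G. real (adj_prod k G v w) * x w) = growth k * x v"
    using sum_paths_psrc[OF order_refl v, of x] sum_paths_x[OF v, of k] adj_prod_eval[OF v, of x] by simp
  show "(\<Sum>w\<in>verts G. real (adj_prod k G v w) * u w) = growth k * u v"
    using sum_paths_psrc[OF order_refl v, of u] assms(1)[OF v] adj_prod_eval[OF v, of u] by simp
qed

text \<open>Stationarity: after a whole number of periods, the continuations of
  \<open>\<gamma>\<close> are the paths that start at the vertex \<open>psrc G \<gamma>\<close> of
  the top level.\<close>

lemma append_fpaths:
  assumes \<gamma>: "\<gamma> \<in> paths (q * k)"
  shows "(fst \<gamma>, snd \<gamma> @ es) \<in> fpaths k G \<longleftrightarrow> (psrc G \<gamma>, es) \<in> fpaths k G"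
    "psrc G (fst \<gamma>, snd \<gamma> @ es) = psrc G (psrc G \<gamma>, es)"
proof -
  have g: "\<gamma> \<in> fpaths k G" "plen \<gamma> = q * k" using \<gamma> by (auto simp: paths_def)
  have src: "psrc G (fst \<gamma>, snd \<gamma> @ es) = psrc G (psrc G \<gamma>, es)" for es
    by (simp add: psrc_def)
  then show "psrc G (fst \<gamma>, snd \<gamma> @ es) = psrc G (psrc G \<gamma>, es)" .
  show "(fst \<gamma>, snd \<gamma> @ es) \<in> fpaths k G \<longleftrightarrow> (psrc G \<gamma>, es) \<in> fpaths k G"
  proof (induction es rule: rev_induct)
    case Nil
    have "(psrc G \<gamma>, []) \<in> fpaths k G" using psrc_verts[OF g(1)] by (simp only: fpaths_Nil)
    then show ?case using g by simp
  next
    case (snoc e es)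
    have "(fst \<gamma>, snd \<gamma> @ es @ [e]) = psnoc (fst \<gamma>, snd \<gamma> @ es) e"
      "(psrc G \<gamma>, es @ [e]) = psnoc (psrc G \<gamma>, es) e" by (simp_all add: psnoc_def)
    moreover have "edges k G (q * k + length es) = edges k G (length es)" by (simp add: edges_def)
    ultimately show ?case using snoc by (simp add: fpaths_psnoc src g(2))
  qed
qed

end

section \<open>Values of the Dixmier trace measure on cylinder sets\<close>

locale dixmier_k_graph = perron_k_graph k G x for k and G :: "'a kgraph" and x +
  fixes \<delta> :: real and \<mu> :: "(nat \<Rightarrow> 'a) measure"
  assumes \<delta>: "0 < \<delta>" "\<delta> < 1" and dixmier: "dixmier_measure k G x \<delta> \<mu>"
begin

lemma prob_space_\<mu>: "prob_space \<mu>" and space_\<mu>: "space \<mu> = bspace k G"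
  and sets_\<mu>: "sets \<mu> = sigma_sets (bspace k G) (bcyl k G ` fpaths k G)"
  using dixmier by (auto simp: dixmier_measure_def borel_sets_bspace)

sublocale \<mu>: prob_space \<mu> by (rule prob_space_\<mu>)

lemma bcyl_sets: "\<gamma> \<in> fpaths k G \<Longrightarrow> bcyl k G \<gamma> \<in> sets \<mu>"
  unfolding sets_\<mu> by (auto intro: sigma_sets.Basic)

lemma weight_eq: "weight k G x \<delta> \<gamma> = growth (plen \<gamma>) powr (- 1 / \<delta>) * x (psrc G \<gamma>)"
  by (simp add: weight_def growth_def)

lemma weight_pos: "\<gamma> \<in> fpaths k G \<Longrightarrow> weight k G x \<delta> \<gamma> > 0"
  using growth_pos[of "plen \<gamma>"] x_pos[OF psrc_verts] by (simp add: weight_eq)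

lemma weight_append:
  assumes \<gamma>: "\<gamma> \<in> paths (q * k)"
  shows "weight k G x \<delta> (fst \<gamma>, snd \<gamma> @ es) = growth (q * k) powr (- 1 / \<delta>) * weight k G x \<delta> (psrc G \<gamma>, es)"
proof -
  have "plen \<gamma> = q * k" using \<gamma> by (simp add: paths_def)
  then show ?thesis
    using growth_pos[of "q * k"] growth_pos[of "length es"]
    by (simp add: weight_eq append_fpaths(2)[OF \<gamma>] growth_add_mult powr_mult)
qed

text \<open>Removing the initial segment \<open>\<gamma>\<close> is a bijection onto the paths
  starting at its source, and it changes all weights by the same factor.\<close>

lemma infsum_weight:
  assumes \<gamma>: "\<gamma> \<in> paths (q * k)"
  shows "(\<Sum>\<^sub>\<infinity>\<eta>\<in>{\<eta> \<in> fpaths k G. initial_segment \<gamma> \<eta>}. weight k G x \<delta> \<eta> powr s)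
    = growth (q * k) powr (- s / \<delta>) *
      (\<Sum>\<^sub>\<infinity>\<eta>\<in>{\<eta> \<in> fpaths k G. initial_segment (psrc G \<gamma>, []) \<eta>}. weight k G x \<delta> \<eta> powr s)"
    (is "infsum ?f ?A = _ * infsum ?f ?B")
proof -
  let ?h = "\<lambda>\<xi>. (fst \<gamma>, snd \<gamma> @ snd \<xi>)"
  have bij: "bij_betw ?h ?B ?A"
    unfolding bij_betw_def
  proof (intro conjI equalityI subsetI)
    show "inj_on ?h ?B" by (auto simp: inj_on_def initial_segment_def prod_eq_iff)
  next
    fix \<eta> assume "\<eta> \<in> ?h ` ?B"
    then obtain es where "\<eta> = (fst \<gamma>, snd \<gamma> @ es)" "(psrc G \<gamma>, es) \<in> fpaths k G"
      by (auto simp: initial_segment_def)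
    then show "\<eta> \<in> ?A" using append_fpaths(1)[OF \<gamma>, of es] by (simp add: initial_segment_def)
  next
    fix \<eta> assume \<eta>: "\<eta> \<in> ?A"
    then obtain es where es: "\<eta> = (fst \<gamma>, snd \<gamma> @ es)"
      by (auto simp: initial_segment_def prefix_def prod_eq_iff)
    then have "(psrc G \<gamma>, es) \<in> ?B"
      using append_fpaths(1)[OF \<gamma>, of es] \<eta> by (simp add: initial_segment_def)
    then show "\<eta> \<in> ?h ` ?B" using es by force
  qed
  have "infsum ?f ?A = infsum (\<lambda>\<xi>. ?f (?h \<xi>)) ?B"
    using infsum_reindex_bij_betw[OF bij, of ?f] by simp
  also have "\<dots> = infsum (\<lambda>\<xi>. growth (q * k) powr (- s / \<delta>) * ?f \<xi>) ?B"
  proof (rule infsum_cong)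
    fix \<xi> assume \<xi>: "\<xi> \<in> ?B"
    then have "\<xi> = (psrc G \<gamma>, snd \<xi>)" by (simp add: initial_segment_def prod_eq_iff)
    then have "weight k G x \<delta> (?h \<xi>) = growth (q * k) powr (- 1 / \<delta>) * weight k G x \<delta> \<xi>"
      using weight_append[OF \<gamma>, of "snd \<xi>"] by simp
    then show "?f (?h \<xi>) = growth (q * k) powr (- s / \<delta>) * ?f \<xi>"
      using weight_pos[of \<xi>] \<xi> by (simp add: powr_mult powr_powr)
  qed
  \<comment> \<open>Extracting a constant from \<open>infsum\<close> is valid also where the sum
    does not converge and its value is the default 0, so the identity holds for every
    \<open>s\<close>.\<close>
  finally show ?thesis by (simp add: infsum_cmult_right')
qed

lemma measure_bcyl_mult:
  assumes \<gamma>: "\<gamma> \<in> paths (q * k)"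
  shows "measure \<mu> (bcyl k G \<gamma>) = measure \<mu> (bcyl k G (psrc G \<gamma>, [])) / growth (q * k)"
proof -
  let ?r = "\<lambda>\<gamma> s. (\<Sum>\<^sub>\<infinity>\<eta>\<in>{\<eta> \<in> fpaths k G. initial_segment \<gamma> \<eta>}. weight k G x \<delta> \<eta> powr s) /
              (\<Sum>\<^sub>\<infinity>\<eta>\<in>fpaths k G. weight k G x \<delta> \<eta> powr s)"
  have g: "\<gamma> \<in> fpaths k G" using \<gamma> by (simp add: paths_def)
  have v: "(psrc G \<gamma>, []) \<in> fpaths k G" using psrc_verts[OF g] by (simp only: fpaths_Nil)
  have lim: "(?r \<eta> \<longlongrightarrow> measure \<mu> (bcyl k G \<eta>)) (at_right \<delta>)" if "\<eta> \<in> fpaths k G" for \<eta>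
    using dixmier that unfolding dixmier_measure_def by blast
  have "((\<lambda>s. growth (q * k) powr (- s / \<delta>) * ?r (psrc G \<gamma>, []) s)
      \<longlongrightarrow> growth (q * k) powr (- \<delta> / \<delta>) * measure \<mu> (bcyl k G (psrc G \<gamma>, []))) (at_right \<delta>)"
    using growth_pos[of "q * k"] \<delta> by (intro tendsto_intros lim[OF v]) auto
  moreover have "(\<lambda>s. growth (q * k) powr (- s / \<delta>) * ?r (psrc G \<gamma>, []) s) = ?r \<gamma>"
    unfolding infsum_weight[OF \<gamma>] times_divide_eq_right by (rule refl)
  ultimately have "(?r \<gamma> \<longlongrightarrow> growth (q * k) powr (- \<delta> / \<delta>) * measure \<mu> (bcyl k G (psrc G \<gamma>, []))) (at_right \<delta>)"
    by (simp only:)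
  \<comment> \<open>At \<open>s = \<delta>\<close> the exponent becomes \<open>- 1\<close>, and
    \<open>\<delta>\<close> disappears from the result.\<close>
  from tendsto_unique[OF _ lim[OF g] this] \<delta> growth_pos[of "q * k"] show ?thesis
    by (simp add: powr_minus_divide)
qed

lemma measure_bcyl_ext:
  assumes "\<gamma> \<in> fpaths k G"
  shows "measure \<mu> (bcyl k G \<gamma>) = (\<Sum>e\<in>ext \<gamma>. measure \<mu> (bcyl k G (psnoc \<gamma> e)))"
  unfolding bcyl_eq_UN[OF assms]
  by (rule \<mu>.finite_measure_finite_Union[OF finite_ext])
    (use disjoint_bcyl_psnoc assms in \<open>auto simp: disjoint_family_on_def psnoc_fpaths intro!: bcyl_sets\<close>)

lemma sum_measure_paths:
  assumes "v \<in> verts G"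
  shows "(\<Sum>\<gamma>\<in>paths n. if fst \<gamma> = v then measure \<mu> (bcyl k G \<gamma>) else 0) = measure \<mu> (bcyl k G (v, []))"
proof (induction n)
  case 0
  have "(\<Sum>\<gamma>\<in>paths 0. if fst \<gamma> = v then measure \<mu> (bcyl k G \<gamma>) else 0)
      = (\<Sum>w\<in>verts G. if w = v then measure \<mu> (bcyl k G (w, [])) else 0)"
    unfolding paths_0 by (subst sum.reindex) (auto simp: inj_on_def intro!: sum.cong)
  then show ?case using assms finite_verts by simp
next
  case (Suc n)
  have "(\<Sum>\<gamma>\<in>paths (Suc n). if fst \<gamma> = v then measure \<mu> (bcyl k G \<gamma>) else 0)
      = (\<Sum>\<gamma>\<in>paths n. \<Sum>e\<in>ext \<gamma>. if fst \<gamma> = v then measure \<mu> (bcyl k G (psnoc \<gamma> e)) else 0)"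
    unfolding sum_paths_Suc by simp
  also have "\<dots> = (\<Sum>\<gamma>\<in>paths n. if fst \<gamma> = v then measure \<mu> (bcyl k G \<gamma>) else 0)"
    by (intro sum.cong refl) (auto simp: measure_bcyl_ext paths_def)
  finally show ?case using Suc by simp
qed

lemma disjoint_bcyl_vert: "disjoint_family_on (\<lambda>v. bcyl k G (v, [])) (verts G)"
  by (auto simp: disjoint_family_on_def bcyl_Nil)

lemma measure_bcyl_vert:
  assumes "v \<in> verts G" shows "measure \<mu> (bcyl k G (v, [])) = x v"
proof (rule eigenvector_unique[OF _ _ assms])
  fix v assume v: "v \<in> verts G"
  have "measure \<mu> (bcyl k G (v, [])) = (\<Sum>\<gamma>\<in>paths k. if fst \<gamma> = v then measure \<mu> (bcyl k G \<gamma>) else 0)"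
    using sum_measure_paths[OF v] by simp
  \<comment> \<open>One full period, \<open>q = 1\<close>. The eigenvalue \<open>growth k\<close> is
    the product of all \<open>rho G i\<close>, because every entry of \<open>ld k\<close> below
    \<open>k\<close> is 1.\<close>
  also have "\<dots> = (\<Sum>\<gamma>\<in>paths k. (if fst \<gamma> = v then measure \<mu> (bcyl k G (psrc G \<gamma>, [])) else 0) / growth k)"
    using measure_bcyl_mult[where q = 1] by (intro sum.cong refl) auto
  finally show "(\<Sum>\<gamma>\<in>paths k. if fst \<gamma> = v then measure \<mu> (bcyl k G (psrc G \<gamma>, [])) else 0)
      = growth k * measure \<mu> (bcyl k G (v, []))"
    using growth_pos[of k] by (simp flip: sum_divide_distrib add: field_simps)
next
  have "bspace k G = (\<Union>v\<in>verts G. bcyl k G (v, []))" by (simp add: bspace_eq_UN paths_0)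
  then have "measure \<mu> (bspace k G) = (\<Sum>v\<in>verts G. measure \<mu> (bcyl k G (v, [])))"
    using \<mu>.finite_measure_finite_Union[OF finite_verts, of "\<lambda>v. bcyl k G (v, [])"]
      bcyl_sets disjoint_bcyl_vert by (auto simp: image_subset_iff)
  then show "(\<Sum>v\<in>verts G. measure \<mu> (bcyl k G (v, []))) = 1"
    using \<mu>.prob_space space_\<mu> by simp
qed

text \<open>Self-similarity gives the formula at multiples of \<open>k\<close>, and summing over
  extensions with \<open>sum_ext_x\<close> carries it from level \<open>n + 1\<close> to level
  \<open>n\<close>. The induction therefore descends from a multiple of \<open>k\<close> beyond the
  path; \<open>plen \<gamma> * k\<close> is far enough.\<close>

lemma measure_bcyl:
  assumes "\<gamma> \<in> fpaths k G" shows "measure \<mu> (bcyl k G \<gamma>) = x (psrc G \<gamma>) / growth (plen \<gamma>)"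
proof -
  have "\<forall>\<gamma>\<in>paths n. measure \<mu> (bcyl k G \<gamma>) = x (psrc G \<gamma>) / growth n" if "n \<le> q * k" for n q
    using that
  proof (induction n rule: inc_induct)
    case base
    then show ?case using measure_bcyl_mult measure_bcyl_vert psrc_verts by (auto simp: paths_def)
  next
    case (step n)
    show ?case
    proof
      fix \<gamma> assume \<gamma>: "\<gamma> \<in> paths n"
      then have g: "\<gamma> \<in> fpaths k G" "plen \<gamma> = n" by (auto simp: paths_def)
      have "measure \<mu> (bcyl k G \<gamma>) = (\<Sum>e\<in>ext \<gamma>. x (src G e) / growth (Suc n))"
        unfolding measure_bcyl_ext[OF g(1)]
        using step.IH \<gamma> by (intro sum.cong refl) (auto simp: paths_Suc)
      also have "\<dots> = x (psrc G \<gamma>) / growth n"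
        using rho_pos[of "n mod k"] k_pos
        by (simp flip: sum_divide_distrib add: sum_ext_x[OF g(1)] g(2) growth_Suc)
      finally show "measure \<mu> (bcyl k G \<gamma>) = x (psrc G \<gamma>) / growth n" .
    qed
  qed
  moreover have "plen \<gamma> \<le> plen \<gamma> * k" "\<gamma> \<in> paths (plen \<gamma>)" using assms k_pos by (auto simp: paths_def)
  ultimately show ?thesis by blast
qed

lemma measure_bcyl_pos: "\<gamma> \<in> fpaths k G \<Longrightarrow> measure \<mu> (bcyl k G \<gamma>) > 0"
  using growth_pos x_pos[OF psrc_verts] by (simp add: measure_bcyl)

end

section \<open>The Laplace--Beltrami form\<close>

text \<open>The bound holds at every point of the type and not just almost everywhere, so the class
  survives composition with measurable maps and passage to other measures.\<close>

definition bounded_measurable :: "'x measure \<Rightarrow> ('x \<Rightarrow> complex) set" where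
  "bounded_measurable M = {f \<in> borel_measurable M. \<exists>C. \<forall>y. cmod (f y) \<le> C}"

lemma bounded_measurable_add:
  assumes "f \<in> bounded_measurable M" "g \<in> bounded_measurable M"
  shows "(\<lambda>y. f y + g y) \<in> bounded_measurable M"
proof -
  obtain C where "f \<in> borel_measurable M" "\<And>y. cmod (f y) \<le> C"
    using assms(1) by (auto simp: bounded_measurable_def)
  moreover obtain D where "g \<in> borel_measurable M" "\<And>y. cmod (g y) \<le> D"
    using assms(2) by (auto simp: bounded_measurable_def)
  ultimately show ?thesis
    by (auto simp: bounded_measurable_def intro!: exI[of _ "C + D"] order_trans[OF norm_triangle_ineq] add_mono)
qed

lemma bounded_measurable_mult:
  assumes "f \<in> bounded_measurable M" "g \<in> bounded_measurable M"
  shows "(\<lambda>y. f y * g y) \<in> bounded_measurable M"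
proof -
  obtain C where C: "f \<in> borel_measurable M" "\<And>y. cmod (f y) \<le> C"
    using assms(1) by (auto simp: bounded_measurable_def)
  obtain D where D: "g \<in> borel_measurable M" "\<And>y. cmod (g y) \<le> D"
    using assms(2) by (auto simp: bounded_measurable_def)
  have "cmod (f y * g y) \<le> C * D" for y
    unfolding norm_mult using C(2)[of y] D(2)[of y] order_trans[OF norm_ge_zero C(2)[of y]]
    by (intro mult_mono) auto
  then show ?thesis using C(1) D(1) by (auto simp: bounded_measurable_def)
qed

lemma bounded_measurable_const: "(\<lambda>y. c) \<in> bounded_measurable M"
  by (auto simp: bounded_measurable_def)

lemma bounded_measurable_scale: "f \<in> bounded_measurable M \<Longrightarrow> (\<lambda>y. c * f y) \<in> bounded_measurable M"
  by (intro bounded_measurable_mult bounded_measurable_const)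

lemma bounded_measurable_diff:
  "f \<in> bounded_measurable M \<Longrightarrow> g \<in> bounded_measurable M \<Longrightarrow> (\<lambda>y. f y - g y) \<in> bounded_measurable M"
  using bounded_measurable_add[of f M "\<lambda>y. -1 * g y"] bounded_measurable_scale[of g M "-1"] by simp

lemma bounded_measurable_cnj: "f \<in> bounded_measurable M \<Longrightarrow> (\<lambda>y. cnj (f y)) \<in> bounded_measurable M"
  by (auto simp: bounded_measurable_def)

lemma bounded_measurable_indicator: "A \<in> sets M \<Longrightarrow> indicator A \<in> bounded_measurable M"
  by (auto simp: bounded_measurable_def indicator_def intro!: exI[of _ 1])

lemma bounded_measurable_comp:
  "T \<in> measurable N M \<Longrightarrow> f \<in> bounded_measurable M \<Longrightarrow> (\<lambda>y. f (T y)) \<in> bounded_measurable N"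
  by (auto simp: bounded_measurable_def)

lemma bounded_measurable_sum:
  "(\<And>i. i \<in> I \<Longrightarrow> f i \<in> bounded_measurable M) \<Longrightarrow> (\<lambda>y. \<Sum>i\<in>I. f i y) \<in> bounded_measurable M"
  by (induction I rule: infinite_finite_induct) (auto intro: bounded_measurable_add bounded_measurable_const)

lemmas bounded_measurable_intros = bounded_measurable_add bounded_measurable_mult bounded_measurable_const
  bounded_measurable_diff bounded_measurable_cnj bounded_measurable_indicator bounded_measurable_sum

lemma (in finite_measure) bounded_measurable_integrable:
  assumes "f \<in> bounded_measurable M" shows "integrable M f"
  using assms by (auto simp: bounded_measurable_def intro: integrable_const_bound)

lemma (in finite_measure) bounded_measurable_L2:
  assumes "f \<in> bounded_measurable M" shows "f \<in> L2 M"
  using assms by (auto simp: bounded_measurable_def intro: bounded_in_L2)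

section \<open>Integrals over squares of sets, and traces of the blocks\<close>

context prob_space begin

lemma pair_prob: "pair_prob_space M M"
  by unfold_locales

lemma integral_pair_mult:
  assumes a: "a \<in> bounded_measurable M" and b: "b \<in> bounded_measurable M"
  shows "(LINT p|(M \<Otimes>\<^sub>M M). a (fst p) * b (snd p)) = (LINT y|M. a y) * (LINT y|M. b y)"
proof -
  interpret P: pair_prob_space M M by (rule pair_prob)
  have "(\<lambda>p. a (fst p) * b (snd p)) \<in> bounded_measurable (M \<Otimes>\<^sub>M M)"
    by (intro bounded_measurable_mult bounded_measurable_comp[OF _ a] bounded_measurable_comp[OF _ b]) measurable
  then have "integrable (M \<Otimes>\<^sub>M M) (\<lambda>p. a (fst p) * b (snd p))"
    by (rule P.bounded_measurable_integrable)
  from P.integral_fst'[OF this] have "(LINT p|(M \<Otimes>\<^sub>M M). a (fst p) * b (snd p)) = (LINT y|M. LINT z|M. a y * b z)"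
    by simp
  then show ?thesis by simp
qed

text \<open>Expand the product and apply Fubini to the four terms. The right side is twice an
  unnormalised covariance on \<open>B\<close>, so only its first term remains once one of the
  functions has integral zero over \<open>B\<close>.\<close>

lemma integral_pair_diff:
  assumes f: "f \<in> bounded_measurable M" and g: "g \<in> bounded_measurable M" and B: "B \<in> sets M"
  shows "(LINT p|(M \<Otimes>\<^sub>M M). indicator (B \<times> B) p * (cnj (f (fst p) - f (snd p)) * (g (fst p) - g (snd p))))
    = 2 * (complex_of_real (measure M B) * (LINT y|M. indicator B y * (cnj (f y) * g y))
        - (LINT y|M. indicator B y * cnj (f y)) * (LINT y|M. indicator B y * g y))"
proof -
  interpret P: pair_prob_space M M by (rule pair_prob)
  let ?i = "\<lambda>y. indicator B y :: complex"
  let ?fg = "\<lambda>y. ?i y * (cnj (f y) * g y)" and ?f = "\<lambda>y. ?i y * cnj (f y)" and ?g = "\<lambda>y. ?i y * g y"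
  have i: "?i \<in> bounded_measurable M" by (rule bounded_measurable_indicator[OF B])
  have bm: "?fg \<in> bounded_measurable M" "?f \<in> bounded_measurable M" "?g \<in> bounded_measurable M"
    by (intro bounded_measurable_intros f g B)+
  have int: "integrable (M \<Otimes>\<^sub>M M) (\<lambda>p. a (fst p) * b (snd p))"
    if "a \<in> bounded_measurable M" "b \<in> bounded_measurable M" for a b :: "_ \<Rightarrow> complex"
    by (intro P.bounded_measurable_integrable bounded_measurable_mult
        bounded_measurable_comp[OF _ that(1)] bounded_measurable_comp[OF _ that(2)]) measurable
  have "(LINT y|M. ?i y) = (LINT y|M. complex_of_real (indicator B y))"
    by (intro Bochner_Integration.integral_cong) (auto simp: indicator_def)
  also have "\<dots> = complex_of_real (measure M B)"
    using B by (subst integral_complex_of_real) auto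
  finally have m: "(LINT y|M. ?i y) = complex_of_real (measure M B)" .
  have "indicator (B \<times> B) p * (cnj (f (fst p) - f (snd p)) * (g (fst p) - g (snd p)))
      = (?fg (fst p) * ?i (snd p) + ?i (fst p) * ?fg (snd p))
        - (?f (fst p) * ?g (snd p) + ?g (fst p) * ?f (snd p))" for p
    by (cases p) (auto simp: indicator_def algebra_simps)
  then have "(LINT p|(M \<Otimes>\<^sub>M M). indicator (B \<times> B) p * (cnj (f (fst p) - f (snd p)) * (g (fst p) - g (snd p))))
    = (LINT p|(M \<Otimes>\<^sub>M M). (?fg (fst p) * ?i (snd p) + ?i (fst p) * ?fg (snd p))
        - (?f (fst p) * ?g (snd p) + ?g (fst p) * ?f (snd p)))"
    by (simp only:)
  also have "\<dots> = ((LINT p|(M \<Otimes>\<^sub>M M). ?fg (fst p) * ?i (snd p)) + (LINT p|(M \<Otimes>\<^sub>M M). ?i (fst p) * ?fg (snd p)))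
      - ((LINT p|(M \<Otimes>\<^sub>M M). ?f (fst p) * ?g (snd p)) + (LINT p|(M \<Otimes>\<^sub>M M). ?g (fst p) * ?f (snd p)))"
    using int[OF bm(1) i] int[OF i bm(1)] int[OF bm(2,3)] int[OF bm(3,2)]
    by (simp only: Bochner_Integration.integral_diff Bochner_Integration.integral_add Bochner_Integration.integrable_add)
  also have "\<dots> = 2 * (complex_of_real (measure M B) * (LINT y|M. ?fg y) - (LINT y|M. ?f y) * (LINT y|M. ?g y))"
    unfolding integral_pair_mult[OF bm(1) i] integral_pair_mult[OF i bm(1)]
      integral_pair_mult[OF bm(2,3)] integral_pair_mult[OF bm(3,2)] m
    by (simp add: algebra_simps)
  finally show ?thesis .
qed

end

text \<open>Made for the marginals of \<open>choice_measure\<close>: it leads from the uniform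
  measure on a restricted space back to the product measure, where Fubini is available.\<close>

lemma integral_uniform_restrict:
  fixes F :: "'x \<Rightarrow> complex"
  assumes "finite_measure M" and D: "D \<in> sets M" "measure M D > 0" and F: "F \<in> borel_measurable M"
  shows "(LINT p|uniform_measure (restrict_space M D) D. F p) = (LINT p|M. indicator D p * F p) / complex_of_real (measure M D)"
    "prob_space (uniform_measure (restrict_space M D) D)"
proof -
  interpret finite_measure M by fact
  let ?R = "restrict_space M D"
  have DM: "D \<inter> space M \<in> sets M" using D by (simp add: Int_absorb2 sets.sets_into_space)
  have DR: "D \<in> sets ?R" using D sets.sets_into_space[OF D(1)] by (auto simp: sets_restrict_space intro!: image_eqI[of _ _ D])
  have eD: "emeasure ?R D = ennreal (measure M D)"
    using emeasure_restrict_space[OF DM, of D] emeasure_eq_measure by simp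
  show "prob_space (uniform_measure ?R D)"
    using eD D(2) by (intro prob_space_uniform_measure) auto
  have "uniform_measure ?R D = density ?R (\<lambda>p. ennreal (indicator D p / measure M D))"
    unfolding uniform_measure_def eD
    by (intro density_cong) (use D(2) DR in \<open>auto simp: divide_ennreal indicator_def simp flip: ennreal_1 intro!: measurable_If\<close>)
  then have "(LINT p|uniform_measure ?R D. F p) = (LINT p|?R. (indicator D p / measure M D) *\<^sub>R F p)"
    using D(2) DR F by (simp add: integral_density measurable_restrict_space1)
  also have "\<dots> = (LINT p|M. indicator D p *\<^sub>R ((indicator D p / measure M D) *\<^sub>R F p))"
    by (rule integral_restrict_space[OF DM])
  also have "\<dots> = (LINT p|M. (indicator D p * F p) / complex_of_real (measure M D))"
    by (intro Bochner_Integration.integral_cong) (auto simp: indicator_def scaleR_conv_of_real)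
  finally show "(LINT p|uniform_measure ?R D. F p) = (LINT p|M. indicator D p * F p) / complex_of_real (measure M D)"
    by simp
qed

text \<open>The commutator has only the off-diagonal entries \<open>r * (a' - a)\<close> and
  \<open>r * (a - a')\<close>, and both contribute the same product to the trace, hence the factor
  2.\<close>

lemma trace_commutator:
  fixes r :: real and c a a' b b' :: complex
  defines "D \<equiv> mat (complex_of_real r) ** vector [vector [0, 1], vector [1, 0]] :: complex^2^2"
    and "P \<equiv> vector [vector [a, 0], vector [0, a']] :: complex^2^2"
    and "Q \<equiv> vector [vector [b, 0], vector [0, b']] :: complex^2^2"
  shows "trace (mat c ** adjoint_mat (D ** P - P ** D) ** (D ** Q - Q ** D))
    = 2 * c * complex_of_real (r\<^sup>2) * (cnj (a - a') * (b - b'))"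
  unfolding D_def P_def Q_def
  by (simp add: trace_def matrix_matrix_mult_def sum_2 adjoint_mat_def mat_def power2_eq_square)
    (simp add: algebra_simps)

lemma trace_blocks:
  "trace (abs_dirac_block k G x \<delta> s \<gamma> ** adjoint_mat (commutator_block k G x \<delta> \<tau> f \<gamma>) **
      commutator_block k G x \<delta> \<tau> g \<gamma>)
    = 2 * complex_of_real (wdiam k G x \<delta> \<gamma> powr s) * complex_of_real ((1 / wdiam k G x \<delta> \<gamma>)\<^sup>2) *
      (cnj (f (fst (\<tau> \<gamma>)) - f (snd (\<tau> \<gamma>))) * (g (fst (\<tau> \<gamma>)) - g (snd (\<tau> \<gamma>))))"
  unfolding abs_dirac_block_def commutator_block_def dirac_block_def rep_block_def
  by (rule trace_commutator)

section \<open>Weights and diameters along a path\<close>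

definition prefix_path :: "'a kgraph \<Rightarrow> (nat \<Rightarrow> 'a) \<Rightarrow> nat \<Rightarrow> 'a \<times> 'a list" where
  "prefix_path G y n = (rng G (y 0), map y [0..<n])"

lemma prefix_path_Suc: "prefix_path G y (Suc n) = psnoc (prefix_path G y n) (y n)"
  by (simp add: prefix_path_def psnoc_def)

lemma plen_prefix_path [simp]: "plen (prefix_path G y n) = n"
  by (simp add: prefix_path_def)

lemma prefix_path_eq: "y \<in> bcyl k G \<gamma> \<Longrightarrow> prefix_path G y (plen \<gamma>) = \<gamma>"
  by (auto simp: bcyl_def prefix_path_def prod_eq_iff intro: nth_equalityI)

lemma bcyl_prefix_path: "y \<in> bspace k G \<Longrightarrow> y \<in> bcyl k G (prefix_path G y n)"
  by (simp add: bcyl_def prefix_path_def)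

lemma wdist_eq:
  assumes "y \<noteq> z" "rng G (y 0) = rng G (z 0)"
  shows "wdist k G x \<delta> y z = weight k G x \<delta> (prefix_path G y (LEAST j. y j \<noteq> z j))"
  using assms by (simp add: wdist_def common_segment_def prefix_path_def)

context dixmier_k_graph begin

lemma prefix_path_fpaths: "y \<in> bspace k G \<Longrightarrow> prefix_path G y n \<in> fpaths k G"
proof (induction n)
  case 0
  have "(rng G (y 0), []) \<in> fpaths k G" using bspace_rng[OF 0] by (simp only: fpaths_Nil)
  then show ?case by (simp add: prefix_path_def)
next
  case (Suc n)
  have "y n \<in> ext (prefix_path G y n)"
    using bcyl_psrc[OF Suc.IH[OF Suc.prems] bcyl_prefix_path[OF Suc.prems]] by simp
  then show ?case using Suc psnoc_fpaths[of "prefix_path G y n" "y n"] by (simp add: prefix_path_Suc)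
qed

text \<open>Let \<open>r\<close> be the eigenvalue at this level and \<open>v\<close> the source of
  \<open>\<gamma>\<close>. The extension multiplies the weight by
  \<open>r powr (- 1 / \<delta>) * x (src G e) / x v\<close>. The eigenvalue equation bounds
  \<open>x (src G e)\<close> by \<open>r * x v\<close>, strictly if another extension adds its
  positive term, and \<open>r powr (1 - 1 / \<delta>) \<le> 1\<close> because
  \<open>r \<ge> 1\<close> and \<open>\<delta> < 1\<close>.\<close>

lemma weight_psnoc:
  assumes \<gamma>: "\<gamma> \<in> fpaths k G" and e: "e \<in> ext \<gamma>"
  shows "weight k G x \<delta> (psnoc \<gamma> e) \<le> weight k G x \<delta> \<gamma>"
    and "e' \<in> ext \<gamma> \<Longrightarrow> e' \<noteq> e \<Longrightarrow> weight k G x \<delta> (psnoc \<gamma> e) < weight k G x \<delta> \<gamma>"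
proof -
  let ?r = "rho G (plen \<gamma> mod k)" and ?v = "psrc G \<gamma>"
  have r: "?r \<ge> 1" using rho_ge_1 k_pos by simp
  have xe: "x (src G e) > 0" if "e \<in> ext \<gamma>" for e
    using that by (intro x_pos src_verts edges_mor) (auto simp: ext_def)
  have sum: "(\<Sum>e\<in>ext \<gamma>. x (src G e)) = ?r * x ?v" by (rule sum_ext_x[OF \<gamma>])
  have eq: "?r powr (- 1 / \<delta>) * (?r * x ?v) = ?r powr (1 - 1 / \<delta>) * x ?v"
    using r powr_add[of ?r "- 1 / \<delta>" 1] by simp
  have "?r powr (1 - 1 / \<delta>) \<le> ?r powr 0" using r \<delta> by (intro powr_mono) (auto simp: field_simps)
  then have p: "?r powr (1 - 1 / \<delta>) \<le> 1" using r by simp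
  have xv: "x ?v > 0" using x_pos[OF psrc_verts[OF \<gamma>]] .
  then have le: "?r powr (1 - 1 / \<delta>) * x ?v \<le> x ?v" using p by simp
  have w: "weight k G x \<delta> (psnoc \<gamma> e) = growth (plen \<gamma>) powr (- 1 / \<delta>) * (?r powr (- 1 / \<delta>) * x (src G e))"
    using growth_pos[of "plen \<gamma>"] r by (simp add: weight_eq growth_Suc powr_mult)
  have g: "growth (plen \<gamma>) powr (- 1 / \<delta>) > 0" using growth_pos[of "plen \<gamma>"] by simp
  have "x (src G e) \<le> ?r * x ?v"
    unfolding sum[symmetric] using e finite_ext xe by (intro member_le_sum) (auto intro: less_imp_le)
  then have "?r powr (- 1 / \<delta>) * x (src G e) \<le> ?r powr (- 1 / \<delta>) * (?r * x ?v)"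
    by (intro mult_left_mono) auto
  then have "?r powr (- 1 / \<delta>) * x (src G e) \<le> x ?v" using eq le by linarith
  then show "weight k G x \<delta> (psnoc \<gamma> e) \<le> weight k G x \<delta> \<gamma>"
    using g unfolding w unfolding weight_eq by (intro mult_left_mono) auto
  assume e': "e' \<in> ext \<gamma>" "e' \<noteq> e"
  have "x (src G e) < x (src G e) + x (src G e')" using xe[OF e'(1)] by simp
  also have "\<dots> = (\<Sum>e\<in>{e, e'}. x (src G e))" using e' by simp
  also have "\<dots> \<le> ?r * x ?v"
    unfolding sum[symmetric] using e e' finite_ext xe by (intro sum_mono2) (auto intro: less_imp_le)
  finally have "?r powr (- 1 / \<delta>) * x (src G e) < ?r powr (- 1 / \<delta>) * (?r * x ?v)"
    using r by (intro mult_strict_left_mono) auto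
  then have "?r powr (- 1 / \<delta>) * x (src G e) < x ?v" using eq le by linarith
  then show "weight k G x \<delta> (psnoc \<gamma> e) < weight k G x \<delta> \<gamma>"
    using g unfolding w unfolding weight_eq by (intro mult_strict_left_mono) auto
qed

lemma weight_prefix_antimono:
  assumes y: "y \<in> bspace k G" and "m \<le> n"
  shows "weight k G x \<delta> (prefix_path G y n) \<le> weight k G x \<delta> (prefix_path G y m)"
  using assms(2)
proof (induction n rule: dec_induct)
  case (step n)
  have "y n \<in> ext (prefix_path G y n)"
    using bcyl_psrc[OF prefix_path_fpaths[OF y] bcyl_prefix_path[OF y]] by simp
  then show ?case
    using weight_psnoc(1)[OF prefix_path_fpaths[OF y]] step.IH by (fastforce simp: prefix_path_Suc)
qed simp

end

locale laplace_k_graph = dixmier_k_graph k G x \<delta> \<mu> for k and G :: "'a kgraph" and x \<delta> \<mu> +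
  assumes weight_diam: "\<gamma> \<in> fpaths k G \<Longrightarrow> weight k G x \<delta> \<gamma> = wdiam k G x \<delta> \<gamma>"
begin

lemma bcyl_nonempty: "\<gamma> \<in> fpaths k G \<Longrightarrow> bcyl k G \<gamma> \<noteq> {}"
  using measure_bcyl_pos[of \<gamma>] by auto

text \<open>Following a path until it branches does not change its cylinder set. Two infinite paths
  realise the diameter exactly if they separate at the first branching.\<close>

lemma diam_pairs_branching:
  assumes \<eta>: "\<eta> \<in> fpaths k G"
  obtains \<gamma> e e' where "\<gamma> \<in> fpaths k G" "bcyl k G \<gamma> = bcyl k G \<eta>" "e \<in> ext \<gamma>" "e' \<in> ext \<gamma>" "e \<noteq> e'"
    "diam_pairs k G x \<delta> \<eta> = {(y, z) \<in> bcyl k G \<gamma> \<times> bcyl k G \<gamma>. y (plen \<gamma>) \<noteq> z (plen \<gamma>)}"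
proof -
  let ?B = "bcyl k G \<eta>"
  \<comment> \<open>A one-point cylinder set would have diameter 0, but the diameter is the weight,
    which is positive.\<close>
  have "\<exists>n. \<exists>y\<in>?B. \<exists>z\<in>?B. y n \<noteq> z n"
  proof (rule ccontr)
    assume "\<not> ?thesis"
    then have "y = z" if "y \<in> ?B" "z \<in> ?B" for y z using that by (intro ext) auto
    moreover obtain y where "y \<in> ?B" using bcyl_nonempty[OF \<eta>] by blast
    ultimately have "?B = {y}" by blast
    then have "{wdist k G x \<delta> y z | y z. y \<in> ?B \<and> z \<in> ?B} = {0}"
      by (simp add: wdist_def)
    then have "wdiam k G x \<delta> \<eta> = 0" by (simp add: wdiam_def)
    then show False using weight_diam[OF \<eta>] weight_pos[OF \<eta>] by simp
  qed
  moreover define n where "n = (LEAST n. \<exists>y\<in>?B. \<exists>z\<in>?B. y n \<noteq> z n)"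
  ultimately have "\<exists>y\<in>?B. \<exists>z\<in>?B. y n \<noteq> z n"
    using LeastI_ex[of "\<lambda>n. \<exists>y\<in>?B. \<exists>z\<in>?B. y n \<noteq> z n"] by simp
  then obtain y z where yz: "y \<in> ?B" "z \<in> ?B" "y n \<noteq> z n" by blast
  have agree: "w i = w' i" if "i < n" "w \<in> ?B" "w' \<in> ?B" for i w w'
    using not_less_Least[OF that(1)[unfolded n_def]] that by blast
  have yb: "y \<in> bspace k G" using yz(1) by (auto simp: bcyl_def)
  define \<gamma> where "\<gamma> = prefix_path G y n"
  have g: "\<gamma> \<in> fpaths k G" "plen \<gamma> = n" using prefix_path_fpaths[OF yb] by (auto simp: \<gamma>_def)
  have yg: "y \<in> bcyl k G \<gamma>" unfolding \<gamma>_def by (rule bcyl_prefix_path[OF yb])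
  have "plen \<eta> \<le> n"
  proof (rule ccontr)
    assume "\<not> plen \<eta> \<le> n"
    then have "y n = z n" using yz by (simp add: bcyl_def)
    then show False using yz by simp
  qed
  then have "bcyl k G \<gamma> \<subseteq> ?B" using bcyl_nested[of \<eta> \<gamma> y k G] yz yg g by simp
  moreover have "?B \<subseteq> bcyl k G \<gamma>"
  proof
    fix w assume w: "w \<in> ?B"
    have "rng G (w 0) = rng G (y 0)" using w yz(1) by (simp add: bcyl_def)
    then show "w \<in> bcyl k G \<gamma>"
      using agree[OF _ w yz(1)] w by (auto simp: bcyl_def \<gamma>_def prefix_path_def)
  qed
  ultimately have B: "bcyl k G \<gamma> = ?B" by auto
  \<comment> \<open>The diameter depends on the cylinder set alone, so it is also the weight of the
    branching path \<open>\<gamma>\<close>, which may be longer than \<open>\<eta>\<close>.\<close>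
  then have W: "wdiam k G x \<delta> \<eta> = weight k G x \<delta> \<gamma>" using weight_diam[OF g(1)] by (simp add: wdiam_def)
  have ext: "w n \<in> ext \<gamma>" if "w \<in> ?B" for w using bcyl_psrc[OF g(1), of w] that B g(2) by simp
  have "wdist k G x \<delta> a b = weight k G x \<delta> \<gamma> \<longleftrightarrow> a n \<noteq> b n" if ab: "a \<in> ?B" "b \<in> ?B" for a b
  proof (cases "a = b")
    case True
    then show ?thesis using weight_pos[OF g(1)] by (simp add: wdist_def)
  next
    case False
    have ab': "a \<in> bspace k G" "rng G (a 0) = rng G (b 0)" using ab by (auto simp: bcyl_def)
    have ga: "prefix_path G a n = \<gamma>" using prefix_path_eq[of a k G \<gamma>] ab(1) B g(2) by simp
    define j where "j = (LEAST j. a j \<noteq> b j)"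
    have wd: "wdist k G x \<delta> a b = weight k G x \<delta> (prefix_path G a j)"
      unfolding j_def by (rule wdist_eq[OF False ab'(2)])
    have "\<exists>j. a j \<noteq> b j" using False by auto
    then have j: "a j \<noteq> b j" unfolding j_def by (rule LeastI_ex)
    then have "n \<le> j" using agree[OF _ ab] by (meson not_le)
    show ?thesis
    proof (cases "a n = b n")
      case True
      \<comment> \<open>A pair that still agrees at the branching separates below one of several
        extensions, where the weight has already dropped strictly.\<close>
      then have "Suc n \<le> j" using j \<open>n \<le> j\<close> by (metis Suc_leI le_neq_implies_less)
      then have "wdist k G x \<delta> a b \<le> weight k G x \<delta> (prefix_path G a (Suc n))"
        unfolding wd by (rule weight_prefix_antimono[OF ab'(1)])
      also have "\<dots> = weight k G x \<delta> (psnoc \<gamma> (a n))" by (simp add: prefix_path_Suc ga)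
      also have "\<dots> < weight k G x \<delta> \<gamma>"
      proof -
        obtain e where "e \<in> ext \<gamma>" "e \<noteq> a n" using ext[OF yz(1)] ext[OF yz(2)] yz(3) by metis
        then show ?thesis using weight_psnoc(2)[OF g(1) ext[OF ab(1)]] by blast
      qed
      finally show ?thesis using True by simp
    next
      case False
      then have "j \<le> n" unfolding j_def by (rule Least_le)
      then show ?thesis using \<open>n \<le> j\<close> False ga wd by simp
    qed
  qed
  then have "diam_pairs k G x \<delta> \<eta> = {(y, z) \<in> bcyl k G \<gamma> \<times> bcyl k G \<gamma>. y (plen \<gamma>) \<noteq> z (plen \<gamma>)}"
    unfolding diam_pairs_def W B g(2) by blast
  then show ?thesis using that[OF g(1) B ext[OF yz(1)] ext[OF yz(2)] yz(3)] by blast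
qed

text \<open>The pairs form the square of a cylinder set minus the disjoint squares of its parts,
  which reduces everything to integrals over squares. Two different extensions span a rectangle of
  positive measure among the pairs.\<close>

lemma integral_diam_pairs:
  assumes \<eta>: "\<eta> \<in> fpaths k G"
  obtains \<gamma> where "\<gamma> \<in> fpaths k G"
    "diam_pairs k G x \<delta> \<eta> \<in> sets (\<mu> \<Otimes>\<^sub>M \<mu>)" "measure (\<mu> \<Otimes>\<^sub>M \<mu>) (diam_pairs k G x \<delta> \<eta>) > 0"
    "\<And>F :: _ \<Rightarrow> complex. F \<in> bounded_measurable (\<mu> \<Otimes>\<^sub>M \<mu>) \<Longrightarrow>
      (LINT p|(\<mu> \<Otimes>\<^sub>M \<mu>). indicator (diam_pairs k G x \<delta> \<eta>) p * F p)
      = (LINT p|(\<mu> \<Otimes>\<^sub>M \<mu>). indicator (bcyl k G \<gamma> \<times> bcyl k G \<gamma>) p * F p)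
        - (\<Sum>e\<in>ext \<gamma>. LINT p|(\<mu> \<Otimes>\<^sub>M \<mu>). indicator (bcyl k G (psnoc \<gamma> e) \<times> bcyl k G (psnoc \<gamma> e)) p * F p)"
proof -
  interpret P: pair_prob_space \<mu> \<mu> by (rule \<mu>.pair_prob)
  obtain \<gamma> e e' where g: "\<gamma> \<in> fpaths k G" "bcyl k G \<gamma> = bcyl k G \<eta>" "e \<in> ext \<gamma>" "e' \<in> ext \<gamma>" "e \<noteq> e'"
    "diam_pairs k G x \<delta> \<eta> = {(y, z) \<in> bcyl k G \<gamma> \<times> bcyl k G \<gamma>. y (plen \<gamma>) \<noteq> z (plen \<gamma>)}"
    using diam_pairs_branching[OF \<eta>] .
  let ?D = "diam_pairs k G x \<delta> \<eta>" and ?B = "bcyl k G \<gamma>" and ?C = "\<lambda>e. bcyl k G (psnoc \<gamma> e)"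
  have C: "?C e \<in> sets \<mu>" if "e \<in> ext \<gamma>" for e using that g(1) by (intro bcyl_sets) (simp add: psnoc_fpaths)
  have B: "?B \<in> sets \<mu>" by (rule bcyl_sets[OF g(1)])
  have U: "?B \<times> ?B - (\<Union>e\<in>ext \<gamma>. ?C e \<times> ?C e) = ?D"
    using bcyl_psrc[OF g(1)] unfolding g(6) by (auto simp: bcyl_psnoc)
  have D: "?D \<in> sets (\<mu> \<Otimes>\<^sub>M \<mu>)"
    unfolding U[symmetric] by (intro sets.Diff sets.finite_UN finite_ext pair_measureI B C)
  have "?C e \<times> ?C e' \<subseteq> ?D" unfolding g(6) using g(5) by (auto simp: bcyl_psnoc)
  then have "measure (\<mu> \<Otimes>\<^sub>M \<mu>) (?C e \<times> ?C e') \<le> measure (\<mu> \<Otimes>\<^sub>M \<mu>) ?D"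
    using D by (rule P.finite_measure_mono)
  moreover have "measure (\<mu> \<Otimes>\<^sub>M \<mu>) (?C e \<times> ?C e') = measure \<mu> (?C e) * measure \<mu> (?C e')"
    using C g by (simp add: measure_def \<mu>.emeasure_pair_measure_Times enn2real_mult)
  moreover have "measure \<mu> (?C e) * measure \<mu> (?C e') > 0"
    using g by (intro mult_pos_pos measure_bcyl_pos) (simp_all add: psnoc_fpaths)
  ultimately have m: "measure (\<mu> \<Otimes>\<^sub>M \<mu>) ?D > 0" by linarith
  have ind: "indicator ?D p = indicator (?B \<times> ?B) p - (\<Sum>e\<in>ext \<gamma>. indicator (?C e \<times> ?C e) p :: complex)" for p
  proof -
    have "indicator (\<Union>e\<in>ext \<gamma>. ?C e \<times> ?C e) p = (\<Sum>e\<in>ext \<gamma>. indicator (?C e \<times> ?C e) p :: complex)"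
      by (rule indicator_UN_sum[OF finite_ext]) (auto simp: disjoint_family_on_def bcyl_psnoc)
    moreover have "(\<Union>e\<in>ext \<gamma>. ?C e \<times> ?C e) \<subseteq> ?B \<times> ?B" by (auto simp: bcyl_psnoc)
    moreover have "indicator (A - A') p = (indicator A p - indicator A' p :: complex)" if "A' \<subseteq> A" for A A'
      using that by (auto simp: indicator_def)
    ultimately show ?thesis unfolding U[symmetric] by simp
  qed
  have "(LINT p|(\<mu> \<Otimes>\<^sub>M \<mu>). indicator ?D p * F p) = (LINT p|(\<mu> \<Otimes>\<^sub>M \<mu>). indicator (?B \<times> ?B) p * F p)
        - (\<Sum>e\<in>ext \<gamma>. LINT p|(\<mu> \<Otimes>\<^sub>M \<mu>). indicator (?C e \<times> ?C e) p * F p)"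
    if F: "F \<in> bounded_measurable (\<mu> \<Otimes>\<^sub>M \<mu>)" for F :: "_ \<Rightarrow> complex"
  proof -
    have int: "integrable (\<mu> \<Otimes>\<^sub>M \<mu>) (\<lambda>p. indicator (A \<times> A) p * F p)" if "A \<in> sets \<mu>" for A
      using that by (intro P.bounded_measurable_integrable bounded_measurable_intros F) auto
    show ?thesis
      unfolding ind left_diff_distrib sum_distrib_right using int[OF B] int[OF C]
      by (simp add: Bochner_Integration.integral_diff Bochner_Integration.integral_sum)
  qed
  then show ?thesis using that[OF g(1) D m] by blast
qed

text \<open>\<open>S\<close> is meant to collect the paths whose cylinder sets contain the support
  of \<open>g\<close>. It is fixed beforehand so that the conditions are linear in
  \<open>g\<close>.\<close>

definition LB_good :: "('a \<times> 'a list) set \<Rightarrow> ((nat \<Rightarrow> 'a) \<Rightarrow> complex) set" where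
  "LB_good S = {g \<in> bounded_measurable \<mu>.
     (\<forall>\<eta>\<in>fpaths k G - S. \<exists>c. \<forall>y\<in>bcyl k G \<eta>. g y = c) \<and>
     (\<forall>\<eta>\<in>S. (\<forall>y. y \<notin> bcyl k G \<eta> \<longrightarrow> g y = 0) \<and> (LINT y|\<mu>. g y) = 0)}"

lemma LB_good_subspace: "cfun.subspace (LB_good S)"
proof -
  have "(\<lambda>y. g y + h y) \<in> LB_good S" if "g \<in> LB_good S" "h \<in> LB_good S" for g h
  proof -
    have b: "g \<in> bounded_measurable \<mu>" "h \<in> bounded_measurable \<mu>" using that by (auto simp: LB_good_def)
    have "\<exists>c. \<forall>y\<in>bcyl k G \<eta>. g y + h y = c" if "\<eta> \<in> fpaths k G - S" for \<eta>
    proof -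
      obtain c d where "\<forall>y\<in>bcyl k G \<eta>. g y = c" "\<forall>y\<in>bcyl k G \<eta>. h y = d"
        using \<open>g \<in> LB_good S\<close> \<open>h \<in> LB_good S\<close> \<open>\<eta> \<in> fpaths k G - S\<close> unfolding LB_good_def by blast
      then show ?thesis by auto
    qed
    then show ?thesis using that b bounded_measurable_add[OF b]
      by (auto simp: LB_good_def \<mu>.bounded_measurable_integrable)
  qed
  moreover have "(\<lambda>y. c * g y) \<in> LB_good S" if "g \<in> LB_good S" for g c
  proof -
    have "\<exists>d. \<forall>y\<in>bcyl k G \<eta>. c * g y = d" if \<eta>: "\<eta> \<in> fpaths k G - S" for \<eta>
    proof -
      obtain d where "\<forall>y\<in>bcyl k G \<eta>. g y = d"
        using \<open>g \<in> LB_good S\<close> \<eta> unfolding LB_good_def by blast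
      then show ?thesis by (intro exI[of _ "c * d"]) simp
    qed
    moreover have "(\<lambda>y. c * g y) \<in> bounded_measurable \<mu>"
      using that by (intro bounded_measurable_scale) (simp add: LB_good_def)
    moreover have "(\<forall>y. y \<notin> bcyl k G \<eta> \<longrightarrow> c * g y = 0) \<and> (LINT y|\<mu>. c * g y) = 0" if \<eta>: "\<eta> \<in> S" for \<eta>
      using \<open>g \<in> LB_good S\<close> \<eta> by (simp add: LB_good_def)
    ultimately show ?thesis by (simp add: LB_good_def)
  qed
  moreover have "(\<lambda>y. 0) \<in> LB_good S" by (auto simp: LB_good_def bounded_measurable_const)
  ultimately show ?thesis by (auto simp: cfun.subspace_def plus_fun_def zero_fun_def)
qed

text \<open>For \<open>\<eta> \<in> S\<close> the mean of \<open>g\<close> vanishes, which kills the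
  product term of \<open>integral_pair_diff\<close> and leaves the factor
  \<open>2 * measure \<mu> (bcyl k G \<eta>)\<close>. Otherwise the integrand is zero.\<close>

lemma LB_good_integral:
  assumes g: "g \<in> LB_good S" and f: "f \<in> bounded_measurable \<mu>" and \<eta>: "\<eta> \<in> fpaths k G"
  shows "(LINT p|(\<mu> \<Otimes>\<^sub>M \<mu>). indicator (bcyl k G \<eta> \<times> bcyl k G \<eta>) p *
      (cnj (f (fst p) - f (snd p)) * (g (fst p) - g (snd p))))
    = (if \<eta> \<in> S then complex_of_real (2 * measure \<mu> (bcyl k G \<eta>)) else 0) * L2_inner \<mu> f g"
proof (cases "\<eta> \<in> S")
  case True
  then have z: "g y = 0" if "y \<notin> bcyl k G \<eta>" for y using g that by (auto simp: LB_good_def)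
  have m: "(LINT y|\<mu>. g y) = 0" using g True by (auto simp: LB_good_def)
  have gb: "g \<in> bounded_measurable \<mu>" using g by (auto simp: LB_good_def)
  have eq: "indicator (bcyl k G \<eta>) y * (cnj (f y) * g y) = cnj (f y) * g y" "indicator (bcyl k G \<eta>) y * g y = g y" for y
    using z[of y] by (auto simp: indicator_def)
  show ?thesis
    unfolding \<mu>.integral_pair_diff[OF f gb bcyl_sets[OF \<eta>]] eq m L2_inner_def using True by simp
next
  case False
  then obtain c where "\<forall>y\<in>bcyl k G \<eta>. g y = c" using g \<eta> unfolding LB_good_def by blast
  then have eq: "indicator (bcyl k G \<eta> \<times> bcyl k G \<eta>) p * (cnj (f (fst p) - f (snd p)) * (g (fst p) - g (snd p))) = 0" for p
    by (cases p) (auto simp: indicator_def)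
  show ?thesis unfolding eq using False by simp
qed

text \<open>The constant is chosen before \<open>f\<close> and \<open>g\<close>, so the identity is
  an eigenvalue equation in weak form. Only the paths in \<open>S\<close> contribute to it.\<close>

lemma LB_form_LB_good:
  assumes S: "finite S" "S \<subseteq> fpaths k G"
  shows "\<exists>c. \<forall>g\<in>LB_good S. \<forall>f\<in>bounded_measurable \<mu>. LB_form k G x \<delta> \<mu> s f g = c * L2_inner \<mu> f g"
proof -
  interpret P: pair_prob_space \<mu> \<mu> by (rule \<mu>.pair_prob)
  let ?D = "diam_pairs k G x \<delta>"
  let ?F = "\<lambda>f g p. cnj (f (fst p) - f (snd p)) * (g (fst p) - g (snd p) :: complex)"
  have Fb: "?F f g \<in> bounded_measurable (\<mu> \<Otimes>\<^sub>M \<mu>)"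
    if "f \<in> bounded_measurable \<mu>" "g \<in> bounded_measurable \<mu>" for f g
    by (intro bounded_measurable_intros bounded_measurable_comp[OF _ that(1)] bounded_measurable_comp[OF _ that(2)])
      measurable
  \<comment> \<open>Each square belonging to the branching path or to one of its extensions
    contributes according to membership in \<open>S\<close>, independently of \<open>f\<close> and
    \<open>g\<close>; hence a single factor \<open>\<kappa>\<close> per path.\<close>
  have "\<exists>\<kappa>. \<forall>g\<in>LB_good S. \<forall>f\<in>bounded_measurable \<mu>.
      (LINT p|(\<mu> \<Otimes>\<^sub>M \<mu>). indicator (?D \<eta>) p * ?F f g p) = \<kappa> * L2_inner \<mu> f g" if \<eta>: "\<eta> \<in> fpaths k G" for \<eta>
  proof -
    obtain \<gamma> where \<gamma>: "\<gamma> \<in> fpaths k G"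
      "\<And>F :: _ \<Rightarrow> complex. F \<in> bounded_measurable (\<mu> \<Otimes>\<^sub>M \<mu>) \<Longrightarrow>
      (LINT p|(\<mu> \<Otimes>\<^sub>M \<mu>). indicator (diam_pairs k G x \<delta> \<eta>) p * F p)
      = (LINT p|(\<mu> \<Otimes>\<^sub>M \<mu>). indicator (bcyl k G \<gamma> \<times> bcyl k G \<gamma>) p * F p)
        - (\<Sum>e\<in>ext \<gamma>. LINT p|(\<mu> \<Otimes>\<^sub>M \<mu>). indicator (bcyl k G (psnoc \<gamma> e) \<times> bcyl k G (psnoc \<gamma> e)) p * F p)"
      using integral_diam_pairs[OF \<eta>] by blast
    let ?q = "\<lambda>\<eta>. if \<eta> \<in> S then complex_of_real (2 * measure \<mu> (bcyl k G \<eta>)) else 0"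
    have "(LINT p|(\<mu> \<Otimes>\<^sub>M \<mu>). indicator (?D \<eta>) p * ?F f g p)
        = (?q \<gamma> - (\<Sum>e\<in>ext \<gamma>. ?q (psnoc \<gamma> e))) * L2_inner \<mu> f g"
      if g: "g \<in> LB_good S" and f: "f \<in> bounded_measurable \<mu>" for f g
    proof -
      have gb: "g \<in> bounded_measurable \<mu>" using g by (simp add: LB_good_def)
      show ?thesis
        unfolding \<gamma>(2)[OF Fb[OF f gb]] LB_good_integral[OF g f \<gamma>(1)] left_diff_distrib sum_distrib_right
        by (intro arg_cong2[where f = minus] sum.cong refl LB_good_integral[OF g f])
          (use \<gamma>(1) in \<open>simp add: psnoc_fpaths\<close>)
    qed
    then show ?thesis by blast
  qed
  then obtain \<kappa> where \<kappa>: "\<And>\<eta> f g. \<eta> \<in> fpaths k G \<Longrightarrow> g \<in> LB_good S \<Longrightarrow> f \<in> bounded_measurable \<mu> \<Longrightarrow>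
      (LINT p|(\<mu> \<Otimes>\<^sub>M \<mu>). indicator (?D \<eta>) p * ?F f g p) = \<kappa> \<eta> * L2_inner \<mu> f g"
    using bchoice[of "fpaths k G" "\<lambda>\<eta> \<kappa>. \<forall>g\<in>LB_good S. \<forall>f\<in>bounded_measurable \<mu>.
      (LINT p|(\<mu> \<Otimes>\<^sub>M \<mu>). indicator (?D \<eta>) p * ?F f g p) = \<kappa> * L2_inner \<mu> f g"] by blast
  let ?N = "\<lambda>\<eta>. uniform_measure (restrict_space (\<mu> \<Otimes>\<^sub>M \<mu>) (?D \<eta>)) (?D \<eta>)"
  let ?CM = "choice_measure k G x \<delta> \<mu>"
  let ?w = "\<lambda>\<eta>. 2 * complex_of_real (wdiam k G x \<delta> \<eta> powr s) * complex_of_real ((1 / wdiam k G x \<delta> \<eta>)\<^sup>2)"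
  have D: "?D \<eta> \<in> sets (\<mu> \<Otimes>\<^sub>M \<mu>)" "measure (\<mu> \<Otimes>\<^sub>M \<mu>) (?D \<eta>) > 0" if "\<eta> \<in> fpaths k G" for \<eta>
    using integral_diam_pairs[OF that] by blast+
  have probN: "prob_space (?N \<eta>)" if "\<eta> \<in> fpaths k G" for \<eta>
    by (rule integral_uniform_restrict(2)[OF P.finite_measure_axioms D[OF that]]) (auto intro: borel_measurable_const)
  have meas: "(\<lambda>\<tau>. \<tau> \<eta>) \<in> measurable ?CM (?N \<eta>)" if "\<eta> \<in> fpaths k G" for \<eta>
    unfolding choice_measure_def by (rule measurable_component_singleton[OF that])
  \<comment> \<open>The marginal of the product measure at \<open>\<eta>\<close> is the factor at
    \<open>\<eta>\<close>, so the expectation of a term that depends on \<open>\<tau> \<eta>\<close>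
    alone is an integral over pairs.\<close>
  have distr: "distr ?CM (?N \<eta>) (\<lambda>\<tau>. \<tau> \<eta>) = ?N \<eta>" if "\<eta> \<in> fpaths k G" for \<eta>
    unfolding choice_measure_def by (rule distr_PiM_component[OF probN that])
  have FN: "F \<in> bounded_measurable (?N \<eta>)" if "F \<in> bounded_measurable (\<mu> \<Otimes>\<^sub>M \<mu>)" for F \<eta>
  proof -
    have F: "F \<in> borel_measurable (\<mu> \<Otimes>\<^sub>M \<mu>)" "\<exists>C. \<forall>p. cmod (F p) \<le> C"
      using that unfolding bounded_measurable_def by blast+
    have "F \<in> borel_measurable (?N \<eta>)"
      unfolding measurable_cong_sets[OF sets_uniform_measure refl] by (rule measurable_restrict_space1[OF F(1)])
    then show ?thesis using F(2) unfolding bounded_measurable_def by blast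
  qed
  interpret CM: prob_space ?CM
    unfolding choice_measure_def by (rule prob_space_PiM[OF probN])
  have comp: "(LINT \<tau>|?CM. F (\<tau> \<eta>)) = (LINT p|(\<mu> \<Otimes>\<^sub>M \<mu>). indicator (?D \<eta>) p * F p) / complex_of_real (measure (\<mu> \<Otimes>\<^sub>M \<mu>) (?D \<eta>))"
    "integrable ?CM (\<lambda>\<tau>. F (\<tau> \<eta>))"
    if F: "F \<in> bounded_measurable (\<mu> \<Otimes>\<^sub>M \<mu>)" and \<eta>: "\<eta> \<in> fpaths k G" for F \<eta>
  proof -
    have "(LINT \<tau>|?CM. F (\<tau> \<eta>)) = (LINT p|distr ?CM (?N \<eta>) (\<lambda>\<tau>. \<tau> \<eta>). F p)"
      by (rule integral_distr[symmetric, OF meas[OF \<eta>]]) (use FN[OF F, of \<eta>] in \<open>simp add: bounded_measurable_def\<close>)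
    also have "\<dots> = (LINT p|?N \<eta>. F p)" unfolding distr[OF \<eta>] by (rule refl)
    also have "\<dots> = (LINT p|(\<mu> \<Otimes>\<^sub>M \<mu>). indicator (?D \<eta>) p * F p) / complex_of_real (measure (\<mu> \<Otimes>\<^sub>M \<mu>) (?D \<eta>))"
      by (rule integral_uniform_restrict(1)[OF P.finite_measure_axioms D[OF \<eta>]])
        (use F in \<open>simp add: bounded_measurable_def\<close>)
    finally show "(LINT \<tau>|?CM. F (\<tau> \<eta>)) = (LINT p|(\<mu> \<Otimes>\<^sub>M \<mu>). indicator (?D \<eta>) p * F p) / complex_of_real (measure (\<mu> \<Otimes>\<^sub>M \<mu>) (?D \<eta>))" .
    show "integrable ?CM (\<lambda>\<tau>. F (\<tau> \<eta>))"
      by (intro CM.bounded_measurable_integrable bounded_measurable_comp[OF meas[OF \<eta>]] FN[OF F])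
  qed
  have "LB_form k G x \<delta> \<mu> s f g
      = (1 / 2 * (\<Sum>\<eta>\<in>S. ?w \<eta> * (\<kappa> \<eta> / complex_of_real (measure (\<mu> \<Otimes>\<^sub>M \<mu>) (?D \<eta>))))) * L2_inner \<mu> f g"
    if g: "g \<in> LB_good S" and f: "f \<in> bounded_measurable \<mu>" for f g
  proof -
    have gb: "g \<in> bounded_measurable \<mu>" using g by (simp add: LB_good_def)
    note F = Fb[OF f gb]
    have "(\<Sum>\<^sub>\<infinity>\<eta>\<in>fpaths k G. ?w \<eta> * ?F f g (\<tau> \<eta>)) = (\<Sum>\<eta>\<in>S. ?w \<eta> * ?F f g (\<tau> \<eta>))"
      if \<tau>: "\<tau> \<in> space ?CM" for \<tau>
    proof -
      \<comment> \<open>Both chosen points lie in the cylinder set of \<open>\<eta>\<close>, where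
        \<open>g\<close> is constant; this cuts the infinite sum down to \<open>S\<close>.\<close>
      have "g (fst (\<tau> \<eta>)) = g (snd (\<tau> \<eta>))" if \<eta>: "\<eta> \<in> fpaths k G" "\<eta> \<notin> S" for \<eta>
      proof -
        have "\<tau> \<eta> \<in> ?D \<eta>"
          using \<tau> \<eta> by (auto simp: space_choice_measure[OF space_\<mu>] choice_functions_def)
        then have "fst (\<tau> \<eta>) \<in> bcyl k G \<eta>" "snd (\<tau> \<eta>) \<in> bcyl k G \<eta>" by (auto simp: diam_pairs_def)
        moreover obtain c where "\<forall>y\<in>bcyl k G \<eta>. g y = c" using g \<eta> unfolding LB_good_def by blast
        ultimately show ?thesis by simp
      qed
      then have "(\<Sum>\<^sub>\<infinity>\<eta>\<in>fpaths k G. ?w \<eta> * ?F f g (\<tau> \<eta>)) = (\<Sum>\<^sub>\<infinity>\<eta>\<in>S. ?w \<eta> * ?F f g (\<tau> \<eta>))"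
        using S(2) by (intro infsum_cong_neutral) auto
      then show ?thesis using S(1) by simp
    qed
    then have "LB_form k G x \<delta> \<mu> s f g = 1 / 2 * (LINT \<tau>|?CM. (\<Sum>\<eta>\<in>S. ?w \<eta> * ?F f g (\<tau> \<eta>)))"
      unfolding LB_form_def trace_blocks
      by (intro arg_cong2[where f = times] refl Bochner_Integration.integral_cong)
    also have "(LINT \<tau>|?CM. (\<Sum>\<eta>\<in>S. ?w \<eta> * ?F f g (\<tau> \<eta>))) = (\<Sum>\<eta>\<in>S. LINT \<tau>|?CM. ?w \<eta> * ?F f g (\<tau> \<eta>))"
      using S(2) comp(2)[OF F] by (intro Bochner_Integration.integral_sum integrable_mult_right) auto
    also have "\<dots> = (\<Sum>\<eta>\<in>S. ?w \<eta> * (\<kappa> \<eta> / complex_of_real (measure (\<mu> \<Otimes>\<^sub>M \<mu>) (?D \<eta>))) * L2_inner \<mu> f g)"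
    proof (intro sum.cong refl)
      fix \<eta> assume "\<eta> \<in> S"
      then have \<eta>: "\<eta> \<in> fpaths k G" using S(2) by auto
      have "(LINT \<tau>|?CM. ?w \<eta> * ?F f g (\<tau> \<eta>)) = ?w \<eta> * (LINT \<tau>|?CM. ?F f g (\<tau> \<eta>))"
        by (rule integral_mult_right_zero)
      also have "\<dots> = ?w \<eta> * (\<kappa> \<eta> * L2_inner \<mu> f g / complex_of_real (measure (\<mu> \<Otimes>\<^sub>M \<mu>) (?D \<eta>)))"
        unfolding comp(1)[OF F \<eta>] \<kappa>[OF \<eta> g f] by (rule refl)
      finally show "(LINT \<tau>|?CM. ?w \<eta> * ?F f g (\<tau> \<eta>))
          = ?w \<eta> * (\<kappa> \<eta> / complex_of_real (measure (\<mu> \<Otimes>\<^sub>M \<mu>) (?D \<eta>))) * L2_inner \<mu> f g" by simp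
    qed
    finally show ?thesis by (simp add: sum_distrib_right mult.assoc)
  qed
  then show ?thesis by blast
qed

end

section \<open>The given spaces as parts of eigenspaces\<close>

lemma diffs_reindex:
  assumes "inj_on h I" shows "diffs M B (h ` I) = diffs M (\<lambda>i. B (h i)) I"
  using assms unfolding diffs_def inj_on_def by blast

lemma diffs_image:
  "diffs M B I = (\<lambda>(i, j) y. normalized_indicator M (B i) y - normalized_indicator M (B j) y) `
    {(i, j). i \<in> I \<and> j \<in> I \<and> i \<noteq> j}"
  unfolding diffs_def fun_diff_def by (auto simp: image_iff)

lemma E_zero_eq: "E_zero k G \<mu> = L2_span \<mu> (diffs \<mu> (\<lambda>v. bcyl k G (v, [])) (verts G))"
  unfolding E_zero_def diffs_def by (rule refl)

lemma (in finite_k_graph) E_path_eq: "E_path k G \<mu> \<gamma> = L2_span \<mu> (diffs \<mu> (\<lambda>e. bcyl k G (psnoc \<gamma> e)) (ext \<gamma>))"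
  unfolding E_path_def diffs_def ext1_def ext_def
  by (intro arg_cong[where f = "L2_span \<mu>"]) blast

context laplace_k_graph begin

lemma LB_domain_bounded_measurable: "LB_domain k G \<subseteq> bounded_measurable \<mu>"
  unfolding LB_domain_def
proof (rule cspan_subset)
  show "cfun.subspace (bounded_measurable \<mu>)"
    using bounded_measurable_add[of _ \<mu>] bounded_measurable_scale[of _ \<mu>] bounded_measurable_const[of 0 \<mu>]
    by (auto simp: cfun.subspace_def plus_fun_def zero_fun_def)
qed (auto intro!: bounded_measurable_indicator bcyl_sets)

text \<open>\<open>laplace_beltrami\<close> evaluates the form at a representative and tests it with
  functions of \<open>LB_domain\<close>, which are bounded and measurable. A combination
  \<open>g\<close> of elements of \<open>E\<close> is such a representative and lies in the subspace
  \<open>LB_good S\<close>.\<close>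

lemma eigenspace:
  assumes "finite S" "S \<subseteq> fpaths k G" "E \<subseteq> LB_good S" "E \<subseteq> LB_domain k G"
  shows "\<exists>c. L2_span \<mu> E \<subseteq> LB_eigenspace k G x \<delta> \<mu> s c"
proof -
  obtain c where c: "\<forall>g\<in>LB_good S. \<forall>f\<in>bounded_measurable \<mu>. LB_form k G x \<delta> \<mu> s f g = c * L2_inner \<mu> f g"
    using LB_form_LB_good[OF assms(1,2)] by blast
  have "L2_span \<mu> E \<subseteq> LB_eigenspace k G x \<delta> \<mu> s c"
  proof
    fix h assume "h \<in> L2_span \<mu> E"
    then obtain g where g: "h \<in> L2 \<mu>" "g \<in> cspan E" "AE y in \<mu>. h y = g y" by (rule L2_spanE)
    have gg: "g \<in> LB_good S" using cspan_subset[OF assms(3) LB_good_subspace] g(2) by blast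
    have gd: "g \<in> LB_domain k G"
      using cspan_trans[of E "(\<lambda>\<gamma>. indicator (bcyl k G \<gamma>)) ` fpaths k G"] assms(4) g(2)
      unfolding LB_domain_def by blast
    have gL: "g \<in> L2 \<mu>" using LB_domain_bounded_measurable gd \<mu>.bounded_measurable_L2 by blast
    have "L2_inner \<mu> f (\<lambda>y. c * h y) = LB_form k G x \<delta> \<mu> s f g" if "f \<in> LB_domain k G" for f
    proof -
      have f: "f \<in> bounded_measurable \<mu>" using that LB_domain_bounded_measurable by blast
      then have "f \<in> L2 \<mu>" by (rule \<mu>.bounded_measurable_L2)
      then have "L2_inner \<mu> f h = L2_inner \<mu> f g" using L2_inner_cong_AE[of f \<mu> f h g] g gL by simp
      then show ?thesis using c gg f by (simp add: L2_inner_scale_right)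
    qed
    then show "h \<in> LB_eigenspace k G x \<delta> \<mu> s c"
      unfolding LB_eigenspace_def laplace_beltrami_def using g gd L2_scale[OF g(1)] by blast
  qed
  then show ?thesis by blast
qed

lemma diffs_LB_domain:
  assumes "p ` I \<subseteq> fpaths k G" shows "diffs \<mu> (\<lambda>i. bcyl k G (p i)) I \<subseteq> LB_domain k G"
proof -
  have "cspan ((\<lambda>i. indicator (bcyl k G (p i))) ` I) \<subseteq> LB_domain k G"
    unfolding LB_domain_def using assms by (intro cspan_mono) auto
  then show ?thesis using diffs_in_cspan[of \<mu> "\<lambda>i. bcyl k G (p i)" I] by blast
qed

text \<open>By \<open>bcyl_nested\<close> the cylinder set of the longer path lies inside that of
  the shorter one or misses it.\<close>

lemma normalized_indicator_bcyl_const: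
  assumes "plen \<gamma> \<le> plen \<eta>"
  shows "\<exists>c. \<forall>y\<in>bcyl k G \<eta>. normalized_indicator \<mu> (bcyl k G \<gamma>) y = c"
proof (cases "bcyl k G \<eta> \<inter> bcyl k G \<gamma> = {}")
  case True
  then have "\<forall>y\<in>bcyl k G \<eta>. normalized_indicator \<mu> (bcyl k G \<gamma>) y = 0"
    by (auto simp: normalized_indicator_def indicator_def)
  then show ?thesis by blast
next
  case False
  then have "bcyl k G \<eta> \<subseteq> bcyl k G \<gamma>" using bcyl_nested[OF assms] by blast
  then have "\<forall>y\<in>bcyl k G \<eta>. normalized_indicator \<mu> (bcyl k G \<gamma>) y = complex_of_real (1 / measure \<mu> (bcyl k G \<gamma>))"
    by (auto simp: normalized_indicator_def indicator_def)
  then show ?thesis by blast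
qed

lemma diffs_const:
  assumes "f \<in> diffs \<mu> (\<lambda>i. bcyl k G (p i)) I" "\<And>i. i \<in> I \<Longrightarrow> plen (p i) \<le> plen \<eta>"
  shows "\<exists>c. \<forall>y\<in>bcyl k G \<eta>. f y = c"
proof -
  from assms(1) obtain i j where ij: "i \<in> I" "j \<in> I"
    "f = (\<lambda>y. normalized_indicator \<mu> (bcyl k G (p i)) y - normalized_indicator \<mu> (bcyl k G (p j)) y)"
    by (auto simp: diffs_def fun_diff_def)
  obtain c where c: "\<forall>y\<in>bcyl k G \<eta>. normalized_indicator \<mu> (bcyl k G (p i)) y = c"
    using normalized_indicator_bcyl_const[OF assms(2)[OF ij(1)]] by blast
  obtain d where d: "\<forall>y\<in>bcyl k G \<eta>. normalized_indicator \<mu> (bcyl k G (p j)) y = d"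
    using normalized_indicator_bcyl_const[OF assms(2)[OF ij(2)]] by blast
  show ?thesis using c d unfolding ij(3) by (intro exI[of _ "c - d"]) simp
qed

lemma E_minus1_eigenspace: "\<exists>c. E_minus1 k G \<mu> \<subseteq> LB_eigenspace k G x \<delta> \<mu> s c"
  unfolding E_minus1_def
\<comment> \<open>The indicator of the whole space is constant on every cylinder set, so
  \<open>S\<close> can be empty.\<close>
proof (rule eigenspace[of "{}"])
  have "bspace k G \<in> sets \<mu>" using sets.top[of \<mu>] space_\<mu> by simp
  then show "{indicator (bspace k G)} \<subseteq> LB_good {}"
    using bcyl_bspace[of k G]
    by (auto simp: LB_good_def indicator_def subset_iff intro!: bounded_measurable_indicator exI[of _ 1])
  have "indicator (bspace k G) = (\<lambda>y. \<Sum>v\<in>verts G. indicator (bcyl k G (v, [])) y :: complex)"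
    using indicator_UN_sum[OF finite_verts disjoint_bcyl_vert]
    by (intro ext) (simp add: bspace_eq_UN paths_0)
  also have "\<dots> \<in> LB_domain k G"
    unfolding LB_domain_def by (intro cspan_sum cspan_base) simp
  finally show "{indicator (bspace k G)} \<subseteq> LB_domain k G" by simp
qed auto

lemma diffs_bounded_measurable:
  assumes "p ` I \<subseteq> fpaths k G" shows "diffs \<mu> (\<lambda>i. bcyl k G (p i)) I \<subseteq> bounded_measurable \<mu>"
  using diffs_LB_domain[OF assms] LB_domain_bounded_measurable by blast

lemma E_zero_eigenspace: "\<exists>c. E_zero k G \<mu> \<subseteq> LB_eigenspace k G x \<delta> \<mu> s c"
  unfolding E_zero_eq
\<comment> \<open>Functions of the initial vertex are constant on every cylinder set, also on those
  of paths of length 0; again \<open>S\<close> is empty.\<close>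
proof (rule eigenspace[of "{}"])
  have p: "(\<lambda>v. (v, [])) ` verts G \<subseteq> fpaths k G" by auto
  show "diffs \<mu> (\<lambda>v. bcyl k G (v, [])) (verts G) \<subseteq> LB_domain k G" by (rule diffs_LB_domain[OF p])
  show "diffs \<mu> (\<lambda>v. bcyl k G (v, [])) (verts G) \<subseteq> LB_good {}"
    using diffs_bounded_measurable[OF p] diffs_const[where p = "\<lambda>v. (v, [])"]
    by (auto simp: LB_good_def)
qed auto

lemma E_path_eigenspace:
  assumes \<gamma>: "\<gamma> \<in> fpaths k G" shows "\<exists>c. E_path k G \<mu> \<gamma> \<subseteq> LB_eigenspace k G x \<delta> \<mu> s c"
  unfolding E_path_eq
proof (rule eigenspace)
  \<comment> \<open>These are the initial segments of \<open>\<gamma>\<close>, including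
    \<open>\<gamma>\<close> itself. The length bound keeps the set finite; on the cylinder set of a
    longer path \<open>g\<close> is constant, by \<open>diffs_const\<close>.\<close>
  let ?S = "{\<eta> \<in> fpaths k G. plen \<eta> \<le> plen \<gamma> \<and> bcyl k G \<gamma> \<subseteq> bcyl k G \<eta>}"
  let ?E = "diffs \<mu> (\<lambda>e. bcyl k G (psnoc \<gamma> e)) (ext \<gamma>)"
  have "?S \<subseteq> (\<Union>n\<le>plen \<gamma>. paths n)" by (auto simp: paths_def)
  then show "finite ?S" by (rule finite_subset) (auto intro: finite_paths)
  show "?S \<subseteq> fpaths k G" by auto
  have p: "psnoc \<gamma> ` ext \<gamma> \<subseteq> fpaths k G" using psnoc_fpaths[OF \<gamma>] by auto
  show "?E \<subseteq> LB_domain k G" by (rule diffs_LB_domain[OF p])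
  show "?E \<subseteq> LB_good ?S"
  proof
    fix g assume g: "g \<in> ?E"
    have sets: "bcyl k G (psnoc \<gamma> e) \<in> sets \<mu>" "measure \<mu> (bcyl k G (psnoc \<gamma> e)) > 0" if "e \<in> ext \<gamma>" for e
      using that p by (auto intro: bcyl_sets measure_bcyl_pos)
    note D = \<mu>.integral_diffs[OF sets g]
    have supp: "g y = 0" if "y \<notin> bcyl k G \<gamma>" for y
      using D(3) that bcyl_eq_UN[OF \<gamma>] by blast
    have "g \<in> bounded_measurable \<mu>" using diffs_bounded_measurable[OF p] g by blast
    moreover have "\<exists>c. \<forall>y\<in>bcyl k G \<eta>. g y = c" if \<eta>: "\<eta> \<in> fpaths k G - ?S" for \<eta>
    proof (cases "plen \<eta> \<le> plen \<gamma>")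
      case True
      then have "bcyl k G \<eta> \<inter> bcyl k G \<gamma> = {}" using bcyl_nested[OF True] \<eta> by blast
      then have "\<forall>y\<in>bcyl k G \<eta>. g y = 0" using supp by blast
      then show ?thesis by blast
    next
      case False
      then show ?thesis by (intro diffs_const[OF g]) simp
    qed
    moreover have "(\<forall>y. y \<notin> bcyl k G \<eta> \<longrightarrow> g y = 0) \<and> (LINT y|\<mu>. g y) = 0" if "\<eta> \<in> ?S" for \<eta>
      using that supp D(2) by blast
    ultimately show "g \<in> LB_good ?S" unfolding LB_good_def by blast
  qed
qed

end

section \<open>The wavelet decomposition\<close>

locale wavelet_k_graph = dixmier_k_graph k G x \<delta> \<mu> for k and G :: "'a kgraph" and x \<delta> \<mu> +
  fixes M :: "((nat \<Rightarrow> nat) \<times> (nat \<Rightarrow> nat) \<Rightarrow> 'a) measure"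
  assumes perron_M: "perron_measure k G x M"
begin

abbreviation pcyl :: "'a \<times> 'a list \<Rightarrow> ((nat \<Rightarrow> nat) \<times> (nat \<Rightarrow> nat) \<Rightarrow> 'a) set" where
  "pcyl \<gamma> \<equiv> cyl k G (pcomp G \<gamma>)"

lemma prob_space_M: "prob_space M" and space_M: "space M = inf_paths k G"
  and sets_M: "sets M = sigma_sets (inf_paths k G) (pcyl ` fpaths k G)"
  using perron_M by (auto simp: perron_measure_def borel_sets_inf_paths)

lemma pcyl_sets: "\<gamma> \<in> fpaths k G \<Longrightarrow> pcyl \<gamma> \<in> sets M"
  unfolding sets_M by (auto intro: sigma_sets.Basic)

lemma to_bratteli_vimage: "\<gamma> \<in> fpaths k G \<Longrightarrow> to_bratteli k -` bcyl k G \<gamma> \<inter> space M = pcyl \<gamma>"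
  using to_bratteli_bcyl[of _ \<gamma>] by (auto simp: space_M cyl_def)

text \<open>Both sides are \<open>x (psrc G \<gamma>) / growth (plen \<gamma>)\<close>: the left by
  the defining property of \<open>M\<close>, the right by \<open>measure_bcyl\<close>.\<close>

lemma measure_pcyl:
  assumes \<gamma>: "\<gamma> \<in> fpaths k G" shows "measure M (pcyl \<gamma>) = measure \<mu> (bcyl k G \<gamma>)"
proof -
  have "measure M (pcyl \<gamma>) = (\<Prod>i<k. 1 / rho G i ^ ld (plen \<gamma>) i) * x (psrc G \<gamma>)"
    using perron_M pcomp[OF \<gamma>] by (simp add: perron_measure_def)
  then show ?thesis by (simp add: measure_bcyl[OF \<gamma>] growth_def prod_dividef)
qed

lemma to_bratteli_measurable: "to_bratteli k \<in> measurable M \<mu>"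
proof (rule measurable_sigma_sets[OF sets_\<mu>])
  show "bcyl k G ` fpaths k G \<subseteq> Pow (bspace k G)" using bcyl_bspace[of k G] by auto
  show "to_bratteli k \<in> space M \<rightarrow> bspace k G" using to_bratteli_bspace by (auto simp: space_M)
qed (use to_bratteli_vimage pcyl_sets in auto)

text \<open>Cylinder sets together with the empty set are stable under intersection and generate the
  sigma-algebra, and both measures agree on them. The purpose is to pull back null sets.\<close>

lemma distr_to_bratteli: "distr M \<mu> (to_bratteli k) = \<mu>"
proof (rule measure_eqI_generator_eq_countable)
  interpret M: prob_space M by (rule prob_space_M)
  let ?E = "insert {} (bcyl k G ` fpaths k G)"
  show "Int_stable ?E"
  proof (rule Int_stableI)
    have *: "bcyl k G \<gamma> \<inter> bcyl k G \<eta> \<in> ?E" if "\<gamma> \<in> fpaths k G" "\<eta> \<in> fpaths k G" "plen \<gamma> \<le> plen \<eta>" for \<gamma> \<eta>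
    proof (cases "bcyl k G \<gamma> \<inter> bcyl k G \<eta> = {}")
      case False
      then have "bcyl k G \<eta> \<subseteq> bcyl k G \<gamma>" using bcyl_nested[OF that(3)] by blast
      then have "bcyl k G \<gamma> \<inter> bcyl k G \<eta> = bcyl k G \<eta>" by blast
      then show ?thesis using that by simp
    qed simp
    fix a b assume ab: "a \<in> ?E" "b \<in> ?E"
    show "a \<inter> b \<in> ?E"
    proof (cases "a = {} \<or> b = {}")
      case False
      with ab obtain \<gamma> \<eta> where ge: "a = bcyl k G \<gamma>" "b = bcyl k G \<eta>" "\<gamma> \<in> fpaths k G" "\<eta> \<in> fpaths k G"
        by auto
      show ?thesis
        using *[of \<gamma> \<eta>] *[of \<eta> \<gamma>] ge by (cases "plen \<gamma> \<le> plen \<eta>") (simp_all add: Int_commute)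
    qed auto
  qed
  show sub: "?E \<subseteq> Pow (bspace k G)" using bcyl_bspace[of k G] by auto
  have eq: "sigma_sets (bspace k G) ?E = sigma_sets (bspace k G) (bcyl k G ` fpaths k G)"
    by (rule sigma_sets_eqI) (auto intro: sigma_sets.intros)
  show "sets \<mu> = sigma_sets (bspace k G) ?E" "sets (distr M \<mu> (to_bratteli k)) = sigma_sets (bspace k G) ?E"
    by (simp_all add: eq sets_\<mu>)
  show "emeasure (distr M \<mu> (to_bratteli k)) X = emeasure \<mu> X" if "X \<in> ?E" for X
  proof (cases "X = {}")
    case False
    with that obtain \<gamma> where \<gamma>: "\<gamma> \<in> fpaths k G" "X = bcyl k G \<gamma>" by auto
    then show ?thesis
      using measure_pcyl[OF \<gamma>(1)]
      by (simp add: emeasure_distr[OF to_bratteli_measurable bcyl_sets] to_bratteli_vimage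
          M.emeasure_eq_measure \<mu>.emeasure_eq_measure)
  qed simp
  show "bcyl k G ` fpaths k G \<subseteq> ?E" by auto
  show "\<Union>(bcyl k G ` fpaths k G) = bspace k G" by (rule UN_bcyl)
  show "countable (bcyl k G ` fpaths k G)" using countable_fpaths by simp
  show "emeasure (distr M \<mu> (to_bratteli k)) a \<noteq> \<infinity>" for a
    using finite_measure.emeasure_finite[OF M.finite_measure_distr[OF to_bratteli_measurable]] by simp
qed

lemma AE_to_bratteli: "AE y in \<mu>. P y \<Longrightarrow> AE w in M. P (to_bratteli k w)"
  by (rule AE_distrD[OF to_bratteli_measurable, unfolded distr_to_bratteli])

lemma pcyl_UN: "\<gamma> \<in> fpaths k G \<Longrightarrow> pcyl \<gamma> = (\<Union>e\<in>ext \<gamma>. pcyl (psnoc \<gamma> e))"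
proof -
  assume \<gamma>: "\<gamma> \<in> fpaths k G"
  have "pcyl \<gamma> = (\<Union>e\<in>ext \<gamma>. to_bratteli k -` bcyl k G (psnoc \<gamma> e) \<inter> space M)"
    unfolding to_bratteli_vimage[OF \<gamma>, symmetric] bcyl_eq_UN[OF \<gamma>] by blast
  then show ?thesis using to_bratteli_vimage psnoc_fpaths[OF \<gamma>] by simp
qed

text \<open>The cells are taken in the path space of the graph, where the wavelet spaces live; the
  tree structure and positivity are pulled back from the diagram.\<close>

sublocale W: nested_partitions M paths "\<lambda>\<gamma>. psnoc \<gamma> ` ext \<gamma>" pcyl
proof (intro nested_partitions.intro prob_space_M nested_partitions_axioms.intro)
  fix n
  show "finite (paths n)" by (rule finite_paths)
  show "paths (Suc n) = (\<Union>\<gamma>\<in>paths n. psnoc \<gamma> ` ext \<gamma>)" by (rule paths_Suc)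
  fix \<gamma> assume "\<gamma> \<in> paths n"
  then have \<gamma>: "\<gamma> \<in> fpaths k G" by (simp add: paths_def)
  show "pcyl \<gamma> \<in> sets M" by (rule pcyl_sets[OF \<gamma>])
  show "measure M (pcyl \<gamma>) > 0" using measure_pcyl[OF \<gamma>] measure_bcyl_pos[OF \<gamma>] by simp
  show "pcyl \<gamma> = \<Union>(pcyl ` psnoc \<gamma> ` ext \<gamma>)" using pcyl_UN[OF \<gamma>] by simp
  have "pcyl (psnoc \<gamma> e) \<inter> pcyl (psnoc \<gamma> e') = {}" if "e \<in> ext \<gamma>" "e' \<in> ext \<gamma>" "e \<noteq> e'" for e e'
    using to_bratteli_vimage[of "psnoc \<gamma> e"] to_bratteli_vimage[of "psnoc \<gamma> e'"] psnoc_fpaths[OF \<gamma>]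
      disjoint_bcyl_psnoc[OF that(3), of \<gamma>] that by blast
  then show "disjoint_family_on pcyl (psnoc \<gamma> ` ext \<gamma>)" by (auto simp: disjoint_family_on_def)
next
  have f: "\<gamma> \<in> fpaths k G" if "\<gamma> \<in> paths 0" for \<gamma> using that by (simp add: paths_def)
  have "(\<Union>\<gamma>\<in>paths 0. pcyl \<gamma>) = (\<Union>\<gamma>\<in>paths 0. to_bratteli k -` bcyl k G \<gamma> \<inter> space M)"
    using to_bratteli_vimage f by simp
  also have "\<dots> = to_bratteli k -` bspace k G \<inter> space M" unfolding bspace_eq_UN by blast
  also have "\<dots> = space M" using to_bratteli_bspace by (auto simp: space_M)
  finally show "(\<Union>\<gamma>\<in>paths 0. pcyl \<gamma>) = space M" .
  show "disjoint_family_on pcyl (paths 0)"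
    unfolding disjoint_family_on_def
  proof (intro ballI impI)
    fix \<gamma> \<eta> assume ge: "\<gamma> \<in> paths 0" "\<eta> \<in> paths 0" "\<gamma> \<noteq> \<eta>"
    then have "bcyl k G \<gamma> \<inter> bcyl k G \<eta> = {}" by (auto simp: paths_0 bcyl_Nil)
    then show "pcyl \<gamma> \<inter> pcyl \<eta> = {}"
      unfolding to_bratteli_vimage[OF f[OF ge(1)], symmetric] to_bratteli_vimage[OF f[OF ge(2)], symmetric]
      by blast
  qed
qed

lemma wavelet_V_eq: "wavelet_V k G M n = L2_span M (W.inds (n * k))"
  unfolding wavelet_V_def pcomp_paths_diag[symmetric] image_image by (rule refl)

lemma decomposition: "is_L2_decomposition M (case_nat (wavelet_V k G M 0) (wavelet_W k G M))"
proof -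
  have "sets M = sigma_sets (space M) (\<Union>n. pcyl ` paths n)"
    by (simp add: sets_M space_M fpaths_UN image_UN)
  moreover have "strict_mono (\<lambda>n. n * k)" using k_pos by (auto simp: strict_mono_def)
  ultimately show ?thesis
    using W.wavelet_decomposition[of "\<lambda>n. n * k"]
    unfolding wavelet_V_eq[symmetric] wavelet_W_def[abs_def] by blast
qed

text \<open>The normalising constants agree because corresponding cylinder sets have equal measure,
  so the generators correspond point by point.\<close>

lemma transport_diffs:
  assumes p: "p ` I \<subseteq> fpaths k G"
  shows "transport k M (L2_span \<mu> (diffs \<mu> (\<lambda>i. bcyl k G (p i)) I)) = L2_span M (diffs M (\<lambda>i. pcyl (p i)) I)"
  unfolding diffs_image
proof (rule transport_L2_span[OF to_bratteli_measurable AE_to_bratteli])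
  have *: "normalized_indicator M (pcyl \<gamma>) w = normalized_indicator \<mu> (bcyl k G \<gamma>) (to_bratteli k w)"
    if "\<gamma> \<in> fpaths k G" "w \<in> space M" for \<gamma> w
    using that to_bratteli_bcyl[of w \<gamma>] measure_pcyl[OF that(1)]
    by (simp add: normalized_indicator_def indicator_def space_M)
  fix ij assume "ij \<in> {(i, j). i \<in> I \<and> j \<in> I \<and> i \<noteq> j}"
  then obtain i j where ij: "ij = (i, j)" "p i \<in> fpaths k G" "p j \<in> fpaths k G" using p by auto
  show "(case ij of (i, j) \<Rightarrow> \<lambda>y. normalized_indicator M (pcyl (p i)) y - normalized_indicator M (pcyl (p j)) y) w
    = (case ij of (i, j) \<Rightarrow> \<lambda>y. normalized_indicator \<mu> (bcyl k G (p i)) y - normalized_indicator \<mu> (bcyl k G (p j)) y)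
      (to_bratteli k w)" if "w \<in> space M" for w
    using *[OF ij(2) that] *[OF ij(3) that] by (simp add: ij(1))
  show "(case ij of (i, j) \<Rightarrow> \<lambda>y. normalized_indicator \<mu> (bcyl k G (p i)) y - normalized_indicator \<mu> (bcyl k G (p j)) y) \<in> L2 \<mu>"
    using ij by (simp add: L2_diff \<mu>.normalized_indicator_in_L2 bcyl_sets)
qed

lemma transport_E_minus1: "transport k M (E_minus1 k G \<mu>) = L2_span M {indicator (space M)}"
proof -
  have "transport k M (L2_span \<mu> ((\<lambda>_. indicator (bspace k G)) ` {()})) = L2_span M ((\<lambda>_. indicator (space M)) ` {()})"
  proof (rule transport_L2_span[OF to_bratteli_measurable AE_to_bratteli])
    show "indicator (bspace k G) \<in> L2 \<mu>" using \<mu>.indicator_in_L2[OF sets.top] by (simp add: space_\<mu>)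
    show "indicator (space M) w = (indicator (bspace k G) (to_bratteli k w) :: complex)" if "w \<in> space M" for w
      using that to_bratteli_bspace by (simp add: space_M)
  qed
  then show ?thesis by (simp add: E_minus1_def)
qed

text \<open>The partition by initial vertices is treated as one more splitting, with the whole space
  in the role of the parent cell. Orthogonality to the constants is the mean-zero property of the
  differences.\<close>

lemma V_0_sum: "is_orth_sum M (wavelet_V k G M 0) (transport k M (E_minus1 k G \<mu>)) (transport k M (E_zero k G \<mu>))"
proof -
  let ?Z = "\<lambda>v. pcyl (v, [])"
  let ?D = "diffs M ?Z (verts G)"
  have Z: "?Z v \<in> sets M" "measure M (?Z v) > 0" if "v \<in> verts G" for v
    using W.B_sets[of "(v, [])" 0] W.B_pos[of "(v, [])" 0] that by (auto simp: paths_0)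
  have U: "(\<Union>v\<in>verts G. ?Z v) = space M" using W.B_root by (simp add: paths_0)
  have dj: "disjoint_family_on ?Z (verts G)"
    using W.disjoint_root by (auto simp: paths_0 disjoint_family_on_def)
  have inds: "W.inds (0 * k) = (\<lambda>v. indicator (?Z v)) ` verts G" by (simp add: paths_0 image_image)
  have "W.inds (0 * k) \<subseteq> cspan ({indicator (space M)} \<union> ?D)"
    unfolding inds using W.indicator_in_cspan_diffs[OF finite_verts dj Z] by (auto simp: U)
  moreover have "indicator (space M) = (\<lambda>y. \<Sum>v\<in>verts G. indicator (?Z v) y :: complex)"
    using indicator_UN_sum[OF finite_verts dj] by (intro ext) (simp add: U)
  then have "indicator (space M) \<in> cspan (W.inds (0 * k))"
    unfolding inds by (simp only:) (intro cspan_sum cspan_base imageI)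
  then have "{indicator (space M)} \<union> ?D \<subseteq> cspan (W.inds (0 * k))"
    using diffs_in_cspan[of M ?Z "verts G"] unfolding inds by blast
  ultimately have V: "wavelet_V k G M 0 = L2_span M ({indicator (space M)} \<union> ?D)"
    unfolding wavelet_V_eq by (intro equalityI L2_span_mono cspan_trans)
  have E0: "transport k M (E_zero k G \<mu>) = L2_span M ?D"
    unfolding E_zero_eq by (rule transport_diffs) auto
  note D = W.integral_diffs[OF Z]
  have "L2_inner M (indicator (space M)) g = 0" if "g \<in> ?D" for g
  proof -
    have "L2_inner M (indicator (space M)) g = (LINT y|M. g y)"
      unfolding L2_inner_def by (intro Bochner_Integration.integral_cong) auto
    then show ?thesis using D(2)[OF _ _ that] by simp
  qed
  then show ?thesis
    unfolding V E0 transport_E_minus1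
    by (intro is_orth_sum_L2_span) (use D(1) W.indicator_in_L2 in auto)
qed

text \<open>One wavelet step crosses \<open>k\<close> levels: the cells split on the way from level
  \<open>n * k\<close> to level \<open>Suc n * k\<close> have level \<open>n * k + t\<close> with
  \<open>t < k\<close>.\<close>

lemma details_eq:
  "W.details (n * k) (Suc n * k) =
    (\<Union>\<gamma>\<in>{\<gamma> \<in> fpaths k G. \<exists>t<k. plen \<gamma> = n * k + t}. diffs M (\<lambda>e. pcyl (psnoc \<gamma> e)) (ext \<gamma>))"
proof -
  have "diffs M pcyl (psnoc \<gamma> ` ext \<gamma>) = diffs M (\<lambda>e. pcyl (psnoc \<gamma> e)) (ext \<gamma>)" for \<gamma>
    by (rule diffs_reindex) (simp add: inj_on_def)
  moreover have "(\<Union>j\<in>{n * k..<Suc n * k}. paths j) = {\<gamma> \<in> fpaths k G. \<exists>t<k. plen \<gamma> = n * k + t}"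
    (is "?A = ?B")
  proof (intro equalityI subsetI)
    fix \<gamma> assume "\<gamma> \<in> ?A"
    then have "\<gamma> \<in> fpaths k G" "n * k \<le> plen \<gamma>" "plen \<gamma> < n * k + k" by (auto simp: paths_def)
    then show "\<gamma> \<in> ?B" by (auto intro!: exI[of _ "plen \<gamma> - n * k"])
  qed (auto simp: paths_def)
  ultimately show ?thesis unfolding W.details_def by (simp flip: UN_UN_flatten)
qed

lemma wavelet_W_eq:
  "wavelet_W k G M n = L2_span M (\<Union>\<gamma> \<in> {\<gamma> \<in> fpaths k G. \<exists>t<k. plen \<gamma> = n * k + t}.
     transport k M (E_path k G \<mu> \<gamma>))"
proof -
  have tr: "transport k M (E_path k G \<mu> \<gamma>) = L2_span M (diffs M (\<lambda>e. pcyl (psnoc \<gamma> e)) (ext \<gamma>))"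
    if "\<gamma> \<in> fpaths k G" for \<gamma>
    unfolding E_path_eq using psnoc_fpaths[OF that] by (intro transport_diffs) auto
  have "wavelet_W k G M n = L2_span M (W.details (n * k) (Suc n * k))"
    unfolding wavelet_W_def wavelet_V_eq by (rule W.wavelet_eq_details) simp
  also have "\<dots> = L2_span M (\<Union>\<gamma> \<in> {\<gamma> \<in> fpaths k G. \<exists>t<k. plen \<gamma> = n * k + t}.
     L2_span M (diffs M (\<lambda>e. pcyl (psnoc \<gamma> e)) (ext \<gamma>)))"
    unfolding details_eq
  proof (rule L2_span_UN[symmetric])
    fix \<gamma> assume "\<gamma> \<in> {\<gamma> \<in> fpaths k G. \<exists>t<k. plen \<gamma> = n * k + t}"
    then show "diffs M (\<lambda>e. pcyl (psnoc \<gamma> e)) (ext \<gamma>) \<subseteq> L2 M"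
      using W.details_L2[of "n * k" "Suc n * k"] unfolding details_eq by blast
  qed
  finally show ?thesis using tr by simp
qed

end

theorem theorem4p2:
  fixes k :: nat and \<Lambda> :: "'a kgraph" and x :: "'a \<Rightarrow> real" and \<delta> :: real
    and M :: "((nat \<Rightarrow> nat) \<times> (nat \<Rightarrow> nat) \<Rightarrow> 'a) measure" and \<mu> :: "(nat \<Rightarrow> 'a) measure"
  assumes "k \<ge> 1"
    and "k_graph k \<Lambda>"
    and "finite_kgraph k \<Lambda>"
    and "strongly_connected \<Lambda>"
    and "irreducible_mat (verts \<Lambda>) (adj_prod k \<Lambda>)"
    and "perron_vector k \<Lambda> x"
    and "perron_measure k \<Lambda> x M"
    and "0 < \<delta>" and "\<delta> < 1"
    and "\<And>\<gamma>. \<gamma> \<in> fpaths k \<Lambda> \<Longrightarrow> weight k \<Lambda> x \<delta> \<gamma> = wdiam k \<Lambda> x \<delta> \<gamma>"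
    and "dixmier_measure k \<Lambda> x \<delta> \<mu>"
  shows "(\<forall>s. (\<exists>c. E_minus1 k \<Lambda> \<mu> \<subseteq> LB_eigenspace k \<Lambda> x \<delta> \<mu> s c) \<and>
              (\<exists>c. E_zero k \<Lambda> \<mu> \<subseteq> LB_eigenspace k \<Lambda> x \<delta> \<mu> s c) \<and>
              (\<forall>\<gamma> \<in> fpaths k \<Lambda>. \<exists>c. E_path k \<Lambda> \<mu> \<gamma> \<subseteq> LB_eigenspace k \<Lambda> x \<delta> \<mu> s c)) \<and>
         is_L2_decomposition M (case_nat (wavelet_V k \<Lambda> M 0) (wavelet_W k \<Lambda> M)) \<and>
         is_orth_sum M (wavelet_V k \<Lambda> M 0)
           (transport k M (E_minus1 k \<Lambda> \<mu>)) (transport k M (E_zero k \<Lambda> \<mu>)) \<and>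
         (\<forall>n. wavelet_W k \<Lambda> M n =
           L2_span M (\<Union>\<gamma> \<in> {\<gamma> \<in> fpaths k \<Lambda>. \<exists>t<k. plen \<gamma> = n * k + t}.
             transport k M (E_path k \<Lambda> \<mu> \<gamma>)))"
proof -
  have d: "dixmier_k_graph k \<Lambda> x \<delta> \<mu>"
    using assms
    by (intro dixmier_k_graph.intro perron_k_graph.intro finite_k_graph.intro finite_k_graph_axioms.intro
        perron_k_graph_axioms.intro dixmier_k_graph_axioms.intro)
  interpret L: laplace_k_graph k \<Lambda> x \<delta> \<mu>
    using assms(10) by (intro laplace_k_graph.intro d laplace_k_graph_axioms.intro)
  interpret W: wavelet_k_graph k \<Lambda> x \<delta> \<mu> M
    using assms(7) by (intro wavelet_k_graph.intro d wavelet_k_graph_axioms.intro)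
  show ?thesis
    using L.E_minus1_eigenspace L.E_zero_eigenspace L.E_path_eigenspace
      W.decomposition W.V_0_sum W.wavelet_W_eq
    by blast
qed

end
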